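(* \textsc{Token Sliding} on bipartite graphs is $W[1]$-hard parameterized by $k$ (the number of tokens).
   Context: \textsc{Token Sliding}: given a graph $G$ and two independent sets $S,T$ of $G$ with $|S|=|T|=k\ge1$, decide whether there is a sequence $S=S_0,\dots,S_\ell=T$ of independent sets of size $k$ such that each $S_{i+1}$ is obtained from $S_i$ by replacing one vertex $u\in S_i$ by a vertex $w\notin S_i$ with $uw\in E(G)$. *)

theory Defs
  imports Main
begin

section \<open>Machine model\<close>

text \<open>
  Running times are measured on a random access machine with structured control flow.
  A store consists of numbered arrays, each with cells indexed by the natural numbers; a scalar
  variable is cell 0 of some array. The only arithmetic is addition, truncated subtraction and
  comparison, so at unit cost the model is polynomially equivalent to Turing machines. (Unit-cost
  multiplication would break this.) Every command costs one step irrespective of the expressions in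
  it: their sizes are fixed by the program and only contribute a constant factor.
\<close>

type_synonym store = "nat \<Rightarrow> nat \<Rightarrow> nat"

datatype exp =
    Const nat
  | Cell nat exp
  | Add exp exp
  | Sub exp exp
  | Less exp exp

primrec eval :: "exp \<Rightarrow> store \<Rightarrow> nat" where
  "eval (Const n) s = n"
| "eval (Cell a e) s = s a (eval e s)"
| "eval (Add e e') s = eval e s + eval e' s"
| "eval (Sub e e') s = eval e s - eval e' s"
| "eval (Less e e') s = (if eval e s < eval e' s then 1 else 0)"

datatype com =
    Skip
  | Assign nat exp exp
  | Seq com com
  | If exp com com
  | While exp com

inductive exec :: "com \<Rightarrow> store \<Rightarrow> nat \<Rightarrow> store \<Rightarrow> bool" where
  Skip: "exec Skip s 1 s"
| Assign: "exec (Assign a i e) s 1 (s(a := (s a)(eval i s := eval e s)))"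
| Seq: "exec p s t s' \<Longrightarrow> exec q s' t' s'' \<Longrightarrow> exec (Seq p q) s (t + t') s''"
| IfTrue: "eval e s \<noteq> 0 \<Longrightarrow> exec p s t s' \<Longrightarrow> exec (If e p q) s (1 + t) s'"
| IfFalse: "eval e s = 0 \<Longrightarrow> exec q s t s' \<Longrightarrow> exec (If e p q) s (1 + t) s'"
| WhileFalse: "eval e s = 0 \<Longrightarrow> exec (While e p) s 1 s"
| WhileTrue: "eval e s \<noteq> 0 \<Longrightarrow> exec p s t s' \<Longrightarrow> exec (While e p) s' t' s''
    \<Longrightarrow> exec (While e p) s (1 + t + t') s''"

lemma exec_deterministic:
  "exec p s t s' \<Longrightarrow> exec p s u s'' \<Longrightarrow> u = t \<and> s'' = s'"
proof (induction arbitrary: u s'' rule: exec.induct)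
  case (Skip s)
  then show ?case by (auto elim: exec.cases)
next
  case (Assign a i e s)
  then show ?case by (auto elim: exec.cases)
next
  case (Seq p s t s' q t' s'')
  from Seq.prems show ?case
    by (cases rule: exec.cases) (use Seq.IH in blast)+
next
  case (IfTrue e s p t s' q)
  from IfTrue.prems show ?case
    by (cases rule: exec.cases) (use IfTrue in blast)+
next
  case (IfFalse e s q t s' p)
  from IfFalse.prems show ?case
    by (cases rule: exec.cases) (use IfFalse in blast)+
next
  case (WhileFalse e s p)
  from WhileFalse.prems show ?case
    by (cases rule: exec.cases) (use WhileFalse in blast)+
next
  case (WhileTrue e s p t s' t' s'')
  from WhileTrue.prems show ?case
    by (cases rule: exec.cases) (use WhileTrue in blast)+
qed

text \<open>
  Input and output use the same layout: the word is in array 0, its length in array 1, the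
  parameter in array 2.
\<close>

definition input_store :: "bool list \<Rightarrow> nat \<Rightarrow> store" where
  "input_store x k =
     (\<lambda>a i. if a = 0 then (if i < length x \<and> x ! i then 1 else 0)
            else if a = 1 \<and> i = 0 then length x
            else if a = 2 \<and> i = 0 then k
            else 0)"

definition output_word :: "store \<Rightarrow> bool list" where
  "output_word s = map (\<lambda>i. s 0 i \<noteq> 0) [0..<s 1 0]"

definition output_param :: "store \<Rightarrow> nat" where
  "output_param s = s 2 0"

definition computable :: "(nat \<Rightarrow> nat) \<Rightarrow> bool" where
  "computable f \<longleftrightarrow> (\<exists>p. \<forall>k. \<exists>t s. exec p (input_store [] k) t s \<and> output_param s = f k)"


section \<open>Parameterized problems and reductions\<close>

type_synonym param_problem = "(bool list \<times> nat) set"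

text \<open>
  The length of the output word is charged to the running time, since the machine could otherwise
  announce a word that is exponentially longer than its running time. Monotonicity of the bounds
  is no restriction, as every computable function is bounded by a nondecreasing computable one.
\<close>

definition fpt_reducible :: "param_problem \<Rightarrow> param_problem \<Rightarrow> bool" where
  "fpt_reducible L L' \<longleftrightarrow>
     (\<exists>p f g c. computable f \<and> mono f \<and> computable g \<and> mono g \<and>
        (\<forall>x k. \<exists>t s. exec p (input_store x k) t s \<and>
           t + length (output_word s) \<le> f k * (length x + 1) ^ c \<and>
           output_param s \<le> g k \<and>
           ((x, k) \<in> L \<longleftrightarrow> (output_word s, output_param s) \<in> L')))"


section \<open>Encodings\<close>

definition enc_nat :: "nat \<Rightarrow> bool list" where
  "enc_nat n = replicate n True @ [False]"

definition enc_set :: "nat \<Rightarrow> nat set \<Rightarrow> bool list" where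
  "enc_set n A = map (\<lambda>i. i \<in> A) [0..<n]"

definition enc_rel :: "nat \<Rightarrow> (nat \<Rightarrow> nat \<Rightarrow> bool) \<Rightarrow> bool list" where
  "enc_rel n R = concat (map (\<lambda>i. map (R i) [0..<n]) [0..<n])"


section \<open>Boolean circuits and the W-hierarchy\<close>

text \<open>
  The gates are numbered in a topological order. Gates of in-degree 0 are the input gates, gates of
  in-degree 1 are negations, and a gate of in-degree at least 2 is a conjunction if it belongs to
  \<open>and_gates\<close> and a disjunction otherwise. The last gate is the output gate.
\<close>

record circuit =
  gates :: nat
  wires :: "(nat \<times> nat) set"
  and_gates :: "nat set"

definition wf_circuit :: "circuit \<Rightarrow> bool" where
  "wf_circuit C \<longleftrightarrow> gates C \<ge> 1 \<and> (\<forall>(j, i) \<in> wires C. j < i \<and> i < gates C)"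

definition indegree :: "circuit \<Rightarrow> nat \<Rightarrow> nat" where
  "indegree C i = card {j. (j, i) \<in> wires C}"

definition input_gates :: "circuit \<Rightarrow> nat set" where
  "input_gates C = {i. i < gates C \<and> indegree C i = 0}"

definition output_gate :: "circuit \<Rightarrow> nat" where
  "output_gate C = gates C - 1"

text \<open>\<open>X\<close> is the set of input gates that are set to true.\<close>

fun gate_value :: "circuit \<Rightarrow> nat set \<Rightarrow> nat \<Rightarrow> bool" where
  "gate_value C X i =
     (if indegree C i = 0 then i \<in> X
      else if indegree C i = 1 then (\<exists>j\<in>{..<i}. (j, i) \<in> wires C \<and> \<not> gate_value C X j)
      else if i \<in> and_gates C then (\<forall>j\<in>{..<i}. (j, i) \<in> wires C \<longrightarrow> gate_value C X j)
      else (\<exists>j\<in>{..<i}. (j, i) \<in> wires C \<and> gate_value C X j))"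

declare gate_value.simps [simp del]

definition input_output_paths :: "circuit \<Rightarrow> nat list set" where
  "input_output_paths C =
     {p. p \<noteq> [] \<and> successively (\<lambda>j i. (j, i) \<in> wires C) p \<and>
         hd p \<in> input_gates C \<and> last p = output_gate C}"

definition depth_at_most :: "circuit \<Rightarrow> nat \<Rightarrow> bool" where
  "depth_at_most C d \<longleftrightarrow> (\<forall>p \<in> input_output_paths C. length p - 1 \<le> d)"

definition weft_at_most :: "circuit \<Rightarrow> nat \<Rightarrow> bool" where
  "weft_at_most C t \<longleftrightarrow>
     (\<forall>p \<in> input_output_paths C. length (filter (\<lambda>i. indegree C i > 2) p) \<le> t)"

definition enc_circuit :: "circuit \<Rightarrow> bool list" where
  "enc_circuit C = enc_nat (gates C) @ enc_rel (gates C) (\<lambda>j i. (j, i) \<in> wires C)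
     @ enc_set (gates C) (and_gates C)"

definition weighted_circuit_sat :: "nat \<Rightarrow> nat \<Rightarrow> param_problem" where
  "weighted_circuit_sat t d =
     {(enc_circuit C, k) | C k.
        wf_circuit C \<and> weft_at_most C t \<and> depth_at_most C d \<and>
        (\<exists>X \<subseteq> input_gates C. card X = k \<and> gate_value C X (output_gate C))}"

definition W :: "nat \<Rightarrow> param_problem set" where
  "W t = {L. \<exists>d\<ge>1. fpt_reducible L (weighted_circuit_sat t d)}"

definition W_hard :: "nat \<Rightarrow> param_problem \<Rightarrow> bool" where
  "W_hard t L \<longleftrightarrow> (\<forall>L' \<in> W t. fpt_reducible L' L)"


section \<open>Token sliding\<close>

definition simple_graph :: "'a set \<Rightarrow> 'a set set \<Rightarrow> bool" where
  "simple_graph V E \<longleftrightarrow> finite V \<and> (\<forall>e\<in>E. \<exists>u\<in>V. \<exists>v\<in>V. u \<noteq> v \<and> e = {u, v})"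

definition bipartite :: "'a set \<Rightarrow> 'a set set \<Rightarrow> bool" where
  "bipartite V E \<longleftrightarrow>
     (\<exists>A B. A \<union> B = V \<and> A \<inter> B = {} \<and> (\<forall>e\<in>E. \<exists>a\<in>A. \<exists>b\<in>B. e = {a, b}))"

definition independent :: "'a set \<Rightarrow> 'a set set \<Rightarrow> 'a set \<Rightarrow> bool" where
  "independent V E S \<longleftrightarrow> S \<subseteq> V \<and> (\<forall>u\<in>S. \<forall>v\<in>S. {u, v} \<notin> E)"

definition slide :: "'a set \<Rightarrow> 'a set set \<Rightarrow> 'a set \<Rightarrow> 'a set \<Rightarrow> bool" where
  "slide V E S S' \<longleftrightarrow> independent V E S \<and> independent V E S' \<and>
     (\<exists>u w. u \<in> S \<and> w \<notin> S \<and> {u, w} \<in> E \<and> S' = insert w (S - {u}))"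

definition token_sliding_yes :: "'a set \<Rightarrow> 'a set set \<Rightarrow> 'a set \<Rightarrow> 'a set \<Rightarrow> nat \<Rightarrow> bool" where
  "token_sliding_yes V E S T k \<longleftrightarrow>
     k \<ge> 1 \<and> independent V E S \<and> independent V E T \<and> card S = k \<and> card T = k \<and>
     (slide V E)\<^sup>*\<^sup>* S T"

definition enc_ts :: "nat \<Rightarrow> nat set set \<Rightarrow> nat set \<Rightarrow> nat set \<Rightarrow> bool list" where
  "enc_ts n E S T = enc_nat n @ enc_rel n (\<lambda>u v. {u, v} \<in> E) @ enc_set n S @ enc_set n T"

definition token_sliding_bipartite :: param_problem where
  "token_sliding_bipartite =
     {(enc_ts n E S T, k) | n E S T k.
        simple_graph {..<n} E \<and> bipartite {..<n} E \<and> token_sliding_yes {..<n} E S T k}"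

end

theory Submission imports Defs begin

text \<open>
Bounded sums over the input word, closed under addition, truncated subtraction and comparison, are computable
in polynomial time. A reduction to satisfiability of circuits of weft 1 and depth \<open>d\<close> can therefore be followed by
any map each bit of whose output is such a sum.

A choice of \<open>k\<close> input gates is a sequence \<open>0 = s 0 < s 1 < \<dots> < s (k + 1) = n + 1\<close>: one entry shows that a gate is
chosen, and two consecutive entries show that the gates between them are not. The extra entry \<open>s (k + 2)\<close> is a
certificate, which names a true child of the disjunctions on the way. The circuit accepts iff, for some such
sequence, no view of at most \<open>2 * 2 ^ d + 1\<close> entries refutes the certificate. Boundedly many entries suffice
because a big conjunction is refuted by a single child, and by weft 1 the value of that child depends on boundedly
many gates. The views are the variables of a bipartite binary constraint problem, whose number is bounded in
\<open>k\<close> and \<open>d\<close>.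

Every variable becomes a cell of the graph. The guards, the home token and the checker of a cell dominate its
unoccupied vertices against the other cells, so no token changes its cell. The lock starts next to the homes of the
checkers on the right, hence has to move to \<open>Lock_On\<close>, which is next to the homes of the checkers on the left, to let
the right checkers in from their pools. It can come back only while no checker is at home. If all right
checkers are inside by then, every cell has a token on a port, and tokens on ports of the two sides are
non-adjacent exactly if the values are compatible.
\<close>

section \<open>Bounded sums as programs\<close>

text \<open>A bipartite graph has no triangles that would confine a token, so a gadget can bind its
  tokens only by domination: no token can move to a vertex that has a second occupied neighbour.
  Hence the several tokens per cell, and the need to follow them into useless states as well. The
  number of tokens may depend on \<open>k\<close> and \<open>d\<close> only, so the witnesses of
  unbounded disjunctions cannot be spread over tokens; they are hidden in the value of a single
  entry, whose range may grow with the input. The constant \<open>2 * 2 ^ d + 1\<close> counts two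
  entries for each of at most \<open>2 ^ d\<close> input gates met where no gate has more than two
  inputs, and one entry for the certificate. Constraints join only left and right variables, so
  every variable occurs on both sides, and agreement on shared indices glues the two copies
  together. Depth and weft of the given circuit are not promised but have to be tested; the test is
  a conjunct of every constraint, so that a bad word yields an instance without solution. As
  \<open>d\<close> is a constant of the reduction, a fixed nesting of bounded sums expresses all of
  this.\<close>

definition bit :: "bool list \<Rightarrow> nat \<Rightarrow> nat" where
  "bit x i = of_bool (i < length x \<and> x ! i)"

fun peek :: "nat list \<Rightarrow> nat" where
  "peek [] = 0"
| "peek (a # s) = a"

text \<open>The list \<open>s\<close> is an environment in the style of de Bruijn:
  \<open>sum\<close> pushes its index, and \<open>pop\<close> skips the innermost variable. The
  bound of a sum is itself such a term, so sizes stay polynomial. Multiplication is no primitive,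
  since the machine has none; it comes back as a repeated sum.\<close>

inductive poly_term :: "(bool list \<Rightarrow> nat list \<Rightarrow> nat) \<Rightarrow> bool" where
  const: "poly_term (\<lambda>x s. c)"
| peek: "poly_term (\<lambda>x s. peek s)"
| pop: "poly_term f \<Longrightarrow> poly_term (\<lambda>x s. f x (tl s))"
| len: "poly_term (\<lambda>x s. length x)"
| bit: "poly_term f \<Longrightarrow> poly_term (\<lambda>x s. bit x (f x s))"
| add: "poly_term f \<Longrightarrow> poly_term g \<Longrightarrow> poly_term (\<lambda>x s. f x s + g x s)"
| sub: "poly_term f \<Longrightarrow> poly_term g \<Longrightarrow> poly_term (\<lambda>x s. f x s - g x s)"
| less: "poly_term f \<Longrightarrow> poly_term g \<Longrightarrow> poly_term (\<lambda>x s. of_bool (f x s < g x s))"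
| sum: "poly_term f \<Longrightarrow> poly_term g \<Longrightarrow> poly_term (\<lambda>x s. \<Sum>i<f x s. g x (i # s))"

definition same_below :: "nat \<Rightarrow> store \<Rightarrow> store \<Rightarrow> bool" where
  "same_below h \<sigma> \<sigma>' \<longleftrightarrow> (\<forall>a i. a \<noteq> 3 \<or> i < h \<longrightarrow> \<sigma>' a i = \<sigma> a i)"

lemma same_below_output: "same_below h \<sigma> \<sigma>' \<Longrightarrow> output_word \<sigma>' = output_word \<sigma>"
  by (simp add: same_below_def output_word_def)

lemma length_output_word: "length (output_word \<sigma>) = \<sigma> 1 0"
  by (simp add: output_word_def)

lemma while_loop:
  assumes step: "\<And>i \<sigma>. i < n \<Longrightarrow> I i \<sigma> \<Longrightarrow> eval e \<sigma> \<noteq> 0 \<and> (\<exists>t \<sigma>'. exec P \<sigma> t \<sigma>' \<and> t \<le> T \<and> I (Suc i) \<sigma>')"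
    and stop: "\<And>\<sigma>. I n \<sigma> \<Longrightarrow> eval e \<sigma> = 0"
    and "I i \<sigma>" "i \<le> n"
  shows "\<exists>t \<sigma>'. exec (While e P) \<sigma> t \<sigma>' \<and> t \<le> 1 + (n - i) * (T + 1) \<and> I n \<sigma>'"
  using assms(3,4)
proof (induction "n - i" arbitrary: i \<sigma>)
  case 0
  then have "i = n" by simp
  then show ?case using stop[of \<sigma>] exec.WhileFalse[of e \<sigma> P] 0 by (intro exI[of _ 1] exI[of _ \<sigma>]) simp
next
  case (Suc d)
  then have i: "i < n" "d = n - Suc i" "Suc i \<le> n" by auto
  then obtain t \<sigma>' where 1: "eval e \<sigma> \<noteq> 0" "exec P \<sigma> t \<sigma>'" "t \<le> T" "I (Suc i) \<sigma>'" using step Suc.prems by blast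
  from Suc.hyps(1)[OF i(2) 1(4) i(3)] obtain t' \<sigma>'' where
    2: "exec (While e P) \<sigma>' t' \<sigma>''" "t' \<le> 1 + (n - Suc i) * (T + 1)" "I n \<sigma>''" by blast
  have "exec (While e P) \<sigma> (1 + t + t') \<sigma>''" using 1 2 by (intro exec.WhileTrue)
  moreover have "n - i = Suc (n - Suc i)" using i by simp
  then have "1 + t + t' \<le> 1 + (n - i) * (T + 1)" using 1(3) 2(2) by simp
  ultimately show ?case using 2 by blast
qed

text \<open>The scratch space is array 3 from index \<open>h\<close> on; the arguments are at the indices \<open>ps\<close>, and the result is left at \<open>h\<close>.
The same \<open>M\<close> bounds arguments, values and running time, so that exponents simply add up under composition.\<close>
definition compiled :: "(bool list \<Rightarrow> nat list \<Rightarrow> nat) \<Rightarrow> nat \<Rightarrow> nat list \<Rightarrow> nat \<Rightarrow> com \<Rightarrow> bool" where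
  "compiled f a ps h P \<longleftrightarrow> (\<forall>\<sigma> M. length (output_word \<sigma>) \<le> M \<longrightarrow> (\<forall>p\<in>set ps. \<sigma> 3 p \<le> M) \<longrightarrow> 2 \<le> M \<longrightarrow>
     f (output_word \<sigma>) (map (\<sigma> 3) ps) \<le> M ^ a \<and>
     (\<exists>t \<sigma>'. exec P \<sigma> t \<sigma>' \<and> t \<le> M ^ a \<and> same_below h \<sigma> \<sigma>' \<and>
        \<sigma>' 3 h = f (output_word \<sigma>) (map (\<sigma> 3) ps)))"

definition compilable :: "(bool list \<Rightarrow> nat list \<Rightarrow> nat) \<Rightarrow> nat \<Rightarrow> bool" where
  "compilable f a \<longleftrightarrow> (\<forall>ps h. (\<forall>p\<in>set ps. p < h) \<longrightarrow> (\<exists>P. compiled f a ps h P))"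

lemma compiledD:
  assumes "compiled f a ps h P" "length (output_word \<sigma>) \<le> M" "\<forall>p\<in>set ps. \<sigma> 3 p \<le> M" "2 \<le> M"
  obtains t \<sigma>' where "f (output_word \<sigma>) (map (\<sigma> 3) ps) \<le> M ^ a" "exec P \<sigma> t \<sigma>'" "t \<le> M ^ a" "same_below h \<sigma> \<sigma>'"
    "\<sigma>' 3 h = f (output_word \<sigma>) (map (\<sigma> 3) ps)"
  using assms unfolding compiled_def by blast

abbreviation (input) scr :: "nat \<Rightarrow> exp" where "scr h \<equiv> Cell 3 (Const h)"

lemma pow_ge: "2 \<le> M \<Longrightarrow> c \<le> a \<Longrightarrow> c \<le> (M::nat) ^ a"
proof -
  assume "2 \<le> M" "c \<le> a"
  have "c \<le> 2 ^ c" using less_exp[of c] by simp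
  also have "\<dots> \<le> M ^ c" using \<open>2 \<le> M\<close> by (rule power_mono) simp
  also have "\<dots> \<le> M ^ a" using \<open>2 \<le> M\<close> \<open>c \<le> a\<close> by (intro power_increasing) auto
  finally show ?thesis .
qed

text \<open>As \<open>M\<close> is at least 2, a constant factor costs only a larger exponent; the
  small summands in the exponents below arise in this way.\<close>

lemma pow_absorb: "2 \<le> M \<Longrightarrow> c \<le> 2 ^ d \<Longrightarrow> a + d \<le> b \<Longrightarrow> c * M ^ a \<le> (M::nat) ^ b"
proof -
  assume *: "2 \<le> M" "c \<le> 2 ^ d" "a + d \<le> b"
  have "c * M ^ a \<le> M ^ d * M ^ a" using *(1,2) power_mono[of 2 M d] by (intro mult_right_mono) auto
  also have "\<dots> = M ^ (a + d)" by (simp add: power_add)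
  also have "\<dots> \<le> M ^ b" using * by (intro power_increasing) auto
  finally show ?thesis .
qed

lemma pow_le: "2 \<le> M \<Longrightarrow> a \<le> b \<Longrightarrow> (M::nat) ^ a \<le> M ^ b"
  by (intro power_increasing) auto

lemma compile_simple:
  assumes "\<And>\<sigma> M. length (output_word \<sigma>) \<le> M \<Longrightarrow> \<forall>p\<in>set ps. \<sigma> 3 p \<le> M \<Longrightarrow> 2 \<le> M \<Longrightarrow>
     eval e \<sigma> = f (output_word \<sigma>) (map (\<sigma> 3) ps) \<and> eval e \<sigma> \<le> M ^ a" "a \<ge> 1"
  shows "compiled f a ps h (Assign 3 (Const h) e)"
  unfolding compiled_def
proof (intro allI impI)
  fix \<sigma> :: store and M assume M: "length (output_word \<sigma>) \<le> M" "\<forall>p\<in>set ps. \<sigma> 3 p \<le> M" "2 \<le> M"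
  have e: "eval e \<sigma> = f (output_word \<sigma>) (map (\<sigma> 3) ps)" "eval e \<sigma> \<le> M ^ a" using assms(1)[OF M] by auto
  have "1 \<le> M ^ a" using M by simp
  then show "f (output_word \<sigma>) (map (\<sigma> 3) ps) \<le> M ^ a \<and> (\<exists>t \<sigma>'. exec (Assign 3 (Const h) e) \<sigma> t \<sigma>' \<and> t \<le> M ^ a
    \<and> same_below h \<sigma> \<sigma>' \<and> \<sigma>' 3 h = f (output_word \<sigma>) (map (\<sigma> 3) ps))"
    using e exec.Assign[of 3 "Const h" e \<sigma>]
    by (intro conjI exI[of _ 1] exI[of _ "\<sigma>(3 := (\<sigma> 3)(h := eval e \<sigma>))"]) (auto simp: same_below_def)
qed

lemma compile_binary:
  assumes f: "compilable f a" and g: "compilable g b"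
    and op: "\<And>\<sigma>. eval (op (scr h) (scr (Suc h))) \<sigma> = F (\<sigma> 3 h) (\<sigma> 3 (Suc h))" "\<And>m n. F m n \<le> m + n + 1"
    and ps: "\<forall>p\<in>set ps. p < h"
  shows "\<exists>P. compiled (\<lambda>x s. F (f x s) (g x s)) (a + b + 2) ps h P"
proof -
  obtain P where P: "compiled f a ps h P" using f ps unfolding compilable_def by blast
  \<comment> \<open>\<open>g\<close> is compiled one cell higher, so that its run preserves the
    value of \<open>f\<close> at \<open>h\<close>.\<close>
  have "\<forall>p\<in>set ps. p < Suc h" using ps by auto
  then obtain Q where Q: "compiled g b ps (Suc h) Q" using g unfolding compilable_def by blast
  show ?thesis
    unfolding compiled_def
  proof (intro exI allI impI)
    fix \<sigma> :: store and M assume M: "length (output_word \<sigma>) \<le> M" "\<forall>p\<in>set ps. \<sigma> 3 p \<le> M" "2 \<le> M"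
    let ?x = "output_word \<sigma>" and ?s = "map (\<sigma> 3) ps"
    obtain t1 \<sigma>1 where 1: "f ?x ?s \<le> M ^ a" "exec P \<sigma> t1 \<sigma>1" "t1 \<le> M ^ a" "same_below h \<sigma> \<sigma>1" "\<sigma>1 3 h = f ?x ?s"
      using compiledD[OF P M] .
    have eq: "output_word \<sigma>1 = ?x" "map (\<sigma>1 3) ps = ?s" "\<And>p. p \<in> set ps \<Longrightarrow> \<sigma>1 3 p = \<sigma> 3 p"
      using 1(4) ps by (auto simp: same_below_output) (auto simp: same_below_def)
    have M1: "length (output_word \<sigma>1) \<le> M" "\<forall>p\<in>set ps. \<sigma>1 3 p \<le> M" using M eq by auto
    obtain t2 \<sigma>2 where 2: "g ?x ?s \<le> M ^ b" "exec Q \<sigma>1 t2 \<sigma>2" "t2 \<le> M ^ b" "same_below (Suc h) \<sigma>1 \<sigma>2"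
      "\<sigma>2 3 (Suc h) = g ?x ?s"
      using compiledD[OF Q M1 M(3)] unfolding eq .
    have v: "\<sigma>2 3 h = f ?x ?s" using 1 2 by (simp add: same_below_def)
    let ?e = "op (scr h) (scr (Suc h))" and ?\<sigma>3 = "\<sigma>2(3 := (\<sigma>2 3)(h := F (f ?x ?s) (g ?x ?s)))"
    have ev: "eval ?e \<sigma>2 = F (f ?x ?s) (g ?x ?s)" using op(1) v 2 by simp
    have "exec (Assign 3 (Const h) ?e) \<sigma>2 1 ?\<sigma>3" using exec.Assign[of 3 "Const h" ?e \<sigma>2] ev by simp
    then have "exec (Seq P (Seq Q (Assign 3 (Const h) ?e))) \<sigma> (t1 + (t2 + 1)) ?\<sigma>3"
      using 1 2 by (intro exec.Seq)
    moreover have bound: "M ^ a + M ^ b + 1 \<le> M ^ (a + b + 2)"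
    proof -
      have "M ^ a \<le> M ^ (a + b)" "M ^ b \<le> M ^ (a + b)" "1 \<le> M ^ (a + b)" using M(3) by (auto intro!: pow_le)
      then have "M ^ a + M ^ b + 1 \<le> 3 * M ^ (a + b)" by simp
      also have "\<dots> \<le> M ^ (a + b + 2)" using M(3) by (intro pow_absorb[of _ _ 2]) auto
      finally show ?thesis .
    qed
    moreover have "same_below h \<sigma> ?\<sigma>3" using 1(4) 2(4) by (auto simp: same_below_def)
    moreover have "F (f ?x ?s) (g ?x ?s) \<le> M ^ (a + b + 2)" using op(2)[of "f ?x ?s" "g ?x ?s"] 1(1) 2(1) bound by simp
    ultimately show "F (f ?x ?s) (g ?x ?s) \<le> M ^ (a + b + 2) \<and> (\<exists>t \<sigma>'. exec (Seq P (Seq Q (Assign 3 (Const h) ?e))) \<sigma> t \<sigma>' \<and>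
      t \<le> M ^ (a + b + 2) \<and> same_below h \<sigma> \<sigma>' \<and> \<sigma>' 3 h = F (f ?x ?s) (g ?x ?s))"
      using 1(3) 2(3) by (intro conjI exI[of _ "t1 + (t2 + 1)"] exI[of _ ?\<sigma>3]) auto
  qed
qed

lemma compile_bit:
  assumes f: "compilable f a"
    and ps: "\<forall>p\<in>set ps. p < h"
  shows "\<exists>P. compiled (\<lambda>x s. bit x (f x s)) (a + 2) ps h P"
proof -
  obtain P where P: "compiled f a ps h P" using f ps unfolding compilable_def by blast
  let ?Q = "If (Less (scr h) (Cell 1 (Const 0))) (If (Cell 0 (scr h)) (Assign 3 (Const h) (Const 1)) (Assign 3 (Const h) (Const 0)))
    (Assign 3 (Const h) (Const 0))"
  show ?thesis
    unfolding compiled_def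
  proof (intro exI allI impI)
    fix \<sigma> :: store and M assume M: "length (output_word \<sigma>) \<le> M" "\<forall>p\<in>set ps. \<sigma> 3 p \<le> M" "2 \<le> M"
    let ?x = "output_word \<sigma>" and ?s = "map (\<sigma> 3) ps"
    obtain t1 \<sigma>1 where 1: "f ?x ?s \<le> M ^ a" "exec P \<sigma> t1 \<sigma>1" "t1 \<le> M ^ a" "same_below h \<sigma> \<sigma>1" "\<sigma>1 3 h = f ?x ?s"
      using compiledD[OF P M] .
    have ow: "output_word \<sigma>1 = ?x" using 1(4) by (rule same_below_output)
    let ?b = "bit ?x (f ?x ?s)"
    let ?\<sigma>2 = "\<sigma>1(3 := (\<sigma>1 3)(h := ?b))"
    have b: "?b = of_bool (f ?x ?s < \<sigma>1 1 0 \<and> \<sigma>1 0 (f ?x ?s) \<noteq> 0)"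
      unfolding ow[symmetric] by (auto simp: bit_def output_word_def)
    have a0: "exec (Assign 3 (Const h) (Const c)) \<sigma>1 1 (\<sigma>1(3 := (\<sigma>1 3)(h := c)))" for c
      using exec.Assign[of 3 "Const h" "Const c" \<sigma>1] by simp
    have "\<exists>t\<le>3. exec ?Q \<sigma>1 t ?\<sigma>2"
    proof (cases "f ?x ?s < \<sigma>1 1 0")
      case True
      then have e: "eval (Less (scr h) (Cell 1 (Const 0))) \<sigma>1 \<noteq> 0" using 1 by simp
      show ?thesis
      proof (cases "\<sigma>1 0 (f ?x ?s) = 0")
        case False
        then have "eval (Cell 0 (scr h)) \<sigma>1 \<noteq> 0" "?b = 1" using 1 True b by auto
        then have "exec ?Q \<sigma>1 (1 + (1 + 1)) ?\<sigma>2" using a0[of 1] by (intro exec.IfTrue[OF e] exec.IfTrue) simp_all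
        then show ?thesis by (intro exI[of _ "1 + (1 + 1)"]) simp
      next
        case False': True
        then have "eval (Cell 0 (scr h)) \<sigma>1 = 0" "?b = 0" using 1 b by auto
        then have "exec ?Q \<sigma>1 (1 + (1 + 1)) ?\<sigma>2" using a0[of 0] by (intro exec.IfTrue[OF e] exec.IfFalse) simp_all
        then show ?thesis by (intro exI[of _ "1 + (1 + 1)"]) simp
      qed
    next
      case False
      then have "eval (Less (scr h) (Cell 1 (Const 0))) \<sigma>1 = 0" "?b = 0" using 1 b by auto
      then have "exec ?Q \<sigma>1 (1 + 1) ?\<sigma>2" using a0[of 0] by (intro exec.IfFalse) simp_all
      then show ?thesis by (intro exI[of _ "1 + 1"]) simp
    qed
    then obtain t2 where 2: "t2 \<le> 3" "exec ?Q \<sigma>1 t2 ?\<sigma>2" by blast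
    have "exec (Seq P ?Q) \<sigma> (t1 + t2) ?\<sigma>2" using 1 2 by (intro exec.Seq)
    moreover have "t1 + t2 \<le> M ^ (a + 2)"
    proof -
      have "1 \<le> M ^ a" using M(3) by simp
      then have "t1 + t2 \<le> 4 * M ^ a" using 1(3) 2(1) by linarith
      also have "\<dots> \<le> M ^ (a + 2)" using M(3) by (intro pow_absorb[of _ _ 2]) auto
      finally show ?thesis .
    qed
    moreover have "same_below h \<sigma> ?\<sigma>2" using 1(4) by (auto simp: same_below_def)
    moreover have "1 \<le> M ^ (a + 2)" using M(3) by simp
    then have "?b \<le> M ^ (a + 2)" by (simp add: bit_def)
    ultimately show "?b \<le> M ^ (a + 2) \<and> (\<exists>t \<sigma>'. exec (Seq P ?Q) \<sigma> t \<sigma>' \<and> t \<le> M ^ (a + 2) \<and> same_below h \<sigma> \<sigma>' \<and> \<sigma>' 3 h = ?b)"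
      by (intro conjI exI[of _ "t1 + t2"] exI[of _ ?\<sigma>2]) auto
  qed
qed

lemma compile_sum:
  assumes f: "compilable f a" and g: "compilable g b"
    and ps: "\<forall>p\<in>set ps. p < h"
  shows "\<exists>P. compiled (\<lambda>x s. \<Sum>i<f x s. g x (i # s)) (a + (a + 1) * b + 4) ps h P"
proof -
  obtain P where P: "compiled f a ps h P" using f ps unfolding compilable_def by blast
  \<comment> \<open>The bound is kept at \<open>h\<close>, the index at \<open>h + 1\<close> and the
    partial sum at \<open>h + 2\<close>; hence the body works from \<open>h + 3\<close> on, with the
    index as its first argument.\<close>
  have "\<forall>p\<in>set (Suc h # ps). p < h + 3" using ps by auto
  then obtain Q where Q: "compiled g b (Suc h # ps) (h + 3) Q" using g unfolding compilable_def by blast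
  let ?e = "Less (scr (Suc h)) (scr h)"
  let ?B = "Seq Q (Seq (Assign 3 (Const (h + 2)) (Add (scr (h + 2)) (scr (h + 3)))) (Assign 3 (Const (Suc h)) (Add (scr (Suc h)) (Const 1))))"
  let ?R = "Seq P (Seq (Assign 3 (Const (Suc h)) (Const 0)) (Seq (Assign 3 (Const (h + 2)) (Const 0))
    (Seq (While ?e ?B) (Assign 3 (Const h) (scr (h + 2))))))"
  show ?thesis
    unfolding compiled_def
  proof (intro exI allI impI)
    fix \<sigma> :: store and M assume M: "length (output_word \<sigma>) \<le> M" "\<forall>p\<in>set ps. \<sigma> 3 p \<le> M" "2 \<le> M"
    let ?x = "output_word \<sigma>" and ?s = "map (\<sigma> 3) ps"
    define n where "n = f ?x ?s"
    obtain t1 \<sigma>1 where 1: "n \<le> M ^ a" "exec P \<sigma> t1 \<sigma>1" "t1 \<le> M ^ a" "same_below h \<sigma> \<sigma>1" "\<sigma>1 3 h = n"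
      unfolding n_def using compiledD[OF P M] .
    \<comment> \<open>The old arguments are at most \<open>M\<close>, the index is at most
      \<open>M ^ a\<close>, and \<open>N\<close> bounds both. One run of \<open>Q\<close> then costs
      at most \<open>N ^ b\<close>, which explains the term \<open>(a + 1) * b\<close> of the
      exponent.\<close>
    define N where "N = M ^ (a + 1)"
    have MN: "M \<le> N" "M ^ a \<le> N" using M(3) unfolding N_def by (simp_all add: self_le_power)
    have N: "2 \<le> N" using M(3) MN by simp
    define I where "I i \<tau> \<longleftrightarrow> same_below h \<sigma> \<tau> \<and> \<tau> 3 h = n \<and> \<tau> 3 (Suc h) = i \<and> \<tau> 3 (h + 2) = (\<Sum>j<i. g ?x (j # ?s))" for i \<tau>
    have step: "eval ?e \<tau> \<noteq> 0 \<and> g ?x (i # ?s) \<le> N ^ b \<and> (\<exists>t \<tau>'. exec ?B \<tau> t \<tau>' \<and> t \<le> N ^ b + 2 \<and> I (Suc i) \<tau>')"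
      if "i < n" "I i \<tau>" for i \<tau>
    proof -
      have I: "same_below h \<sigma> \<tau>" "\<tau> 3 h = n" "\<tau> 3 (Suc h) = i" "\<tau> 3 (h + 2) = (\<Sum>j<i. g ?x (j # ?s))"
        using that(2) unfolding I_def by auto
      have ow: "output_word \<tau> = ?x" using I(1) by (rule same_below_output)
      have eqp: "\<tau> 3 p = \<sigma> 3 p" if "p \<in> set ps" for p using I(1) that ps by (auto simp: same_below_def)
      have mp: "map (\<tau> 3) (Suc h # ps) = i # ?s" using I(3) eqp by auto
      have "length (output_word \<tau>) \<le> N" using M(1) MN ow by simp
      moreover have "\<forall>p\<in>set (Suc h # ps). \<tau> 3 p \<le> N" using M(2) MN 1(1) I(3) that(1) eqp by fastforce
      ultimately obtain t \<tau>1 where 2: "g ?x (i # ?s) \<le> N ^ b" "exec Q \<tau> t \<tau>1" "t \<le> N ^ b" "same_below (h + 3) \<tau> \<tau>1"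
        "\<tau>1 3 (h + 3) = g ?x (i # ?s)"
        using compiledD[OF Q _ _ N, of \<tau>] unfolding ow mp by metis
      let ?\<tau>2 = "\<tau>1(3 := (\<tau>1 3)(h + 2 := (\<Sum>j<Suc i. g ?x (j # ?s))))"
      let ?\<tau>3 = "?\<tau>2(3 := (?\<tau>2 3)(Suc h := Suc i))"
      have k: "\<tau>1 3 (h + 2) = (\<Sum>j<i. g ?x (j # ?s))" "\<tau>1 3 (Suc h) = i" "\<tau>1 3 h = n"
        using 2(4) I by (auto simp: same_below_def)
      have "exec (Assign 3 (Const (h + 2)) (Add (scr (h + 2)) (scr (h + 3)))) \<tau>1 1 ?\<tau>2"
        using exec.Assign[of 3 "Const (h + 2)" "Add (scr (h + 2)) (scr (h + 3))" \<tau>1] k 2(5) by simp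
      moreover have "exec (Assign 3 (Const (Suc h)) (Add (scr (Suc h)) (Const 1))) ?\<tau>2 1 ?\<tau>3"
        using exec.Assign[of 3 "Const (Suc h)" "Add (scr (Suc h)) (Const 1)" ?\<tau>2] k by simp
      ultimately have "exec ?B \<tau> (t + (1 + 1)) ?\<tau>3" using 2 by (intro exec.Seq)
      moreover have "same_below h \<sigma> ?\<tau>3" using I(1) 2(4) by (auto simp: same_below_def)
      then have "I (Suc i) ?\<tau>3" using k unfolding I_def by simp
      moreover have "eval ?e \<tau> \<noteq> 0" using I that(1) by simp
      ultimately show ?thesis using 2(1,3) by (intro conjI exI[of _ "t + (1 + 1)"] exI[of _ ?\<tau>3]) auto
    qed
    let ?\<sigma>2 = "\<sigma>1(3 := (\<sigma>1 3)(Suc h := 0))"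
    let ?\<sigma>3 = "?\<sigma>2(3 := (?\<sigma>2 3)(h + 2 := 0))"
    have i0: "I 0 ?\<sigma>3" using 1 unfolding I_def by (auto simp: same_below_def)
    have stop: "eval ?e \<tau> = 0" if "I n \<tau>" for \<tau> using that unfolding I_def by simp
    have "\<exists>t \<sigma>'. exec (While ?e ?B) ?\<sigma>3 t \<sigma>' \<and> t \<le> 1 + (n - 0) * ((N ^ b + 2) + 1) \<and> I n \<sigma>'"
      by (rule while_loop[where I = I]) (use step stop i0 in auto)
    moreover have "1 + (n - 0) * ((N ^ b + 2) + 1) = 1 + n * (N ^ b + 3)" by (simp add: algebra_simps)
    ultimately obtain t4 \<sigma>4 where 4: "exec (While ?e ?B) ?\<sigma>3 t4 \<sigma>4" "t4 \<le> 1 + n * (N ^ b + 3)" "I n \<sigma>4" by metis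
    let ?v = "\<Sum>i<n. g ?x (i # ?s)"
    let ?\<sigma>5 = "\<sigma>4(3 := (\<sigma>4 3)(h := ?v))"
    have "exec (Assign 3 (Const h) (scr (h + 2))) \<sigma>4 1 ?\<sigma>5"
      using exec.Assign[of 3 "Const h" "scr (h + 2)" \<sigma>4] 4(3) unfolding I_def by simp
    moreover have "exec (Assign 3 (Const (Suc h)) (Const 0)) \<sigma>1 1 ?\<sigma>2"
      using exec.Assign[of 3 "Const (Suc h)" "Const 0" \<sigma>1] by simp
    moreover have "exec (Assign 3 (Const (h + 2)) (Const 0)) ?\<sigma>2 1 ?\<sigma>3"
      using exec.Assign[of 3 "Const (h + 2)" "Const 0" ?\<sigma>2] by simp
    ultimately have ex: "exec ?R \<sigma> (t1 + (1 + (1 + (t4 + 1)))) ?\<sigma>5"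
      using 1(2) 4(1) by (intro exec.Seq)
    have Nb: "N ^ b = M ^ ((a + 1) * b)" unfolding N_def by (simp only: power_mult)
    let ?c = "a + (a + 1) * b"
    have le: "M ^ a \<le> M ^ ?c" "1 \<le> M ^ ?c" using M(3) by (auto intro: pow_le)
    have nN: "n * N ^ b \<le> M ^ ?c" unfolding power_add Nb using 1(1) by (rule mult_right_mono) simp
    have "t1 + (1 + (1 + (t4 + 1))) \<le> M ^ a + 4 + n * N ^ b + 3 * n" using 1(3) 4(2) by (simp add: algebra_simps)
    also have "\<dots> \<le> 9 * M ^ ?c" using le nN 1(1) by linarith
    also have "\<dots> \<le> M ^ (?c + 4)" using M(3) by (intro pow_absorb[of _ _ 4]) auto
    finally have time: "t1 + (1 + (1 + (t4 + 1))) \<le> M ^ (?c + 4)" .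
    have "?v \<le> (\<Sum>i<n. N ^ b)"
    proof (rule sum_mono)
      fix i assume "i \<in> {..<n}"
      then have i: "i < n" by simp
      \<comment> \<open>\<open>compiled\<close> bounds a value only at a store that holds the
        arguments, so a store with index \<open>i\<close> has to be exhibited.\<close>
      obtain \<tau> where "I i \<tau>"
      proof -
        have "I i (\<sigma>1(3 := (\<sigma>1 3)(Suc h := i, h + 2 := (\<Sum>j<i. g ?x (j # ?s)))))" using 1 unfolding I_def by (auto simp: same_below_def)
        then show ?thesis using that by blast
      qed
      then show "g ?x (i # ?s) \<le> N ^ b" using step[OF i] by blast
    qed
    also have "\<dots> \<le> M ^ (?c + 4)" using nN pow_le[OF M(3), of ?c "?c + 4"] by simp
    finally have val: "?v \<le> M ^ (?c + 4)" .
    have "same_below h \<sigma> ?\<sigma>5" using 4(3) unfolding I_def by (auto simp: same_below_def)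
    then show "(\<Sum>i<f ?x ?s. g ?x (i # ?s)) \<le> M ^ (?c + 4) \<and> (\<exists>t \<sigma>'. exec ?R \<sigma> t \<sigma>' \<and> t \<le> M ^ (?c + 4) \<and> same_below h \<sigma> \<sigma>' \<and>
      \<sigma>' 3 h = (\<Sum>i<f ?x ?s. g ?x (i # ?s)))"
      unfolding n_def[symmetric] using val time ex
      by (intro conjI exI[of _ "t1 + (1 + (1 + (t4 + 1)))"] exI[of _ ?\<sigma>5]) auto
  qed
qed

theorem poly_term_compilable: "poly_term f \<Longrightarrow> \<exists>a. compilable f a"
proof (induction rule: poly_term.induct)
  case (const c)
  have "compiled (\<lambda>x s. c) (Suc c) ps h (Assign 3 (Const h) (Const c))" for ps h
    by (rule compile_simple) (auto intro: pow_ge simp del: power_Suc)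
  then show ?case unfolding compilable_def by blast
next
  case peek
  have "\<exists>P. compiled (\<lambda>x. peek) 1 ps h P" for ps h
  proof (cases ps)
    case Nil
    have "compiled (\<lambda>x. peek) 1 ps h (Assign 3 (Const h) (Const 0))"
      by (rule compile_simple) (auto simp: Nil)
    then show ?thesis ..
  next
    case (Cons p qs)
    have "compiled (\<lambda>x. peek) 1 ps h (Assign 3 (Const h) (scr p))"
      by (rule compile_simple) (auto simp: Cons)
    then show ?thesis ..
  qed
  then show ?case unfolding compilable_def by blast
next
  case (pop f)
  then obtain a where a: "compilable f a" by blast
  have "\<exists>P. compiled (\<lambda>x s. f x (tl s)) a ps h P" if "\<forall>p\<in>set ps. p < h" for ps h
  proof -
    have tl: "set (tl ps) \<subseteq> set ps" by (cases ps) auto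
    then have "\<forall>p\<in>set (tl ps). p < h" using that by blast
    with a obtain P where "compiled f a (tl ps) h P" unfolding compilable_def by blast
    then have "compiled (\<lambda>x s. f x (tl s)) a ps h P" using tl unfolding compiled_def map_tl[symmetric] by blast
    then show ?thesis ..
  qed
  then show ?case unfolding compilable_def by blast
next
  case len
  have "compiled (\<lambda>x s. length x) 1 ps h (Assign 3 (Const h) (Cell 1 (Const 0)))" for ps h
    by (rule compile_simple) (auto simp: length_output_word)
  then show ?case unfolding compilable_def by blast
next
  case (bit f)
  then obtain a where "compilable f a" by blast
  then have "compilable (\<lambda>x s. bit x (f x s)) (a + 2)"
    unfolding compilable_def[of "\<lambda>x s. bit x (f x s)"] by (intro allI impI compile_bit)
  then show ?case ..
next
  case (add f g)
  then obtain a b where "compilable f a" "compilable g b" by blast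
  then have "compilable (\<lambda>x s. f x s + g x s) (a + b + 2)"
    unfolding compilable_def[of "\<lambda>x s. f x s + g x s"] by (intro allI impI compile_binary[where op = Add]) auto
  then show ?case ..
next
  case (sub f g)
  then obtain a b where "compilable f a" "compilable g b" by blast
  then have "compilable (\<lambda>x s. f x s - g x s) (a + b + 2)"
    unfolding compilable_def[of "\<lambda>x s. f x s - g x s"] by (intro allI impI compile_binary[where op = Sub]) auto
  then show ?case ..
next
  case (less f g)
  then obtain a b where "compilable f a" "compilable g b" by blast
  then have "compilable (\<lambda>x s. of_bool (f x s < g x s)) (a + b + 2)"
    unfolding compilable_def[of "\<lambda>x s. of_bool (f x s < g x s)"] by (intro allI impI compile_binary[where op = Less]) auto
  then show ?case ..
next
  case (sum f g)
  then obtain a b where "compilable f a" "compilable g b" by blast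
  then have "compilable (\<lambda>x s. \<Sum>i<f x s. g x (i # s)) (a + (a + 1) * b + 4)"
    unfolding compilable_def[of "\<lambda>x s. \<Sum>i<f x s. g x (i # s)"] by (intro allI impI compile_sum)
  then show ?case ..
qed

section \<open>Closure properties of bounded sums\<close>

lemma poly_term_sum:
  assumes "poly_term f" "poly_term (\<lambda>x s. G (peek s) x (tl s))"
  shows "poly_term (\<lambda>x s. \<Sum>i<f x s. G i x s)"
  using poly_term.sum[OF assms] by simp

definition poly_pred :: "(bool list \<Rightarrow> nat list \<Rightarrow> bool) \<Rightarrow> bool" where
  "poly_pred P \<longleftrightarrow> poly_term (\<lambda>x s. of_bool (P x s))"

lemma poly_term_mult:
  assumes "poly_term f" "poly_term g"
  shows "poly_term (\<lambda>x s. f x s * g x s)"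
proof -
  have "poly_term (\<lambda>x s. \<Sum>i<f x s. g x s)"
    by (rule poly_term_sum) (use assms poly_term.pop in auto)
  then show ?thesis by simp
qed

lemma poly_term_power: "poly_term f \<Longrightarrow> poly_term (\<lambda>x s. f x s ^ n)"
  by (induction n) (auto intro: poly_term.const poly_term_mult)

lemma poly_pred_less: "poly_term f \<Longrightarrow> poly_term g \<Longrightarrow> poly_pred (\<lambda>x s. f x s < g x s)"
  unfolding poly_pred_def by (rule poly_term.less)

lemma poly_pred_not: "poly_pred P \<Longrightarrow> poly_pred (\<lambda>x s. \<not> P x s)"
proof -
  have *: "of_bool (\<not> p) = (1 - of_bool p :: nat)" for p by (cases p) auto
  show "poly_pred P \<Longrightarrow> poly_pred (\<lambda>x s. \<not> P x s)"
    unfolding poly_pred_def * by (rule poly_term.sub[OF poly_term.const])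
qed

lemma poly_pred_conj: "poly_pred P \<Longrightarrow> poly_pred Q \<Longrightarrow> poly_pred (\<lambda>x s. P x s \<and> Q x s)"
  unfolding poly_pred_def of_bool_conj by (rule poly_term_mult)

lemma poly_pred_disj: "poly_pred P \<Longrightarrow> poly_pred Q \<Longrightarrow> poly_pred (\<lambda>x s. P x s \<or> Q x s)"
  using poly_pred_not[OF poly_pred_conj[OF poly_pred_not poly_pred_not], of P Q] by simp

lemma poly_pred_imp: "poly_pred P \<Longrightarrow> poly_pred Q \<Longrightarrow> poly_pred (\<lambda>x s. P x s \<longrightarrow> Q x s)"
  unfolding imp_conv_disj by (intro poly_pred_disj poly_pred_not)

lemma poly_pred_iff: "poly_pred P \<Longrightarrow> poly_pred Q \<Longrightarrow> poly_pred (\<lambda>x s. P x s \<longleftrightarrow> Q x s)"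
  unfolding iff_conv_conj_imp by (intro poly_pred_conj poly_pred_imp)

lemma poly_pred_le: "poly_term f \<Longrightarrow> poly_term g \<Longrightarrow> poly_pred (\<lambda>x s. f x s \<le> g x s)"
  using poly_pred_not[OF poly_pred_less, of g f] by (simp add: not_less)

lemma poly_pred_eq: "poly_term f \<Longrightarrow> poly_term g \<Longrightarrow> poly_pred (\<lambda>x s. f x s = g x s)"
  unfolding eq_iff by (intro poly_pred_conj poly_pred_le)

lemma poly_pred_const: "poly_pred (\<lambda>x s. c)"
  unfolding poly_pred_def by (rule poly_term.const)

lemma poly_pred_if:
  assumes "poly_pred P" "poly_pred Q" "poly_pred R"
  shows "poly_pred (\<lambda>x s. if P x s then Q x s else R x s)"
  unfolding if_bool_eq_conj by (intro poly_pred_conj poly_pred_imp poly_pred_not assms)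

lemma poly_pred_bex:
  assumes "poly_term f" "poly_pred (\<lambda>x s. P (peek s) x (tl s))"
  shows "poly_pred (\<lambda>x s. \<exists>i<f x s. P i x s)"
proof -
  have "poly_pred (\<lambda>x s. 0 < (\<Sum>i<f x s. of_bool (P i x s) :: nat))"
    by (intro poly_pred_less poly_term.const poly_term_sum assms(1) assms(2)[unfolded poly_pred_def])
  moreover have "(0 < (\<Sum>i<n. of_bool (Q i) :: nat)) \<longleftrightarrow> (\<exists>i<n. Q i)" for n :: nat and Q
    unfolding zero_less_iff_neq_zero by auto
  ultimately show ?thesis by simp
qed

lemma poly_pred_ball:
  assumes "poly_term f" "poly_pred (\<lambda>x s. P (peek s) x (tl s))"
  shows "poly_pred (\<lambda>x s. \<forall>i<f x s. P i x s)"
  using poly_pred_not[OF poly_pred_bex[OF assms(1), of "\<lambda>i x s. \<not> P i x s"]] poly_pred_not[OF assms(2)] by simp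

text \<open>Unrolling the quantifier lets \<open>r\<close> occur where terms admit only constants,
  such as in the exponent of a power.\<close>

lemma poly_pred_bex_const: "(\<And>r. r < (n::nat) \<Longrightarrow> poly_pred (P r)) \<Longrightarrow> poly_pred (\<lambda>x s. \<exists>r<n. P r x s)"
proof (induction n)
  case (Suc n)
  then show ?case unfolding Ex_less_Suc by (intro poly_pred_disj) simp_all
qed (simp add: poly_pred_const)

lemma poly_pred_ball_const: "(\<And>r. r < (n::nat) \<Longrightarrow> poly_pred (P r)) \<Longrightarrow> poly_pred (\<lambda>x s. \<forall>r<n. P r x s)"
  using poly_pred_not[OF poly_pred_bex_const[of n "\<lambda>r x s. \<not> P r x s"]] poly_pred_not by simp

lemma poly_term_div:
  assumes "poly_term f" "poly_term g"
  shows "poly_term (\<lambda>x s. f x s div g x s)"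
proof -
  \<comment> \<open>The quotient is the number of positive multiples of the divisor up to the
    dividend; the conjunct \<open>0 < g x s\<close> reproduces the convention that division by 0
    gives 0.\<close>
  have "poly_term (\<lambda>x s. \<Sum>i<f x s. of_bool ((i + 1) * g x s \<le> f x s \<and> 0 < g x s))"
    by (rule poly_term_sum[OF assms(1)], fold poly_pred_def)
      (intro poly_pred_conj poly_pred_le poly_pred_less poly_term_mult poly_term.add poly_term.peek poly_term.const
        poly_term.pop assms)
  moreover have "(\<Sum>i<n. of_bool ((i + 1) * m \<le> n \<and> 0 < m)) = n div m" for n m :: nat
  proof (cases "m = 0")
    case False
    have "(\<Sum>i<N. of_bool (i < q)) = min N q" for N q :: nat by (induction N) auto
    moreover have "((i + 1) * m \<le> n \<and> 0 < m) = (i < n div m)" for i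
      using False less_eq_div_iff_mult_less_eq[of m "i + 1" n] by (simp add: Suc_le_eq)
    ultimately show ?thesis by (simp add: min_absorb2 div_le_dividend)
  qed simp
  ultimately show ?thesis by simp
qed

lemma poly_term_mod: "poly_term f \<Longrightarrow> poly_term g \<Longrightarrow> poly_term (\<lambda>x s. f x s mod g x s)"
  unfolding minus_mult_div_eq_mod[symmetric] by (intro poly_term.sub poly_term_mult poly_term_div)

lemma poly_pred_bit: "poly_term f \<Longrightarrow> poly_pred (\<lambda>x s. f x s < length x \<and> x ! f x s)"
  using poly_term.bit[of f] unfolding poly_pred_def bit_def .

lemmas poly_intros = poly_term.const poly_term.peek poly_term.len poly_term.add poly_term.sub
  poly_term_mult poly_term_power poly_term_div poly_term_mod
  poly_pred_less poly_pred_not poly_pred_conj poly_pred_disj poly_pred_imp poly_pred_iff poly_pred_le poly_pred_eq poly_pred_const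
  poly_pred_if poly_pred_bex poly_pred_ball poly_term.pop

section \<open>Programs that write their output bit by bit\<close>

theorem poly_machine:
  assumes "poly_term len" "poly_term dig" "poly_term par"
  shows "\<exists>q a. \<forall>\<sigma>. let x = output_word \<sigma>; k = output_param \<sigma> in
    len x [k] \<le> (length x + k + 2) ^ a \<and>
    (\<exists>t \<sigma>'. exec q \<sigma> t \<sigma>' \<and> t \<le> (length x + k + 2) ^ a \<and>
       output_word \<sigma>' = map (\<lambda>i. dig x [i, k] \<noteq> 0) [0..<len x [k]] \<and> output_param \<sigma>' = par x [k])"
proof -
  obtain a b c where abc: "compilable len a" "compilable dig b" "compilable par c"
    using assms[THEN poly_term_compilable] by blast
  have "\<forall>p\<in>set [0]. p < (1::nat)" by simp
  then obtain P where P: "compiled len a [0] 1 P" using abc(1) unfolding compilable_def by blast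
  have "\<forall>p\<in>set [2, 0]. p < (3::nat)" by simp
  then obtain Q where Q: "compiled dig b [2, 0] 3 Q" using abc(2) unfolding compilable_def by blast
  have "\<forall>p\<in>set [0]. p < (2::nat)" by simp
  then obtain R where R: "compiled par c [0] 2 R" using abc(3) unfolding compilable_def by blast
  \<comment> \<open>The new word is collected in array 4 and copied afterwards, since every digit
    may still read the input word in array 0. For the same reason the parameter is computed before
    the copying, and the length is set last.\<close>
  let ?e = "Less (scr 2) (scr 1)" and ?inc = "Assign 3 (Const 2) (Add (scr 2) (Const 1))" and ?zero = "Assign 3 (Const 2) (Const 0)"
  let ?B = "Seq Q (Seq (Assign 4 (scr 2) (scr 3)) ?inc)"
  let ?C = "Seq (Assign 0 (scr 2) (Cell 4 (scr 2))) ?inc"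
  let ?q = "Seq (Assign 3 (Const 0) (Cell 2 (Const 0))) (Seq P (Seq ?zero (Seq (While ?e ?B) (Seq R
     (Seq (Assign 2 (Const 0) (scr 2)) (Seq ?zero (Seq (While ?e ?C) (Assign 1 (Const 0) (scr 1)))))))))"
  \<comment> \<open>The summand 10 absorbs the factor 1000 in the estimate of the running
    time.\<close>
  define d where "d = a + (a + 1) * b + c + 10"
  have "len x [k] \<le> (length x + k + 2) ^ d \<and>
    (\<exists>t \<sigma>'. exec ?q \<sigma> t \<sigma>' \<and> t \<le> (length x + k + 2) ^ d \<and>
       output_word \<sigma>' = map (\<lambda>i. dig x [i, k] \<noteq> 0) [0..<len x [k]] \<and> output_param \<sigma>' = par x [k])"
    if x: "x = output_word \<sigma>" and k: "k = output_param \<sigma>" for \<sigma> x k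
  proof -
    define M where "M = length x + k + 2"
    have M: "length x \<le> M" "k \<le> M" "2 \<le> M" unfolding M_def by auto
    define \<sigma>1 where "\<sigma>1 = \<sigma>(3 := (\<sigma> 3)(0 := k))"
    have e1: "exec (Assign 3 (Const 0) (Cell 2 (Const 0))) \<sigma> 1 \<sigma>1"
      using exec.Assign[of 3 "Const 0" "Cell 2 (Const 0)" \<sigma>] k by (simp add: \<sigma>1_def output_param_def)
    have x1: "output_word \<sigma>1 = x" "map (\<sigma>1 3) [0] = [k]" unfolding x \<sigma>1_def by (simp_all add: output_word_def)
    define n where "n = len x [k]"
    have "length (output_word \<sigma>1) \<le> M" "\<forall>p\<in>set [0]. \<sigma>1 3 p \<le> M" using M x1 by auto
    from compiledD[OF P this M(3)] obtain t2 \<sigma>2 where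
      2: "n \<le> M ^ a" "exec P \<sigma>1 t2 \<sigma>2" "t2 \<le> M ^ a" "same_below 1 \<sigma>1 \<sigma>2" "\<sigma>2 3 1 = n"
      unfolding x1 n_def by metis
    define \<sigma>3 where "\<sigma>3 = \<sigma>2(3 := (\<sigma>2 3)(2 := 0))"
    have e3: "exec ?zero \<sigma>2 1 \<sigma>3" using exec.Assign[of 3 "Const 2" "Const 0" \<sigma>2] by (simp add: \<sigma>3_def)
    define N where "N = M ^ (a + 1)"
    have MN: "M \<le> N" "M ^ a \<le> N" using M(3) unfolding N_def by (simp_all add: self_le_power)
    have N: "2 \<le> N" using M(3) MN by simp
    define I :: "nat \<Rightarrow> store \<Rightarrow> bool" where "I i \<tau> \<longleftrightarrow> (\<forall>a j. a \<noteq> 3 \<and> a \<noteq> 4 \<longrightarrow> \<tau> a j = \<sigma> a j) \<and> \<tau> 3 0 = k \<and> \<tau> 3 1 = n \<and> \<tau> 3 2 = i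
      \<and> (\<forall>j<i. \<tau> 4 j = dig x [j, k])" for i \<tau>
    have stepI: "eval ?e \<tau> \<noteq> 0 \<and> (\<exists>t \<tau>'. exec ?B \<tau> t \<tau>' \<and> t \<le> N ^ b + 2 \<and> I (Suc i) \<tau>')"
      if "i < n" "I i \<tau>" for i \<tau>
    proof -
      have I: "\<tau> 3 0 = k" "\<tau> 3 1 = n" "\<tau> 3 2 = i" "\<forall>a j. a \<noteq> 3 \<and> a \<noteq> 4 \<longrightarrow> \<tau> a j = \<sigma> a j" "\<forall>j<i. \<tau> 4 j = dig x [j, k]"
        using that(2) unfolding I_def by auto
      have ow: "output_word \<tau> = x" unfolding x output_word_def using I(4) by simp
      have mp: "map (\<tau> 3) [2, 0] = [i, k]" using I by simp
      have "length (output_word \<tau>) \<le> N" "\<forall>p\<in>set [2, 0]. \<tau> 3 p \<le> N" using ow M MN 2(1) I that(1) by auto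
      then obtain t \<tau>1 where 5: "exec Q \<tau> t \<tau>1" "t \<le> N ^ b" "same_below 3 \<tau> \<tau>1" "\<tau>1 3 3 = dig x [i, k]"
        using compiledD[OF Q _ _ N, of \<tau>] unfolding ow mp by metis
      let ?\<tau>2 = "\<tau>1(4 := (\<tau>1 4)(i := dig x [i, k]))"
      let ?\<tau>3 = "?\<tau>2(3 := (?\<tau>2 3)(2 := Suc i))"
      have j: "\<tau>1 3 2 = i" "\<tau>1 3 0 = k" "\<tau>1 3 1 = n" using 5(3) I unfolding same_below_def by auto
      have "exec (Assign 4 (scr 2) (scr 3)) \<tau>1 1 ?\<tau>2"
        using exec.Assign[of 4 "scr 2" "scr 3" \<tau>1] j 5(4) by simp
      moreover have "exec ?inc ?\<tau>2 1 ?\<tau>3"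
        using exec.Assign[of 3 "Const 2" "Add (scr 2) (Const 1)" ?\<tau>2] j by simp
      ultimately have "exec ?B \<tau> (t + (1 + 1)) ?\<tau>3" using 5(1) by (intro exec.Seq)
      moreover have "I (Suc i) ?\<tau>3" using 5(3) I j unfolding I_def same_below_def by (auto simp: less_Suc_eq)
      moreover have "eval ?e \<tau> \<noteq> 0" using I that(1) by simp
      ultimately show ?thesis using 5(2) by (intro conjI exI[of _ "t + (1 + 1)"] exI[of _ ?\<tau>3]) auto
    qed
    have i0: "I 0 \<sigma>3" using 2(4,5) unfolding I_def \<sigma>3_def \<sigma>1_def same_below_def by auto
    have stop: "eval ?e \<tau> = 0" if "I n \<tau>" for \<tau> using that unfolding I_def by simp
    have "\<exists>t \<sigma>'. exec (While ?e ?B) \<sigma>3 t \<sigma>' \<and> t \<le> 1 + (n - 0) * ((N ^ b + 2) + 1) \<and> I n \<sigma>'"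
      by (rule while_loop[where I = I]) (use stepI stop i0 in auto)
    then obtain t4 \<sigma>4 where 4: "exec (While ?e ?B) \<sigma>3 t4 \<sigma>4" "t4 \<le> 1 + (n - 0) * ((N ^ b + 2) + 1)" "I n \<sigma>4" by blast
    have ow4: "output_word \<sigma>4 = x" using 4(3) unfolding x output_word_def I_def by simp
    have mp4: "map (\<sigma>4 3) [0] = [k]" using 4(3) unfolding I_def by simp
    have "length (output_word \<sigma>4) \<le> M" "\<forall>p\<in>set [0]. \<sigma>4 3 p \<le> M" using M ow4 mp4 by auto
    from compiledD[OF R this M(3)] obtain t5 \<sigma>5 where
      5: "exec R \<sigma>4 t5 \<sigma>5" "t5 \<le> M ^ c" "same_below 2 \<sigma>4 \<sigma>5" "\<sigma>5 3 2 = par x [k]"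
      unfolding ow4 mp4 by metis
    define \<sigma>6 where "\<sigma>6 = \<sigma>5(2 := (\<sigma>5 2)(0 := par x [k]))"
    have e6: "exec (Assign 2 (Const 0) (scr 2)) \<sigma>5 1 \<sigma>6"
      using exec.Assign[of 2 "Const 0" "scr 2" \<sigma>5] 5(4) by (simp add: \<sigma>6_def)
    define \<sigma>7 where "\<sigma>7 = \<sigma>6(3 := (\<sigma>6 3)(2 := 0))"
    have e7: "exec ?zero \<sigma>6 1 \<sigma>7" using exec.Assign[of 3 "Const 2" "Const 0" \<sigma>6] by (simp add: \<sigma>7_def)
    define J :: "nat \<Rightarrow> store \<Rightarrow> bool" where "J i \<tau> \<longleftrightarrow> \<tau> 2 0 = par x [k] \<and> \<tau> 3 1 = n \<and> \<tau> 3 2 = i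
      \<and> (\<forall>j<n. \<tau> 4 j = dig x [j, k]) \<and> (\<forall>j<i. \<tau> 0 j = dig x [j, k])" for i \<tau>
    have stepJ: "eval ?e \<tau> \<noteq> 0 \<and> (\<exists>t \<tau>'. exec ?C \<tau> t \<tau>' \<and> t \<le> 2 \<and> J (Suc i) \<tau>')"
      if "i < n" "J i \<tau>" for i \<tau>
    proof -
      have J: "\<tau> 2 0 = par x [k]" "\<tau> 3 1 = n" "\<tau> 3 2 = i" "\<forall>j<n. \<tau> 4 j = dig x [j, k]" "\<forall>j<i. \<tau> 0 j = dig x [j, k]"
        using that(2) unfolding J_def by auto
      let ?\<tau>2 = "\<tau>(0 := (\<tau> 0)(i := dig x [i, k]))"
      let ?\<tau>3 = "?\<tau>2(3 := (?\<tau>2 3)(2 := Suc i))"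
      have "exec (Assign 0 (scr 2) (Cell 4 (scr 2))) \<tau> 1 ?\<tau>2"
        using exec.Assign[of 0 "scr 2" "Cell 4 (scr 2)" \<tau>] J that(1) by simp
      moreover have "exec ?inc ?\<tau>2 1 ?\<tau>3"
        using exec.Assign[of 3 "Const 2" "Add (scr 2) (Const 1)" ?\<tau>2] J by simp
      ultimately have "exec ?C \<tau> (1 + 1) ?\<tau>3" by (intro exec.Seq)
      moreover have "J (Suc i) ?\<tau>3" using J unfolding J_def by (auto simp: less_Suc_eq)
      moreover have "eval ?e \<tau> \<noteq> 0" using J that(1) by simp
      ultimately show ?thesis by (intro conjI exI[of _ "1 + 1"] exI[of _ ?\<tau>3]) auto
    qed
    have j0: "J 0 \<sigma>7" using 4(3) 5(3,4) unfolding J_def I_def \<sigma>7_def \<sigma>6_def same_below_def by auto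
    have stop': "eval ?e \<tau> = 0" if "J n \<tau>" for \<tau> using that unfolding J_def by simp
    have "\<exists>t \<sigma>'. exec (While ?e ?C) \<sigma>7 t \<sigma>' \<and> t \<le> 1 + (n - 0) * (2 + 1) \<and> J n \<sigma>'"
      by (rule while_loop[where I = J]) (use stepJ stop' j0 in auto)
    then obtain t8 \<sigma>8 where 8: "exec (While ?e ?C) \<sigma>7 t8 \<sigma>8" "t8 \<le> 1 + (n - 0) * (2 + 1)" "J n \<sigma>8" by blast
    define \<sigma>9 where "\<sigma>9 = \<sigma>8(1 := (\<sigma>8 1)(0 := n))"
    have e9: "exec (Assign 1 (Const 0) (scr 1)) \<sigma>8 1 \<sigma>9"
      using exec.Assign[of 1 "Const 0" "scr 1" \<sigma>8] 8(3) by (simp add: \<sigma>9_def J_def)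
    let ?t = "1 + (t2 + (1 + (t4 + (t5 + (1 + (1 + (t8 + 1)))))))"
    have ex: "exec ?q \<sigma> ?t \<sigma>9"
      by (rule exec.Seq[OF e1 exec.Seq[OF 2(2) exec.Seq[OF e3 exec.Seq[OF 4(1) exec.Seq[OF 5(1) exec.Seq[OF e6
          exec.Seq[OF e7 exec.Seq[OF 8(1) e9]]]]]]]])
    have "output_word \<sigma>9 = map (\<lambda>i. dig x [i, k] \<noteq> 0) [0..<n]" "output_param \<sigma>9 = par x [k]"
      using 8(3) unfolding output_word_def output_param_def \<sigma>9_def J_def by auto
    moreover have "?t \<le> M ^ d"
    proof -
      have Nb: "N ^ b = M ^ ((a + 1) * b)" unfolding N_def by (simp only: power_mult)
      let ?c = "a + (a + 1) * b + c"
      have le: "M ^ a \<le> M ^ ?c" "1 \<le> M ^ ?c" "M ^ c \<le> M ^ ?c" using M(3) by (auto intro: pow_le)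
      have "n * N ^ b \<le> M ^ (a + (a + 1) * b)" unfolding power_add Nb using 2(1) by (rule mult_right_mono) simp
      also have "\<dots> \<le> M ^ ?c" using M(3) by (intro pow_le) auto
      finally have nN: "n * N ^ b \<le> M ^ ?c" .
      have t4: "t4 \<le> 1 + n * N ^ b + 3 * n" using 4(2) by (simp add: algebra_simps)
      have "?t \<le> 2 * M ^ a + M ^ c + n * N ^ b + 8 + 6 * n" using 2(3) t4 5(2) 8(2) by simp
      also have "\<dots> \<le> 1000 * M ^ ?c" using le nN 2(1) by linarith
      also have "\<dots> \<le> M ^ d" using M(3) unfolding d_def by (intro pow_absorb[of _ _ 10]) auto
      finally show ?thesis .
    qed
    moreover have "n \<le> M ^ d" using 2(1) pow_le[OF M(3), of a d] unfolding d_def by simp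
    ultimately show ?thesis using ex unfolding M_def[symmetric] n_def[symmetric] by blast
  qed
  then show ?thesis unfolding Let_def by blast
qed

section \<open>Simulation of programs on disjoint arrays\<close>

fun rename_exp :: "(nat \<Rightarrow> nat) \<Rightarrow> exp \<Rightarrow> exp" where
  "rename_exp r (Const n) = Const n"
| "rename_exp r (Cell a e) = Cell (r a) (rename_exp r e)"
| "rename_exp r (Add e e') = Add (rename_exp r e) (rename_exp r e')"
| "rename_exp r (Sub e e') = Sub (rename_exp r e) (rename_exp r e')"
| "rename_exp r (Less e e') = Less (rename_exp r e) (rename_exp r e')"

fun rename_com :: "(nat \<Rightarrow> nat) \<Rightarrow> com \<Rightarrow> com" where
  "rename_com r Skip = Skip"
| "rename_com r (Assign a i e) = Assign (r a) (rename_exp r i) (rename_exp r e)"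
| "rename_com r (Seq p q) = Seq (rename_com r p) (rename_com r q)"
| "rename_com r (If e p q) = If (rename_exp r e) (rename_com r p) (rename_com r q)"
| "rename_com r (While e p) = While (rename_exp r e) (rename_com r p)"

lemma eval_rename: "eval (rename_exp r e) \<sigma> = eval e (\<sigma> \<circ> r)"
  by (induction e) auto

text \<open>Injectivity keeps distinct arrays distinct, so a run lifts to any store that contains a
  renamed copy of its own. Two unknown programs can thus share a store, although either may use any
  array.\<close>

lemma exec_rename:
  assumes "exec p s t s'" "inj r" "\<sigma> \<circ> r = s"
  shows "\<exists>\<sigma>'. exec (rename_com r p) \<sigma> t \<sigma>' \<and> \<sigma>' \<circ> r = s' \<and> (\<forall>a. a \<notin> range r \<longrightarrow> \<sigma>' a = \<sigma> a)"
  using assms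
proof (induction arbitrary: \<sigma> rule: exec.induct)
  case (Skip s)
  then show ?case using exec.Skip by force
next
  case (Assign a i e s)
  have "\<sigma>(r a := (\<sigma> (r a))(eval i s := eval e s)) \<circ> r = s(a := (s a)(eval i s := eval e s))"
    using Assign by (auto simp: fun_eq_iff inj_eq)
  moreover have "exec (rename_com r (Assign a i e)) \<sigma> 1 (\<sigma>(r a := (\<sigma> (r a))(eval i s := eval e s)))"
    using exec.Assign[of "r a" "rename_exp r i" "rename_exp r e" \<sigma>] Assign by (simp add: eval_rename)
  moreover have "\<forall>b. b \<notin> range r \<longrightarrow> (\<sigma>(r a := (\<sigma> (r a))(eval i s := eval e s))) b = \<sigma> b" by auto
  ultimately show ?case by blast
next
  case (Seq p s t s' q t' s'')
  then show ?case using exec.Seq by (metis rename_com.simps(3))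
next
  case (IfTrue e s p t s' q)
  then show ?case using exec.IfTrue by (metis rename_com.simps(4) eval_rename)
next
  case (IfFalse e s q t s' p)
  then show ?case using exec.IfFalse by (metis rename_com.simps(4) eval_rename)
next
  case (WhileFalse e s p)
  then show ?case using exec.WhileFalse by (metis rename_com.simps(5) eval_rename)
next
  case (WhileTrue e s p t s' t' s'')
  then show ?case using exec.WhileTrue by (metis rename_com.simps(5) eval_rename)
qed

text \<open>The bounds of a composed reduction have to be computable again. They are a polynomial in
  the old bounds, or the new parameter evaluated at an old bound.\<close>

lemma computable_combine:
  assumes "computable f" "computable g" "poly_term h"
  shows "computable (\<lambda>k. h [] [f k, g k])"
proof -
  obtain p where p: "\<And>k. \<exists>t s. exec p (input_store [] k) t s \<and> output_param s = f k"
    using assms(1) unfolding computable_def by blast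
  obtain q where q: "\<And>k. \<exists>t s. exec q (input_store [] k) t s \<and> output_param s = g k"
    using assms(2) unfolding computable_def by blast
  obtain a where "compilable h a" using poly_term_compilable[OF assms(3)] by blast
  moreover have "\<forall>p\<in>set [0, 1]. p < (2::nat)" by simp
  ultimately obtain R where R: "compiled h a [0, 1] 2 R" unfolding compilable_def by blast
  \<comment> \<open>Odd and even arrays from 3 on keep the two runs apart. They also avoid array 1,
    whose cell 0 must remain 0 for the final program to see the empty word.\<close>
  define r r' :: "nat \<Rightarrow> nat" where "r i = 2 * i + 3" and "r' i = 2 * i + 4" for i
  have inj: "inj r" "inj r'" unfolding r_def r'_def by (auto simp: inj_def)
  have nr: "r' i \<notin> range r" "r i \<notin> range r'" for i unfolding r_def r'_def by (auto, presburger+)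
  let ?P = "Seq (Assign 7 (Const 0) (Cell 2 (Const 0))) (Seq (Assign 8 (Const 0) (Cell 2 (Const 0)))
    (Seq (rename_com r p) (Seq (rename_com r' q) (Seq (Assign 3 (Const 0) (Cell 7 (Const 0)))
    (Seq (Assign 3 (Const 1) (Cell 8 (Const 0))) (Seq R (Assign 2 (Const 0) (scr 2))))))))"
  have "\<exists>t s. exec ?P (input_store [] k) t s \<and> output_param s = h [] [f k, g k]" for k
  proof -
    let ?\<sigma> = "input_store [] k"
    let ?\<sigma>1 = "?\<sigma>(7 := (?\<sigma> 7)(0 := k))"
    let ?\<sigma>2 = "?\<sigma>1(8 := (?\<sigma>1 8)(0 := k))"
    have e1: "exec (Assign 7 (Const 0) (Cell 2 (Const 0))) ?\<sigma> 1 ?\<sigma>1"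
      using exec.Assign[of 7 "Const 0" "Cell 2 (Const 0)" ?\<sigma>] by (simp add: input_store_def)
    have e2: "exec (Assign 8 (Const 0) (Cell 2 (Const 0))) ?\<sigma>1 1 ?\<sigma>2"
      using exec.Assign[of 8 "Const 0" "Cell 2 (Const 0)" ?\<sigma>1] by (simp add: input_store_def)
    obtain t3 s3 where 3: "exec p (input_store [] k) t3 s3" "output_param s3 = f k" using p by blast
    obtain t4 s4 where 4: "exec q (input_store [] k) t4 s4" "output_param s4 = g k" using q by blast
    have "?\<sigma>2 \<circ> r = input_store [] k" "?\<sigma>2 \<circ> r' = input_store [] k"
      unfolding r_def r'_def by (auto simp: fun_eq_iff input_store_def)
    then obtain \<sigma>3 where 5: "exec (rename_com r p) ?\<sigma>2 t3 \<sigma>3" "\<sigma>3 \<circ> r = s3" "\<And>a. a \<notin> range r \<Longrightarrow> \<sigma>3 a = ?\<sigma>2 a"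
      "?\<sigma>2 \<circ> r' = input_store [] k"
      using exec_rename[OF 3(1) inj(1)] by blast
    have "\<sigma>3 \<circ> r' = ?\<sigma>2 \<circ> r'" using 5(3) nr(1) by (auto simp: fun_eq_iff)
    then obtain \<sigma>4 where 6: "exec (rename_com r' q) \<sigma>3 t4 \<sigma>4" "\<sigma>4 \<circ> r' = s4" "\<And>a. a \<notin> range r' \<Longrightarrow> \<sigma>4 a = \<sigma>3 a"
      using exec_rename[OF 4(1) inj(2), of \<sigma>3] 5(4) by auto
    have r2: "r 2 = 7" "r' 2 = 8" by (simp_all add: r_def r'_def)
    have f: "\<sigma>4 7 0 = f k" using 5(2) 3(2) 6(3)[OF nr(2)[of 2]] r2 unfolding output_param_def
      by (metis comp_apply)
    have g: "\<sigma>4 8 0 = g k" using 6(2) 4(2) r2 unfolding output_param_def by (metis comp_apply)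
    have "1 \<notin> range r" "1 \<notin> range r'" unfolding r_def r'_def by auto
    then have w: "\<sigma>4 1 0 = 0" using 5(3)[of 1] 6(3)[of 1] by (simp add: input_store_def)
    let ?\<sigma>5 = "\<sigma>4(3 := (\<sigma>4 3)(0 := f k))"
    let ?\<sigma>6 = "?\<sigma>5(3 := (?\<sigma>5 3)(1 := g k))"
    have e5: "exec (Assign 3 (Const 0) (Cell 7 (Const 0))) \<sigma>4 1 ?\<sigma>5"
      using exec.Assign[of 3 "Const 0" "Cell 7 (Const 0)" \<sigma>4] f by simp
    have e6: "exec (Assign 3 (Const 1) (Cell 8 (Const 0))) ?\<sigma>5 1 ?\<sigma>6"
      using exec.Assign[of 3 "Const 1" "Cell 8 (Const 0)" ?\<sigma>5] g by simp
    have ow: "output_word ?\<sigma>6 = []" using w by (simp add: output_word_def)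
    have mp: "map (?\<sigma>6 3) [0, 1] = [f k, g k]" by simp
    have "length (output_word ?\<sigma>6) \<le> f k + g k + 2" "\<forall>p\<in>set [0, 1]. ?\<sigma>6 3 p \<le> f k + g k + 2" "2 \<le> f k + g k + 2"
      using ow by auto
    from compiledD[OF R this] obtain t7 \<sigma>7 where 7: "exec R ?\<sigma>6 t7 \<sigma>7" "\<sigma>7 3 2 = h [] [f k, g k]"
      unfolding ow mp by metis
    let ?\<sigma>8 = "\<sigma>7(2 := (\<sigma>7 2)(0 := h [] [f k, g k]))"
    have e8: "exec (Assign 2 (Const 0) (scr 2)) \<sigma>7 1 ?\<sigma>8"
      using exec.Assign[of 2 "Const 0" "scr 2" \<sigma>7] 7(2) by simp
    note exec.Seq[OF e1 exec.Seq[OF e2 exec.Seq[OF 5(1) exec.Seq[OF 6(1) exec.Seq[OF e5 exec.Seq[OF e6 exec.Seq[OF 7(1) e8]]]]]]]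
    moreover have "output_param ?\<sigma>8 = h [] [f k, g k]" by (simp add: output_param_def)
    ultimately show ?thesis by blast
  qed
  then show ?thesis unfolding computable_def by blast
qed

text \<open>The intermediate word has length at most \<open>f k * (length x + 1) ^ c\<close>,
  because the definition charges it to the running time, and the intermediate parameter is at most
  \<open>g k\<close>. A polynomial in both has the required form again, and monotonicity of
  \<open>g2\<close> carries the bound on the parameter over.\<close>

theorem fpt_reducible_poly:
  assumes red: "fpt_reducible L L1" and poly: "poly_term len" "poly_term dig" "poly_term par"
    and par: "\<And>x k. par x [k] = g2 k" and mono: "mono g2"
    and correct: "\<And>x k. (x, k) \<in> L1 \<longleftrightarrow> (map (\<lambda>i. dig x [i, k] \<noteq> 0) [0..<len x [k]], g2 k) \<in> L2"
  shows "fpt_reducible L L2"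
proof -
  obtain p f g c where f: "computable f" "mono f" and g: "computable g" "mono g"
    and p: "\<And>x k. \<exists>t s. exec p (input_store x k) t s \<and> t + length (output_word s) \<le> f k * (length x + 1) ^ c \<and>
      output_param s \<le> g k \<and> ((x, k) \<in> L \<longleftrightarrow> (output_word s, output_param s) \<in> L1)"
    using red unfolding fpt_reducible_def by blast
  obtain q a where q: "\<And>\<sigma> x k. x = output_word \<sigma> \<Longrightarrow> k = output_param \<sigma> \<Longrightarrow> len x [k] \<le> (length x + k + 2) ^ a \<and>
    (\<exists>t \<sigma>'. exec q \<sigma> t \<sigma>' \<and> t \<le> (length x + k + 2) ^ a \<and>
       output_word \<sigma>' = map (\<lambda>i. dig x [i, k] \<noteq> 0) [0..<len x [k]] \<and> output_param \<sigma>' = par x [k])"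
    using poly_machine[OF poly] unfolding Let_def by blast
  let ?F = "\<lambda>k. f k + g k + 2"
  let ?f = "\<lambda>k. ?F k ^ (a + 3)" and ?g = "\<lambda>k. g2 (g k)"
  have "poly_term (\<lambda>x s. (peek s + peek (tl s) + 2) ^ (a + 3))"
    by (intro poly_intros)
  from computable_combine[OF f(1) g(1) this] have cf: "computable ?f" by simp
  have "poly_term (\<lambda>x s. par x (tl s))" using poly(3) by (rule poly_term.pop)
  from computable_combine[OF f(1) g(1) this] have cg: "computable ?g" by (simp add: par)
  have mf: "mono ?f"
    by (intro monoI power_mono add_mono) (use f(2) g(2) in \<open>auto dest: monoD\<close>)
  have mg: "mono ?g" using mono g(2) unfolding mono_def by blast
  have "\<exists>t s. exec (Seq p q) (input_store x k) t s \<and> t + length (output_word s) \<le> ?f k * (length x + 1) ^ (c * (a + 3)) \<and>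
      output_param s \<le> ?g k \<and> ((x, k) \<in> L \<longleftrightarrow> (output_word s, output_param s) \<in> L2)" for x k
  proof -
    obtain t s where 1: "exec p (input_store x k) t s" "t + length (output_word s) \<le> f k * (length x + 1) ^ c"
      "output_param s \<le> g k" "(x, k) \<in> L \<longleftrightarrow> (output_word s, output_param s) \<in> L1" using p by blast
    define x' k' where "x' = output_word s" and "k' = output_param s"
    obtain t' s' where 2: "len x' [k'] \<le> (length x' + k' + 2) ^ a" "exec q s t' s'" "t' \<le> (length x' + k' + 2) ^ a"
      "output_word s' = map (\<lambda>i. dig x' [i, k'] \<noteq> 0) [0..<len x' [k']]" "output_param s' = g2 k'"
      using q[OF x'_def k'_def] par by auto
    let ?n = "(length x + 1) ^ c" let ?N = "?F k * ?n"
    have n1: "1 \<le> ?n" by simp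
    have "length x' + k' + 2 \<le> f k * ?n + g k + 2" using 1(2,3) unfolding x'_def k'_def by linarith
    also have "g k + 2 \<le> (g k + 2) * ?n" using mult_le_mono2[OF n1, of "g k + 2"] by (simp only: mult_1_right)
    then have "f k * ?n + g k + 2 \<le> ?N" by (simp add: algebra_simps)
    finally have M: "length x' + k' + 2 \<le> ?N" .
    have N2: "2 \<le> ?N" using M by simp
    have t: "t \<le> ?N ^ (a + 1)"
    proof -
      have "t \<le> ?N" using 1(2) by (simp add: algebra_simps)
      also have "\<dots> = ?N ^ 1" by simp
      also have "\<dots> \<le> ?N ^ (a + 1)" using N2 by (intro pow_le) auto
      finally show ?thesis .
    qed
    have pa: "(length x' + k' + 2) ^ a \<le> ?N ^ (a + 1)"
      using power_mono[OF M, of a] pow_le[OF N2, of a "a + 1"] by linarith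
    have "t + t' + length (output_word s') \<le> 3 * ?N ^ (a + 1)"
      using t pa 2(1,3,4) by simp
    also have "\<dots> \<le> ?N ^ (a + 3)" using N2 by (intro pow_absorb[of _ _ 2]) auto
    also have "\<dots> = ?f k * (length x + 1) ^ (c * (a + 3))" unfolding power_mult_distrib power_mult by simp
    finally have "t + t' + length (output_word s') \<le> ?f k * (length x + 1) ^ (c * (a + 3))" .
    moreover have "exec (Seq p q) (input_store x k) (t + t') s'" using 1(1) 2(2) by (rule exec.Seq)
    moreover have "output_param s' \<le> ?g k" using 2(5) 1(3) mono unfolding k'_def by (auto dest: monoD)
    moreover have "(x, k) \<in> L \<longleftrightarrow> (output_word s', output_param s') \<in> L2"
      using 1(4) correct[of x' k'] 2(4,5) unfolding x'_def k'_def by simp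
    ultimately show ?thesis by blast
  qed
  then show ?thesis unfolding fpt_reducible_def using cf cg mf mg by blast
qed

section \<open>Refuting circuits of weft 1\<close>

abbreviation wire :: "circuit \<Rightarrow> nat \<Rightarrow> nat \<Rightarrow> bool" where
  "wire C j i \<equiv> (j, i) \<in> wires C"

lemma wire_less: "wf_circuit C \<Longrightarrow> wire C j i \<Longrightarrow> j < i \<and> i < gates C"
  by (auto simp: wf_circuit_def)

lemma finite_children: "wf_circuit C \<Longrightarrow> finite {j. wire C j i}"
  by (rule finite_subset[of _ "{..<i}"]) (auto dest: wire_less)

lemma indegree_0: "wf_circuit C \<Longrightarrow> indegree C i = 0 \<longleftrightarrow> (\<forall>j. \<not> wire C j i)"
  unfolding indegree_def using finite_children[of C i] by auto

text \<open>Depth and weft are defined by paths, of which there may be exponentially many. This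
  recursion and the next two look only at children and have a fixed height, so they unfold into
  formulas that the reduction can evaluate.\<close>

fun depth_le :: "circuit \<Rightarrow> nat \<Rightarrow> nat \<Rightarrow> bool" where
  "depth_le C 0 i \<longleftrightarrow> indegree C i = 0"
| "depth_le C (Suc m) i \<longleftrightarrow> (\<forall>j<i. wire C j i \<longrightarrow> depth_le C m j)"

fun thin :: "circuit \<Rightarrow> nat \<Rightarrow> nat \<Rightarrow> bool" where
  "thin C 0 i \<longleftrightarrow> True"
| "thin C (Suc m) i \<longleftrightarrow> indegree C i \<le> 2 \<and> (\<forall>j<i. wire C j i \<longrightarrow> thin C m j)"

fun weft_le_1 :: "circuit \<Rightarrow> nat \<Rightarrow> nat \<Rightarrow> bool" where
  "weft_le_1 C 0 i \<longleftrightarrow> True"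
| "weft_le_1 C (Suc m) i \<longleftrightarrow> (\<forall>j<i. wire C j i \<longrightarrow> (if indegree C i \<le> 2 then weft_le_1 C m j else thin C m j))"

lemma thin_imp_weft_le_1: "thin C m i \<Longrightarrow> weft_le_1 C m i"
  by (induction m arbitrary: i) auto

definition paths_to :: "circuit \<Rightarrow> nat \<Rightarrow> nat list set" where
  "paths_to C i = {p. p \<noteq> [] \<and> successively (wire C) p \<and> hd p \<in> input_gates C \<and> last p = i}"

lemma input_output_paths_eq: "input_output_paths C = paths_to C (output_gate C)"
  by (simp add: input_output_paths_def paths_to_def)

lemma paths_to_snoc: "p \<in> paths_to C i \<Longrightarrow> \<exists>q. p = q @ [i]"
  unfolding paths_to_def using append_butlast_last_id[of p] by (intro exI[of _ "butlast p"]) auto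

lemma paths_to_input:
  assumes "wf_circuit C" "i < gates C" "indegree C i = 0"
  shows "paths_to C i = {[i]}"
proof -
  have "p = [i]" if p: "p \<in> paths_to C i" for p
  proof -
    obtain q where q: "p = q @ [i]" using p paths_to_snoc by blast
    have "q = []"
    proof (rule ccontr)
      assume "q \<noteq> []"
      then have "wire C (last q) i" using p unfolding q paths_to_def by (simp add: successively_append_iff)
      then show False using assms indegree_0 by blast
    qed
    then show ?thesis using q by simp
  qed
  moreover have "[i] \<in> paths_to C i" using assms by (simp add: paths_to_def input_gates_def)
  ultimately show ?thesis by blast
qed

lemma paths_to_inner:
  assumes "wf_circuit C" "indegree C i \<noteq> 0"
  shows "paths_to C i = {q @ [i] |q j. wire C j i \<and> q \<in> paths_to C j}"
proof (intro equalityI subsetI)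
  fix p assume p: "p \<in> paths_to C i"
  then obtain q where q: "p = q @ [i]" using paths_to_snoc by blast
  have "q \<noteq> []" using p assms(2) unfolding q paths_to_def by (auto simp: input_gates_def)
  then have "wire C (last q) i" "q \<in> paths_to C (last q)"
    using p unfolding q paths_to_def by (auto simp: successively_append_iff)
  then show "p \<in> {q @ [i] |q j. wire C j i \<and> q \<in> paths_to C j}" using q by blast
next
  fix p assume "p \<in> {q @ [i] |q j. wire C j i \<and> q \<in> paths_to C j}"
  then show "p \<in> paths_to C i" by (auto simp: paths_to_def successively_append_iff)
qed

lemma paths_to_nonempty: "wf_circuit C \<Longrightarrow> i < gates C \<Longrightarrow> paths_to C i \<noteq> {}"
proof (induction i rule: less_induct)
  case (less i)
  show ?case
  proof (cases "indegree C i = 0")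
    case True
    then show ?thesis using less paths_to_input by auto
  next
    case False
    then obtain j where j: "wire C j i" using indegree_0[OF less(2), of i] by auto
    then have "paths_to C j \<noteq> {}" using less wire_less[of C j i] by auto
    then show ?thesis using paths_to_inner[OF less(2) False] j by blast
  qed
qed

lemma depth_le_iff:
  "wf_circuit C \<Longrightarrow> i < gates C \<Longrightarrow> depth_le C m i \<longleftrightarrow> (\<forall>p\<in>paths_to C i. length p - 1 \<le> m)"
proof (induction m arbitrary: i)
  case 0
  show ?case
  proof (cases "indegree C i = 0")
    case True
    then show ?thesis using 0 by (simp add: paths_to_input)
  next
    case False
    then obtain j where j: "wire C j i" using indegree_0[OF 0(1), of i] by auto
    then obtain q where "q \<in> paths_to C j" using paths_to_nonempty[of C j] 0 wire_less[of C j i] by fastforce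
    then have "q @ [i] \<in> paths_to C i" "q \<noteq> []" using paths_to_inner[OF 0(1) False] j by (auto simp: paths_to_def)
    then show ?thesis using False by (auto intro!: bexI[of _ "q @ [i]"])
  qed
next
  case (Suc m)
  show ?case
  proof (cases "indegree C i = 0")
    case True
    then show ?thesis using Suc by (simp add: paths_to_input indegree_0)
  next
    case False
    have "(\<forall>p\<in>paths_to C i. length p - 1 \<le> Suc m) \<longleftrightarrow> (\<forall>j. wire C j i \<longrightarrow> (\<forall>q\<in>paths_to C j. length q \<le> Suc m))"
      unfolding paths_to_inner[OF Suc(2) False] by fastforce
    also have "\<dots> \<longleftrightarrow> (\<forall>j. wire C j i \<longrightarrow> (\<forall>q\<in>paths_to C j. length q - 1 \<le> m))"
      by (simp add: le_diff_conv)
    also have "\<dots> \<longleftrightarrow> (\<forall>j. wire C j i \<longrightarrow> depth_le C m j)" using Suc wire_less[of C _ i] by fastforce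
    also have "\<dots> \<longleftrightarrow> depth_le C (Suc m) i" using wire_less[OF Suc(2)] by auto
    finally show ?thesis ..
  qed
qed

abbreviation big :: "circuit \<Rightarrow> nat list \<Rightarrow> nat" where
  "big C p \<equiv> length (filter (\<lambda>i. indegree C i > 2) p)"

lemma big_snoc: "big C (q @ [i]) = big C q + (if indegree C i \<le> 2 then 0 else 1)"
  by simp

lemma ball_paths:
  assumes "wf_circuit C" "indegree C i \<noteq> 0"
  shows "(\<forall>p\<in>paths_to C i. P p) \<longleftrightarrow> (\<forall>j. wire C j i \<longrightarrow> (\<forall>q\<in>paths_to C j. P (q @ [i])))"
  unfolding paths_to_inner[OF assms] by blast

lemma thin_iff:
  "wf_circuit C \<Longrightarrow> i < gates C \<Longrightarrow> depth_le C m i \<Longrightarrow> thin C m i \<longleftrightarrow> (\<forall>p\<in>paths_to C i. big C p = 0)"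
proof (induction m arbitrary: i)
  case 0
  then show ?case by (simp add: paths_to_input)
next
  case (Suc m)
  show ?case
  proof (cases "indegree C i = 0")
    case True
    then show ?thesis using Suc by (simp add: paths_to_input indegree_0)
  next
    case False
    obtain j where j: "wire C j i" using False indegree_0[OF Suc.prems(1), of i] by auto
    then have "paths_to C j \<noteq> {}"
      using paths_to_nonempty[OF Suc.prems(1), of j] wire_less[OF Suc.prems(1) j] Suc.prems(2) by simp
    \<comment> \<open>Some path reaches a child of \<open>i\<close>; otherwise the condition on
      paths would be vacuous and say nothing about the indegree of \<open>i\<close>.\<close>
    then have ne: "\<exists>j q. wire C j i \<and> q \<in> paths_to C j" using j by blast
    have child: "j < gates C" "depth_le C m j" if "wire C j i" for j
      using that Suc.prems wire_less[OF Suc.prems(1) that] by auto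
    have "(\<forall>p\<in>paths_to C i. big C p = 0) \<longleftrightarrow>
        (\<forall>j q. wire C j i \<and> q \<in> paths_to C j \<longrightarrow> big C q = 0 \<and> indegree C i \<le> 2)"
      unfolding ball_paths[OF Suc(2) False] big_snoc by auto
    also have "\<dots> \<longleftrightarrow> indegree C i \<le> 2 \<and> (\<forall>j. wire C j i \<longrightarrow> (\<forall>q\<in>paths_to C j. big C q = 0))"
      using ne by blast
    also have "(\<forall>j. wire C j i \<longrightarrow> (\<forall>q\<in>paths_to C j. big C q = 0)) \<longleftrightarrow> (\<forall>j. wire C j i \<longrightarrow> thin C m j)"
      using Suc.IH[OF Suc.prems(1)] child by simp
    finally show ?thesis using wire_less[OF Suc(2)] by auto
  qed
qed

lemma weft_le_1_iff:
  "wf_circuit C \<Longrightarrow> i < gates C \<Longrightarrow> depth_le C m i \<Longrightarrow> weft_le_1 C m i \<longleftrightarrow> (\<forall>p\<in>paths_to C i. big C p \<le> 1)"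
proof (induction m arbitrary: i)
  case 0
  then show ?case by (simp add: paths_to_input)
next
  case (Suc m)
  show ?case
  proof (cases "indegree C i = 0")
    case True
    then show ?thesis using Suc by (simp add: paths_to_input indegree_0)
  next
    case False
    have child: "j < gates C" "depth_le C m j" if "wire C j i" for j
      using that Suc.prems wire_less[OF Suc.prems(1) that] by auto
    have "(\<forall>p\<in>paths_to C i. big C p \<le> 1) \<longleftrightarrow>
        (\<forall>j. wire C j i \<longrightarrow> (\<forall>q\<in>paths_to C j. big C q + (if indegree C i \<le> 2 then 0 else 1) \<le> 1))"
      unfolding ball_paths[OF Suc(2) False] big_snoc by blast
    also have "\<dots> \<longleftrightarrow> (\<forall>j. wire C j i \<longrightarrow> (if indegree C i \<le> 2 then weft_le_1 C m j else thin C m j))"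
      using Suc.IH[OF Suc.prems(1)] thin_iff[OF Suc.prems(1)] child by simp
    finally show ?thesis using wire_less[OF Suc(2)] by auto
  qed
qed

lemma weft_depth_iff:
  assumes "wf_circuit C"
  shows "weft_at_most C 1 \<and> depth_at_most C d \<longleftrightarrow>
    depth_le C d (gates C - 1) \<and> weft_le_1 C d (gates C - 1)"
proof -
  have "gates C - 1 < gates C" using assms by (auto simp: wf_circuit_def)
  then show ?thesis
    using depth_le_iff[OF assms, of "gates C - 1" d] weft_le_1_iff[OF assms, of "gates C - 1" d]
    unfolding weft_at_most_def depth_at_most_def input_output_paths_eq output_gate_def by blast
qed

text \<open>With the value \<open>b\<close> as a parameter, duality merges conjunctions and
  disjunctions: the test \<open>(i \<in> and_gates C) = b\<close> separates the universal from the
  existential case, whatever the kind of the gate.\<close>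

lemma gate_value_cases:
  assumes "wf_circuit C"
  shows "indegree C i = 0 \<Longrightarrow> gate_value C X i \<longleftrightarrow> i \<in> X"
    "indegree C i = 1 \<Longrightarrow> wire C j i \<Longrightarrow> gate_value C X i \<longleftrightarrow> \<not> gate_value C X j"
    "indegree C i \<ge> 2 \<Longrightarrow> gate_value C X i = b \<longleftrightarrow>
      (if (i \<in> and_gates C) = b then \<forall>j. wire C j i \<longrightarrow> gate_value C X j = b else \<exists>j. wire C j i \<and> gate_value C X j = b)"
proof -
  have w: "j \<in> {..<i} \<and> wire C j i \<longleftrightarrow> wire C j i" for j i using wire_less[OF assms] by auto
  show "indegree C i = 0 \<Longrightarrow> gate_value C X i \<longleftrightarrow> i \<in> X" by (simp add: gate_value.simps)
  show "gate_value C X i \<longleftrightarrow> \<not> gate_value C X j" if "indegree C i = 1" "wire C j i"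
  proof -
    have "card {j. wire C j i} = 1" using that(1) by (simp add: indegree_def)
    then obtain j' where "{j. wire C j i} = {j'}" by (rule card_1_singletonE)
    then have "wire C k i \<longleftrightarrow> k = j" for k using that(2) by (metis mem_Collect_eq singletonD)
    then show ?thesis using that wire_less[OF assms that(2)] by (subst gate_value.simps) auto
  qed
  show "gate_value C X i = b \<longleftrightarrow>
      (if (i \<in> and_gates C) = b then \<forall>j. wire C j i \<longrightarrow> gate_value C X j = b else \<exists>j. wire C j i \<and> gate_value C X j = b)"
    if "indegree C i \<ge> 2"
    using that wire_less[OF assms, of _ i] by (subst gate_value.simps) auto
qed

text \<open>\<open>vis a v\<close> means that entry \<open>a\<close> of the sequence is visible and equals \<open>v\<close>; gate \<open>i\<close> is chosen iff \<open>i + 1\<close> occurs.\<close>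
definition sees :: "circuit \<Rightarrow> nat \<Rightarrow> (nat \<Rightarrow> nat \<Rightarrow> bool) \<Rightarrow> bool \<Rightarrow> nat \<Rightarrow> bool" where
  "sees C k vis b i \<longleftrightarrow> (if b then \<exists>a<k. vis (a + 1) (i + 1)
     else \<exists>a<k + 1. \<exists>v<i + 1. \<exists>v'<gates C + 2. vis a v \<and> vis (a + 1) v' \<and> i + 1 < v')"

text \<open>A derivation of the value \<open>b\<close> from visible entries, in which visibility
  occurs only positively. It is consulted only below a big gate, where weft 1 leaves no further big
  gate.\<close>

fun determined :: "circuit \<Rightarrow> nat \<Rightarrow> (nat \<Rightarrow> nat \<Rightarrow> bool) \<Rightarrow> nat \<Rightarrow> bool \<Rightarrow> nat \<Rightarrow> bool" where
  "determined C k vis 0 b i \<longleftrightarrow> indegree C i = 0 \<and> sees C k vis b i"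
| "determined C k vis (Suc m) b i \<longleftrightarrow>
    (if indegree C i = 0 then sees C k vis b i
     else if indegree C i = 1 then \<exists>j<i. wire C j i \<and> determined C k vis m (\<not> b) j
     else if (i \<in> and_gates C) = b then \<forall>j<i. wire C j i \<longrightarrow> determined C k vis m b j
     else \<exists>j<i. wire C j i \<and> determined C k vis m b j)"

text \<open>Let \<open>B\<close> be the bound one level below. A code \<open>j * B + c\<close> of a
  child and its certificate lies below \<open>n * B\<close>, and a code of two certificates lies
  below \<open>B * B\<close>; the sum covers both.\<close>

fun cert_bound :: "nat \<Rightarrow> nat \<Rightarrow> nat" where
  "cert_bound n 0 = 1"
| "cert_bound n (Suc m) = (n + cert_bound n m) * cert_bound n m"

text \<open>The claim is that gate \<open>i\<close> has the value \<open>b\<close>, certified by \<open>c\<close>. At a disjunction (for \<open>b\<close>), \<open>c\<close> consists of a child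
and its certificate; at a conjunction of two, it consists of both certificates. A big conjunction needs no
certificate, since its children are determined by few entries.\<close>
fun refuted :: "circuit \<Rightarrow> nat \<Rightarrow> (nat \<Rightarrow> nat \<Rightarrow> bool) \<Rightarrow> nat \<Rightarrow> bool \<Rightarrow> nat \<Rightarrow> nat \<Rightarrow> bool" where
  "refuted C k vis 0 b i c \<longleftrightarrow> indegree C i = 0 \<and> sees C k vis (\<not> b) i"
| "refuted C k vis (Suc m) b i c \<longleftrightarrow>
    (if indegree C i = 0 then sees C k vis (\<not> b) i
     else if indegree C i = 1 then \<exists>j<i. wire C j i \<and> refuted C k vis m (\<not> b) j c
     else if (i \<in> and_gates C) = b then
       (if indegree C i \<le> 2 then \<exists>j<i. wire C j i \<and>
            (if \<forall>j'<j. \<not> wire C j' i then refuted C k vis m b j (c div cert_bound (gates C) m)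
             else refuted C k vis m b j (c mod cert_bound (gates C) m))
        else \<exists>j<i. wire C j i \<and> determined C k vis m (\<not> b) j)
     else \<not> (c div cert_bound (gates C) m < i \<and> wire C (c div cert_bound (gates C) m) i) \<or>
       refuted C k vis m b (c div cert_bound (gates C) m) (c mod cert_bound (gates C) m))"

text \<open>The hypothesis on \<open>vis\<close> stops at \<open>k + 1\<close>, as entry
  \<open>k + 2\<close> is never read. Through the next two lemmas, adding or changing the stored
  certificate therefore does not disturb a refutation.\<close>

lemma sees_mono: "sees C k vis b i \<Longrightarrow> (\<And>a v. a \<le> k + 1 \<Longrightarrow> vis a v \<Longrightarrow> vis' a v) \<Longrightarrow> sees C k vis' b i"
proof -
  assume s: "sees C k vis b i" and mono: "\<And>a v. a \<le> k + 1 \<Longrightarrow> vis a v \<Longrightarrow> vis' a v"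
  show ?thesis
  proof (cases b)
    case True
    then show ?thesis using s mono by (auto simp: sees_def)
  next
    case False
    then obtain a v v' where "a < k + 1" "v < i + 1" "v' < gates C + 2" "vis a v" "vis (a + 1) v'" "i + 1 < v'"
      using s by (auto simp: sees_def)
    moreover from this have "vis' a v" "vis' (a + 1) v'" using mono by auto
    ultimately show ?thesis using False by (auto simp: sees_def)
  qed
qed

lemma determined_mono:
  "determined C k vis m b i \<Longrightarrow> (\<And>a v. a \<le> k + 1 \<Longrightarrow> vis a v \<Longrightarrow> vis' a v) \<Longrightarrow> determined C k vis' m b i"
proof (induction m arbitrary: b i)
  case 0
  then show ?case using sees_mono[of C k vis _ _ vis'] by auto
next
  case (Suc m)
  have "sees C k vis b i \<Longrightarrow> sees C k vis' b i" using Suc.prems(2) sees_mono by blast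
  moreover have "determined C k vis m b j \<Longrightarrow> determined C k vis' m b j" for b j
    using Suc.IH Suc.prems(2) by blast
  ultimately show ?case using Suc.prems(1) by (fastforce split: if_splits)
qed

lemma refuted_mono:
  "refuted C k vis m b i c \<Longrightarrow> (\<And>a v. a \<le> k + 1 \<Longrightarrow> vis a v \<Longrightarrow> vis' a v) \<Longrightarrow> refuted C k vis' m b i c"
proof (induction m arbitrary: b i c)
  case 0
  then show ?case using sees_mono[of C k vis _ _ vis'] by auto
next
  case (Suc m)
  have "sees C k vis b i \<Longrightarrow> sees C k vis' b i" for b using Suc.prems(2) sees_mono by blast
  moreover have "determined C k vis m b j \<Longrightarrow> determined C k vis' m b j" for b j
    using Suc.prems(2) determined_mono by blast
  moreover have "refuted C k vis m b j c \<Longrightarrow> refuted C k vis' m b j c" for b j c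
    using Suc.IH Suc.prems(2) by blast
  ultimately show ?case using Suc.prems(1) unfolding refuted.simps by (smt (verit, ccfv_threshold))
qed

definition vis_of :: "(nat \<Rightarrow> nat) \<Rightarrow> nat set \<Rightarrow> nat \<Rightarrow> nat \<Rightarrow> bool" where
  "vis_of s V a v \<longleftrightarrow> a \<in> V \<and> v = s a"

section \<open>Increasing sequences and the input gates they choose\<close>

locale selection =
  fixes C :: circuit and k :: nat and s :: "nat \<Rightarrow> nat"
  assumes wf: "wf_circuit C"
    and first: "s 0 = 0" and last: "s (k + 1) = gates C + 1"
    and mono: "\<And>a b. a < b \<Longrightarrow> b \<le> k + 1 \<Longrightarrow> s a < s b"
begin

definition chosen :: "nat set" where
  "chosen = (\<lambda>a. s (a + 1) - 1) ` {..<k}"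

lemma pos: "a < k \<Longrightarrow> 0 < s (a + 1)"
  using mono[of 0 "a + 1"] first by simp

lemma chosen_iff: "i \<in> chosen \<longleftrightarrow> (\<exists>a<k. s (a + 1) = i + 1)"
  unfolding chosen_def using pos by (force simp: image_iff)

lemma sees_sound:
  assumes "sees C k (vis_of s V) b i"
  shows "(i \<in> chosen) = b"
proof (cases b)
  case True
  then show ?thesis using assms by (auto simp: sees_def chosen_iff vis_of_def)
next
  case False
  then obtain a where a: "a < k + 1" "s a < i + 1" "i + 1 < s (a + 1)"
    using assms by (auto simp: sees_def vis_of_def)
  have False if "c < k" "s (c + 1) = i + 1" for c
  proof (cases "c + 1 \<le> a")
    case True
    then have "s (c + 1) \<le> s a" using mono[of "c + 1" a] a(1) by (cases "c + 1 = a") auto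
    then show False using a that by simp
  next
    case False
    then have "s (a + 1) \<le> s (c + 1)" using mono[of "a + 1" "c + 1"] that(1) by (cases "c = a") auto
    then show False using a that by simp
  qed
  then show ?thesis using False chosen_iff by blast
qed

lemma sees_complete:
  assumes "i < gates C"
  shows "\<exists>V. V \<subseteq> {..k + 1} \<and> card V \<le> 2 \<and> sees C k (vis_of s V) (i \<in> chosen) i"
proof (cases "i \<in> chosen")
  case True
  then obtain a where "a < k" "s (a + 1) = i + 1" using chosen_iff by blast
  then show ?thesis using True by (intro exI[of _ "{a + 1}"]) (auto simp: sees_def vis_of_def)
next
  case False
  \<comment> \<open>The sequence starts below \<open>i + 1\<close> and ends at
    \<open>gates C + 1\<close>, so some step leads from below \<open>i + 1\<close> to at least
    \<open>i + 1\<close>. The two ends of this step form the view.\<close>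
  have "\<exists>a\<le>k. s a < i + 1 \<and> \<not> s (a + 1) < i + 1"
  proof (rule ccontr)
    assume no: "\<not> ?thesis"
    have "a \<le> k + 1 \<Longrightarrow> s a < i + 1" for a
    proof (induction a)
      case (Suc a)
      then show ?case using no by (metis Suc_eq_plus1 Suc_le_mono Suc_leD)
    qed (simp add: first)
    from this[of "k + 1"] show False using last assms by simp
  qed
  then obtain a where a: "a \<le> k" "s a < i + 1" "i + 1 \<le> s (a + 1)" by auto
  have "s (a + 1) \<noteq> i + 1" using False chosen_iff a(1) last assms by (cases "a = k") auto
  then have "i + 1 < s (a + 1)" using a(3) by simp
  moreover have "s (a + 1) < gates C + 2"
    using a(1) last mono[of "a + 1" "k + 1"] by (cases "a = k") auto
  ultimately have "sees C k (vis_of s {a, a + 1}) False i"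
    using a by (auto simp: sees_def vis_of_def intro!: exI[of _ a])
  then show ?thesis using False a by (intro exI[of _ "{a, a + 1}"]) auto
qed

abbreviation val :: "nat \<Rightarrow> bool" where
  "val \<equiv> gate_value C chosen"

lemma determined_sound: "determined C k (vis_of s V) m b i \<Longrightarrow> val i = b"
proof (induction m arbitrary: b i)
  case 0
  then show ?case using sees_sound gate_value_cases(1)[OF wf] by auto
next
  case (Suc m)
  consider "indegree C i = 0" | "indegree C i = 1" | "indegree C i \<ge> 2" by linarith
  then show ?case
  proof cases
    case 1
    then show ?thesis using Suc.prems sees_sound gate_value_cases(1)[OF wf] by auto
  next
    case 2
    then obtain j where "wire C j i" "determined C k (vis_of s V) m (\<not> b) j" using Suc.prems by auto
    then show ?thesis using Suc.IH gate_value_cases(2)[OF wf 2] by blast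
  next
    case 3
    then have "if (i \<in> and_gates C) = b then \<forall>j. wire C j i \<longrightarrow> val j = b else \<exists>j. wire C j i \<and> val j = b"
      using Suc.prems Suc.IH wire_less[OF wf, of _ i] by (simp split: if_splits) blast+
    then show ?thesis using gate_value_cases(3)[OF wf 3] by blast
  qed
qed

text \<open>Two entries settle an input gate, and a thin gate has at most two children, so the bound
  doubles with each level.\<close>

lemma determined_complete:
  "i < gates C \<Longrightarrow> depth_le C m i \<Longrightarrow> thin C m i \<Longrightarrow>
    \<exists>V. V \<subseteq> {..k + 1} \<and> card V \<le> 2 * 2 ^ m \<and> determined C k (vis_of s V) m (val i) i"
proof (induction m arbitrary: i)
  case 0
  then show ?case using sees_complete[of i] gate_value_cases(1)[OF wf] by auto
next
  case (Suc m)
  let ?ch = "{j. wire C j i}"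
  have ch: "j < gates C" "depth_le C m j" "thin C m j" "j < i" if "wire C j i" for j
    using Suc.prems wire_less[OF wf that] that by auto
  have "\<forall>j\<in>?ch. \<exists>V. V \<subseteq> {..k + 1} \<and> card V \<le> 2 * 2 ^ m \<and> determined C k (vis_of s V) m (val j) j"
    using Suc.IH ch by simp
  then obtain V where V: "\<And>j. wire C j i \<Longrightarrow> V j \<subseteq> {..k + 1} \<and> card (V j) \<le> 2 * 2 ^ m \<and> determined C k (vis_of s (V j)) m (val j) j"
    unfolding bchoice_iff by blast
  define U where "U = (\<Union>j\<in>?ch. V j)"
  show ?case
  proof (cases "indegree C i = 0")
    case True
    have "(2::nat) \<le> 2 * 2 ^ Suc m" by simp
    moreover obtain V where V: "V \<subseteq> {..k + 1}" "card V \<le> 2" "sees C k (vis_of s V) (i \<in> chosen) i"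
      using sees_complete[OF Suc.prems(1)] by blast
    ultimately have "card V \<le> 2 * 2 ^ Suc m" by linarith
    moreover have "val i = (i \<in> chosen)" using gate_value_cases(1)[OF wf True] .
    then have "determined C k (vis_of s V) (Suc m) (val i) i" using V(3) True by simp
    ultimately show ?thesis using V(1) by blast
  next
    case False
    have fin: "finite ?ch" using finite_children[OF wf] .
    have "card U \<le> (\<Sum>j\<in>?ch. card (V j))" unfolding U_def by (rule card_UN_le[OF fin])
    also have "\<dots> \<le> card ?ch * (2 * 2 ^ m)" using V by (intro sum_bounded_above[where 'a = nat, simplified]) auto
    also have "\<dots> \<le> 2 * (2 * 2 ^ m)" using Suc.prems(3) by (simp add: indegree_def)
    finally have "card U \<le> 2 * 2 ^ Suc m" by simp
    moreover have "U \<subseteq> {..k + 1}" unfolding U_def using V by blast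
    moreover have det: "determined C k (vis_of s U) m (val j) j" if "wire C j i" for j
    proof (rule determined_mono)
      show "determined C k (vis_of s (V j)) m (val j) j" using V[OF that] by blast
      show "vis_of s U a v" if "vis_of s (V j) a v" for a v
        using that \<open>wire C j i\<close> by (auto simp: U_def vis_of_def)
    qed
    have "determined C k (vis_of s U) (Suc m) (val i) i"
    proof (cases "indegree C i = 1")
      case True
      then obtain j where j: "wire C j i" using False indegree_0[OF wf, of i] by auto
      then show ?thesis using True det[OF j] gate_value_cases(2)[OF wf True j] ch(4)[OF j] by auto
    next
      case F: False
      then have "indegree C i \<ge> 2" using False by simp
      then have gv: "if (i \<in> and_gates C) = val i then \<forall>j. wire C j i \<longrightarrow> val j = val i else \<exists>j. wire C j i \<and> val j = val i"
        using gate_value_cases(3)[OF wf, of i chosen "val i"] by blast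
      show ?thesis
      proof (cases "(i \<in> and_gates C) = val i")
        case True
        then have "\<forall>j<i. wire C j i \<longrightarrow> determined C k (vis_of s U) m (val i) j" using gv det by auto
        then show ?thesis using False F True by simp
      next
        case ne: False
        then obtain j where j: "wire C j i" "val j = val i" using gv by auto
        then have "\<exists>j<i. wire C j i \<and> determined C k (vis_of s U) m (val i) j"
          using det[OF j(1)] ch(4) by auto
        then show ?thesis using False F ne by simp
      qed
    qed
    ultimately show ?thesis by blast
  qed
qed

lemma cert_bound_pos: "0 < gates C \<Longrightarrow> 0 < cert_bound (gates C) m"
  by (induction m) auto

text \<open>A wrong claim is refuted along a single path: a conjunction has a wrong child, and a
  disjunction is followed to the child that the certificate names. Entries are spent only where the
  path ends, at an input gate or at a child of a big conjunction, and that child is determined by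
  few of them.\<close>

lemma refuted_sound:
  "i < gates C \<Longrightarrow> depth_le C m i \<Longrightarrow> weft_le_1 C m i \<Longrightarrow> val i \<noteq> b \<Longrightarrow>
    \<exists>V. V \<subseteq> {..k + 1} \<and> card V \<le> 2 * 2 ^ m \<and> refuted C k (vis_of s V) m b i c"
proof (induction m arbitrary: i b c)
  case 0
  then show ?case using sees_complete[of i] gate_value_cases(1)[OF wf, of i chosen] by auto
next
  case (Suc m)
  have le: "(2::nat) \<le> 2 * 2 ^ Suc m" "(2::nat) * 2 ^ m \<le> 2 * 2 ^ Suc m" by simp_all
  have ch: "j < gates C" "depth_le C m j" "if indegree C i \<le> 2 then weft_le_1 C m j else thin C m j" "j < i"
    if "wire C j i" for j
    using Suc.prems wire_less[OF wf that] that by auto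
  consider "indegree C i = 0" | "indegree C i = 1" | "indegree C i \<ge> 2" by linarith
  then show ?case
  proof cases
    case 1
    then have "val i = (i \<in> chosen)" by (rule gate_value_cases(1)[OF wf])
    then have "(i \<in> chosen) = (\<not> b)" using Suc.prems(4) by blast
    moreover obtain V where V: "V \<subseteq> {..k + 1}" "card V \<le> 2" "sees C k (vis_of s V) (i \<in> chosen) i"
      using sees_complete[OF Suc.prems(1)] by blast
    ultimately have "refuted C k (vis_of s V) (Suc m) b i c" using 1 by simp
    moreover have "card V \<le> 2 * 2 ^ Suc m" using V(2) le(1) by linarith
    ultimately show ?thesis using V(1) by blast
  next
    case 2
    then obtain j where j: "wire C j i" using indegree_0[OF wf, of i] by auto
    have "val j \<noteq> (\<not> b)" using gate_value_cases(2)[OF wf 2 j] Suc.prems(4) by blast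
    moreover have "weft_le_1 C m j" using ch(3)[OF j] 2 by simp
    ultimately obtain V where "V \<subseteq> {..k + 1}" "card V \<le> 2 * 2 ^ m" "refuted C k (vis_of s V) m (\<not> b) j c"
      using Suc.IH[of j "\<not> b" c] ch j by blast
    then show ?thesis using le(2) 2 j ch(4) by (intro exI[of _ V]) auto
  next
    case 3
    note gv = gate_value_cases(3)[OF wf 3, of chosen b]
    show ?thesis
    proof (cases "(i \<in> and_gates C) = b")
      case True
      then obtain j where j: "wire C j i" "val j \<noteq> b" using gv Suc.prems(4) by auto
      show ?thesis
      proof (cases "indegree C i \<le> 2")
        case small: True
        \<comment> \<open>The quotient belongs to the child of smallest number, the remainder to the
          other child.\<close>
        define c' where "c' = (if \<forall>j'<j. \<not> wire C j' i then c div cert_bound (gates C) m else c mod cert_bound (gates C) m)"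
        obtain V where V: "V \<subseteq> {..k + 1}" "card V \<le> 2 * 2 ^ m" "refuted C k (vis_of s V) m b j c'"
          using Suc.IH[of j b c'] ch[OF j(1)] j(2) small by auto
        let ?r = "refuted C k (vis_of s V)" and ?B = "cert_bound (gates C) m"
        have "if \<forall>j'<j. \<not> wire C j' i then ?r m b j (c div ?B) else ?r m b j (c mod ?B)"
          using V(3) unfolding c'_def by (auto split: if_splits)
        then have "\<exists>j<i. wire C j i \<and> (if \<forall>j'<j. \<not> wire C j' i then ?r m b j (c div ?B) else ?r m b j (c mod ?B))"
          using j(1) ch(4)[OF j(1)] by blast
        then have "?r (Suc m) b i c" using 3 True small by simp
        then show ?thesis using V le(2) by (intro exI[of _ V]) linarith
      next
        case False
        have "val j = (\<not> b)" using j(2) by blast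
        then obtain V where "V \<subseteq> {..k + 1}" "card V \<le> 2 * 2 ^ m" "determined C k (vis_of s V) m (\<not> b) j"
          using determined_complete[of j m] ch[OF j(1)] False by auto
        then show ?thesis using le(2) 3 j ch(4) True False by (intro exI[of _ V]) auto
      qed
    next
      case False
      define j where "j = c div cert_bound (gates C) m"
      have nv: "wire C j i \<Longrightarrow> val j \<noteq> b" using False gv Suc.prems(4) by auto
      show ?thesis
      proof (cases "j < i \<and> wire C j i")
        case True
        define c' where "c' = c mod cert_bound (gates C) m"
        have "weft_le_1 C m j" using ch(3)[of j] True thin_imp_weft_le_1 by (auto split: if_splits)
        then obtain V where "V \<subseteq> {..k + 1}" "card V \<le> 2 * 2 ^ m" "refuted C k (vis_of s V) m b j c'"
          using Suc.IH[of j b c'] ch[of j] True nv by blast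
        then show ?thesis using le(2) 3 True False unfolding j_def c'_def by (intro exI[of _ V]) auto
      next
        case F: False
        then show ?thesis using 3 False unfolding j_def by (intro exI[of _ "{}"]) auto
      qed
    qed
  qed
qed

text \<open>A certificate is assembled from those of the children. At a big conjunction any number
  serves, since no child with the right value can be determined to have the opposite one.\<close>

lemma refuted_complete:
  "i < gates C \<Longrightarrow> val i = b \<Longrightarrow> \<exists>c<cert_bound (gates C) m. \<not> refuted C k (vis_of s UNIV) m b i c"
proof (induction m arbitrary: i b)
  case 0
  have "\<not> refuted C k (vis_of s UNIV) 0 b i 0"
    using sees_sound[of UNIV "\<not> b" i] gate_value_cases(1)[OF wf, of i chosen] 0 by auto
  then show ?case by auto
next
  case (Suc m)
  let ?B = "cert_bound (gates C) m" and ?R = "refuted C k (vis_of s UNIV)"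
  have B: "0 < ?B" using cert_bound_pos Suc.prems(1) by auto
  have le: "?B \<le> cert_bound (gates C) (Suc m)" "gates C * ?B \<le> cert_bound (gates C) (Suc m)" "?B * ?B \<le> cert_bound (gates C) (Suc m)"
    using mult_le_mono1[of 1 ?B ?B] B by (simp_all add: add_mult_distrib trans_le_add2)
  have pair: "(a * ?B + c) div ?B = a" "(a * ?B + c) mod ?B = c" if "c < ?B" for a c using that by auto
  have pair_less: "a * ?B + c < x * ?B" if "c < ?B" "a < x" for a c x
  proof -
    have "a * ?B + c < Suc a * ?B" using that by simp
    also have "\<dots> \<le> x * ?B" using that by (intro mult_right_mono) auto
    finally show ?thesis .
  qed
  consider "indegree C i = 0" | "indegree C i = 1" | "indegree C i \<ge> 2" by linarith
  then show ?case
  proof cases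
    case 1
    then have "\<not> ?R (Suc m) b i 0"
      using sees_sound[of UNIV "\<not> b" i] gate_value_cases(1)[OF wf, of i chosen] Suc.prems by auto
    then show ?thesis using B le(1) by (intro exI[of _ 0]) linarith
  next
    case 2
    then obtain j where j: "wire C j i" using indegree_0[OF wf, of i] by auto
    have uniq: "j' = j" if "wire C j' i" for j'
    proof -
      have "card {j. wire C j i} = 1" using 2 by (simp add: indegree_def)
      then obtain a where "{j. wire C j i} = {a}" by (rule card_1_singletonE)
      then show ?thesis using j that by (metis mem_Collect_eq singletonD)
    qed
    have "val j = (\<not> b)" using gate_value_cases(2)[OF wf 2 j] Suc.prems(2) by blast
    then obtain c where c: "c < ?B" "\<not> ?R m (\<not> b) j c" using Suc.IH[of j "\<not> b"] wire_less[OF wf j] Suc.prems(1) by auto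
    then have "\<not> ?R (Suc m) b i c" using 2 uniq by auto
    then show ?thesis using c(1) le(1) by (intro exI[of _ c]) linarith
  next
    case 3
    note gv = gate_value_cases(3)[OF wf 3, of chosen b]
    show ?thesis
    proof (cases "(i \<in> and_gates C) = b")
      case True
      then have all: "val j = b" if "wire C j i" for j using gv Suc.prems(2) that by auto
      show ?thesis
      proof (cases "indegree C i \<le> 2")
        case False
        then have "\<not> ?R (Suc m) b i 0"
          using determined_sound[of UNIV m "\<not> b"] all 3 True by auto
        then show ?thesis using B le(1) by (intro exI[of _ 0]) linarith
      next
        case small: True
        have "card {j. wire C j i} = 2" using small 3 by (simp add: indegree_def)
        then obtain a b' where "{j. wire C j i} = {a, b'}" "a \<noteq> b'" by (auto simp: card_2_iff)
        then obtain j1 j2 where j: "{j. wire C j i} = {j1, j2}" "j1 < j2"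
          by (metis insert_commute linorder_neqE_nat)
        then have ch: "wire C j i \<longleftrightarrow> j = j1 \<or> j = j2" for j by (metis insert_iff mem_Collect_eq singletonD)
        then have w: "wire C j1 i" "wire C j2 i" by blast+
        obtain c1 where c1: "c1 < ?B" "\<not> ?R m b j1 c1" using Suc.IH[of j1 b] all w wire_less[OF wf w(1)] Suc.prems(1) by auto
        obtain c2 where c2: "c2 < ?B" "\<not> ?R m b j2 c2" using Suc.IH[of j2 b] all w wire_less[OF wf w(2)] Suc.prems(1) by auto
        have nr: "\<not> (if \<forall>j'<j. \<not> wire C j' i then ?R m b j c1 else ?R m b j c2)" if "wire C j i" for j
        proof -
          have "j = j1 \<or> j = j2" using that ch by blast
          moreover have "\<not> wire C j' i" if "j' < j1" for j' using that j(2) ch by auto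
          ultimately show ?thesis using c1 c2 w j(2) by auto
        qed
        have "\<not> ?R (Suc m) b i (c1 * ?B + c2)"
        proof
          assume "?R (Suc m) b i (c1 * ?B + c2)"
          then have "\<exists>j<i. wire C j i \<and> (if \<forall>j'<j. \<not> wire C j' i then ?R m b j ((c1 * ?B + c2) div ?B)
              else ?R m b j ((c1 * ?B + c2) mod ?B))"
            using small 3 True by simp
          then obtain j where jw: "wire C j i" and jr: "if \<forall>j'<j. \<not> wire C j' i then ?R m b j c1 else ?R m b j c2"
            unfolding pair[OF c2(1)] by (elim exE conjE)
          from nr[OF jw] jr show False by (rule notE)
        qed
        moreover have "c1 * ?B + c2 < cert_bound (gates C) (Suc m)" using pair_less[OF c2(1) c1(1)] le(3) by linarith
        ultimately show ?thesis by blast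
      qed
    next
      case False
      then obtain j where j: "wire C j i" "val j = b" using gv Suc.prems(2) by auto
      then obtain c where c: "c < ?B" "\<not> ?R m b j c" using Suc.IH[of j b] wire_less[OF wf j(1)] Suc.prems(1) by auto
      then have "\<not> ?R (Suc m) b i (j * ?B + c)" using 3 False pair[OF c(1)] j wire_less[OF wf j(1)] by simp
      moreover have "j * ?B + c < cert_bound (gates C) (Suc m)"
        using pair_less[OF c(1), of j "gates C"] wire_less[OF wf j(1)] Suc.prems(1) le(2) by linarith
      ultimately show ?thesis by blast
    qed
  qed
qed

end

text \<open>Over all views, the clauses for one entry and for two entries force the sequence to be a
  \<open>selection\<close> of input gates. Values range below an explicit \<open>D\<close> because
  only bounded quantifiers can be computed.\<close>

definition good :: "circuit \<Rightarrow> nat \<Rightarrow> nat \<Rightarrow> nat \<Rightarrow> (nat \<Rightarrow> nat \<Rightarrow> bool) \<Rightarrow> bool" where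
  "good C k d D vis \<longleftrightarrow>
    (\<forall>a<k + 2. \<forall>v<D. vis a v \<longrightarrow> (a = 0 \<longrightarrow> v = 0) \<and> (a = k + 1 \<longrightarrow> v = gates C + 1) \<and>
       (0 < a \<and> a \<le> k \<longrightarrow> v - 1 < gates C \<and> indegree C (v - 1) = 0)) \<and>
    (\<forall>a<k + 2. \<forall>v<D. \<forall>b<k + 2. \<forall>w<D. vis a v \<and> vis b w \<and> a < b \<longrightarrow> v < w) \<and>
    (\<forall>c<D. vis (k + 2) c \<longrightarrow> \<not> refuted C k vis d True (gates C - 1) c)"

text \<open>\<open>D\<close> leaves room for the entries of the sequence, which go up to
  \<open>gates C + 1\<close>, and for every certificate.\<close>

lemma satisfiable_iff_good:
  assumes wf: "wf_circuit C" and depth: "depth_le C d (gates C - 1)" and weft: "weft_le_1 C d (gates C - 1)"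
    and D: "D = gates C + 2 + cert_bound (gates C) d"
  shows "(\<exists>X\<subseteq>input_gates C. card X = k \<and> gate_value C X (output_gate C)) \<longleftrightarrow>
    (\<exists>s. (\<forall>a<k + 3. s a < D) \<and>
      (\<forall>V. V \<subseteq> {..<k + 3} \<and> V \<noteq> {} \<and> card V \<le> 2 * 2 ^ d + 1 \<longrightarrow> good C k d D (vis_of s V)))"
proof
  have n: "gates C - 1 < gates C" using wf by (auto simp: wf_circuit_def)
  assume "\<exists>X\<subseteq>input_gates C. card X = k \<and> gate_value C X (output_gate C)"
  then obtain X where X: "X \<subseteq> input_gates C" "card X = k" "gate_value C X (gates C - 1)"
    unfolding output_gate_def by blast
  have finX: "finite X" using X(1) by (rule finite_subset) (simp add: input_gates_def)
  define xs where "xs = sorted_list_of_set X"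
  have xs: "length xs = k" "set xs = X" "sorted_wrt (<) xs"
    unfolding xs_def using finX X(2) by (auto simp: strict_sorted_list_of_set)
  have xsn: "xs ! a < gates C" "indegree C (xs ! a) = 0" if "a < k" for a
    using that xs X(1) nth_mem[of a xs] by (auto simp: input_gates_def)
  define s0 where "s0 a = (if a = 0 then 0 else if a \<le> k then xs ! (a - 1) + 1 else gates C + 1)" for a
  have mono0: "s0 a < s0 b" if "a < b" "b \<le> k + 1" for a b
    using that xsn[of "a - 1"] sorted_wrt_nth_less[OF xs(3), of "a - 1" "b - 1"] xs(1) unfolding s0_def by auto
  interpret S: selection C k s0
    by standard (use wf mono0 in \<open>auto simp: s0_def\<close>)
  have "S.chosen = X"
  proof -
    have "S.chosen = (!) xs ` {..<k}" unfolding S.chosen_def by (intro image_cong) (auto simp: s0_def)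
    also have "\<dots> = set xs" using xs(1) by (auto simp: set_conv_nth)
    finally show ?thesis using xs(2) by simp
  qed
  then obtain c where c: "c < cert_bound (gates C) d" "\<not> refuted C k (vis_of s0 UNIV) d True (gates C - 1) c"
    using S.refuted_complete[OF n, of True d] X(3) by auto
  define s where "s = s0(k + 2 := c)"
  have "good C k d D (vis_of s V)" for V
  proof -
    have nr: "\<not> refuted C k (vis_of s V) d True (gates C - 1) c"
      using c(2) refuted_mono[of C k "vis_of s V" d True "gates C - 1" c "vis_of s0 UNIV"]
      by (auto simp: vis_of_def s_def)
    have ms: "s a < s b" if "a < b" "b < k + 2" for a b using mono0[of a b] that by (simp add: s_def)
    have ends: "s 0 = 0" "s (k + 1) = gates C + 1" "s (k + 2) = c" by (auto simp: s_def s0_def)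
    have inp: "s a - 1 < gates C" "indegree C (s a - 1) = 0" if "0 < a" "a \<le> k" for a
      using xsn[of "a - 1"] that by (auto simp: s_def s0_def)
    show ?thesis
      unfolding good_def
    proof (intro conjI allI impI)
      fix v' assume "vis_of s V (k + 2) v'"
      then show "\<not> refuted C k (vis_of s V) d True (gates C - 1) v'" using nr ends(3) by (simp add: vis_of_def)
    qed (use ms ends inp in \<open>auto simp: vis_of_def\<close>)
  qed
  moreover have "s a < D" if "a < k + 3" for a
  proof (cases "0 < a \<and> a \<le> k")
    case True
    then have "xs ! (a - 1) < gates C" "s a = xs ! (a - 1) + 1" using xsn[of "a - 1"] by (auto simp: s_def s0_def)
    then show ?thesis unfolding D by linarith
  next
    case False
    then show ?thesis using that c(1) unfolding D s_def s0_def by auto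
  qed
  ultimately show "\<exists>s. (\<forall>a<k + 3. s a < D) \<and>
      (\<forall>V. V \<subseteq> {..<k + 3} \<and> V \<noteq> {} \<and> card V \<le> 2 * 2 ^ d + 1 \<longrightarrow> good C k d D (vis_of s V))"
    by blast
next
  have n: "gates C - 1 < gates C" using wf by (auto simp: wf_circuit_def)
  assume "\<exists>s. (\<forall>a<k + 3. s a < D) \<and>
      (\<forall>V. V \<subseteq> {..<k + 3} \<and> V \<noteq> {} \<and> card V \<le> 2 * 2 ^ d + 1 \<longrightarrow> good C k d D (vis_of s V))"
  then obtain s where s1: "\<forall>a<k + 3. s a < D"
    and s2: "\<forall>V. V \<subseteq> {..<k + 3} \<and> V \<noteq> {} \<and> card V \<le> 2 * 2 ^ d + 1 \<longrightarrow> good C k d D (vis_of s V)"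
    by (elim exE conjE)
  from s1 have s: "s a < D" if "a < k + 3" for a using that by simp
  from s2 have good: "good C k d D (vis_of s V)" if "V \<subseteq> {..<k + 3}" "V \<noteq> {}" "card V \<le> 2 * 2 ^ d + 1" for V
    using that by simp
  have one: "(a = 0 \<longrightarrow> s a = 0) \<and> (a = k + 1 \<longrightarrow> s a = gates C + 1) \<and>
       (0 < a \<and> a \<le> k \<longrightarrow> s a - 1 < gates C \<and> indegree C (s a - 1) = 0)" if "a < k + 2" for a
    using good[of "{a}"] that s[of a] by (auto simp: good_def vis_of_def)
  have two: "s a < s b" if "a < b" "b \<le> k + 1" for a b
  proof -
    have "card {a, b} \<le> 2 * 2 ^ d + 1" using that one_le_power[of "2::nat" d] by simp
    then have "good C k d D (vis_of s {a, b})" using that by (intro good) auto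
    moreover have "a < k + 2" "b < k + 2" "s a < D" "s b < D" using that s by auto
    moreover have "vis_of s {a, b} a (s a)" "vis_of s {a, b} b (s b)" by (auto simp: vis_of_def)
    ultimately show ?thesis using that(1) unfolding good_def by blast
  qed
  interpret S: selection C k s
    by standard (use wf two one[of 0] one[of "k + 1"] in auto)
  have "S.chosen \<subseteq> input_gates C" unfolding S.chosen_def input_gates_def
  proof clarify
    fix a assume "a < k"
    then show "s (a + 1) - 1 < gates C \<and> indegree C (s (a + 1) - 1) = 0" using one[of "a + 1"] by simp
  qed
  moreover have "inj_on (\<lambda>a. s (a + 1) - 1) {..<k}"
  proof (rule inj_onI)
    fix a b assume ab: "a \<in> {..<k}" "b \<in> {..<k}" "s (a + 1) - 1 = s (b + 1) - 1"
    then have "s (a + 1) = s (b + 1)" using S.pos[of a] S.pos[of b] by simp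
    then show "a = b" using two[of "a + 1" "b + 1"] two[of "b + 1" "a + 1"] ab by (cases a b rule: linorder_cases) auto
  qed
  then have "card S.chosen = k" unfolding S.chosen_def by (simp add: card_image)
  moreover have "S.val (gates C - 1)"
  proof (rule ccontr)
    assume "\<not> S.val (gates C - 1)"
    then obtain V where V: "V \<subseteq> {..k + 1}" "card V \<le> 2 * 2 ^ d" "refuted C k (vis_of s V) d True (gates C - 1) (s (k + 2))"
      using S.refuted_sound[OF n depth weft, of True "s (k + 2)"] by auto
    \<comment> \<open>The view has to show the certificate next to the entries that refute it; this
      is the summand 1 in the permitted size.\<close>
    let ?W = "insert (k + 2) V"
    have "refuted C k (vis_of s ?W) d True (gates C - 1) (s (k + 2))"
      using refuted_mono[OF V(3), of "vis_of s ?W"] by (auto simp: vis_of_def)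
    moreover have "?W \<subseteq> {..<k + 3}" using V(1) by auto
    then have "good C k d D (vis_of s ?W)" using V(2) card_insert_le_m1[of "2 * 2 ^ d + 1" V "k + 2"] by (intro good) auto
    moreover have "s (k + 2) < D" "vis_of s ?W (k + 2) (s (k + 2))" using s by (auto simp: vis_of_def)
    ultimately show False unfolding good_def by blast
  qed
  ultimately show "\<exists>X\<subseteq>input_gates C. card X = k \<and> gate_value C X (output_gate C)"
    unfolding output_gate_def by blast
qed

section \<open>Cells\<close>

text \<open>A cell has two copies of each port; the copy \<open>Port True u\<close> can also be reached from the home \<open>CHome\<close> of the checker.
It has two guards, with homes \<open>GHome False\<close> and \<open>GHome True\<close>; a guard of colour \<open>v\<close> blocks all ports of other colours.\<close>
datatype spot = Port bool nat | Guard bool nat | GHome bool | PHome | CHome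

fun spot_arc :: "spot \<Rightarrow> spot \<Rightarrow> bool" where
  "spot_arc (Port c u) (Guard l v) = (u \<noteq> v)"
| "spot_arc (GHome l) (Guard l' v) = (l = l')"
| "spot_arc PHome (Port c u) = True"
| "spot_arc CHome (Port c u) = c"
| "spot_arc _ _ = False"

definition spot_adj :: "spot \<Rightarrow> spot \<Rightarrow> bool" where
  "spot_adj x y \<longleftrightarrow> spot_arc x y \<or> spot_arc y x"

definition spot_indep :: "spot set \<Rightarrow> bool" where
  "spot_indep Y \<longleftrightarrow> (\<forall>x\<in>Y. \<forall>y\<in>Y. \<not> spot_adj x y)"

definition guard_layer :: "bool \<Rightarrow> spot set" where
  "guard_layer l = insert (GHome l) (range (Guard l))"

text \<open>In the next three definitions, \<open>v\<close> says that the checker of the cell is still in its pool. The states \<open>W\<close> and \<open>V\<close> of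
\<open>cell_inv\<close>, in which two ports or two guards of one layer conflict, do not help but are reachable.\<close>
definition rest :: "bool \<Rightarrow> spot set set" where
  "rest v = (if v then insert {PHome} {{Port c u} |c u. True}
     else insert {PHome, CHome} ({{Port False u, CHome} |u. True} \<union> {{Port False u, Port True w} |u w. True}))"

definition crowded :: "bool \<Rightarrow> spot set set" where
  "crowded v = (if v then {{Port c u, Port c' w} |c u c' w. u \<noteq> w}
     else {{Port False u, Port False w, CHome} |u w. u \<noteq> w} \<union>
       {{Port c u, Port c' w, Port True z} |c u c' w z. (c, u) \<noteq> (c', w) \<and> (c, u) \<noteq> (True, z) \<and> (c', w) \<noteq> (True, z)})"

inductive cell_inv :: "bool \<Rightarrow> spot set \<Rightarrow> bool" where
  N: "x \<in> guard_layer l \<Longrightarrow> y \<in> guard_layer (\<not> l) \<Longrightarrow> R \<in> rest v \<Longrightarrow> cell_inv v ({x, y} \<union> R)"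
| W: "R \<in> crowded v \<Longrightarrow> cell_inv v (insert (GHome l) R)"
| V: "u \<noteq> w \<Longrightarrow> y \<in> guard_layer (\<not> l) \<Longrightarrow> cell_inv v ({Guard l u, Guard l w, y} \<union> (if v then {} else {CHome}))"

lemma guard_layer_simps [simp]:
  "GHome l \<in> guard_layer l' \<longleftrightarrow> l = l'" "Guard l v \<in> guard_layer l' \<longleftrightarrow> l = l'"
  "PHome \<notin> guard_layer l" "CHome \<notin> guard_layer l" "Port c u \<notin> guard_layer l"
  by (auto simp: guard_layer_def)

section \<open>Case distinctions on the states of a cell\<close>

lemma guard_layerE: "x \<in> guard_layer l \<Longrightarrow> (x = GHome l \<Longrightarrow> R) \<Longrightarrow> (\<And>v. x = Guard l v \<Longrightarrow> R) \<Longrightarrow> R"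
  by (auto simp: guard_layer_def)

lemma spot_adj_simps:
  "spot_adj (Port c a) w \<longleftrightarrow> (\<exists>l v. w = Guard l v \<and> a \<noteq> v) \<or> w = PHome \<or> (c \<and> w = CHome)"
  "spot_adj (Guard l v) w \<longleftrightarrow> (\<exists>c a. w = Port c a \<and> a \<noteq> v) \<or> w = GHome l"
  "spot_adj (GHome l) w \<longleftrightarrow> (\<exists>v. w = Guard l v)"
  "spot_adj PHome w \<longleftrightarrow> (\<exists>c u. w = Port c u)"
  "spot_adj CHome w \<longleftrightarrow> (\<exists>u. w = Port True u)"
  unfolding spot_adj_def by (cases w; auto)+

lemma cell_inv_normal:
  assumes "cell_inv v Y" "spot_indep Y"
  obtains x l y R where "x \<in> guard_layer l" "y \<in> guard_layer (\<not> l)" "R \<in> rest v" "Y = {x, y} \<union> R"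
  | R l where "R \<in> crowded v" "Y = insert (GHome l) R"
  | u w y l where "u \<noteq> w" "y \<in> guard_layer (\<not> l)" "Y = {Guard l u, Guard l w, y} \<union> (if v then {} else {CHome})"
  using assms(1) by cases blast+

lemma rest_cases:
  assumes "R \<in> rest v"
  obtains "v" "R = {PHome}" | c u where "v" "R = {Port c u}" | "\<not> v" "R = {PHome, CHome}"
  | u where "\<not> v" "R = {Port False u, CHome}" | u w where "\<not> v" "R = {Port False u, Port True w}"
  using assms unfolding rest_def by (cases v) (simp_all, blast+)

lemma crowded_cases:
  assumes "R \<in> crowded v"
  obtains c u c' w where "v" "R = {Port c u, Port c' w}" "u \<noteq> w"
  | u w where "\<not> v" "R = {Port False u, Port False w, CHome}" "u \<noteq> w"
  | c u c' w z where "\<not> v" "R = {Port c u, Port c' w, Port True z}" "(c, u) \<noteq> (c', w)" "(c, u) \<noteq> (True, z)" "(c', w) \<noteq> (True, z)"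
  using assms unfolding crowded_def by (cases v) (simp_all, blast+)

lemma crowdedI:
  "u \<noteq> w \<Longrightarrow> {Port c u, Port c' w} \<in> crowded True"
  "u \<noteq> w \<Longrightarrow> {Port False u, Port False w, CHome} \<in> crowded False"
  "(c, u) \<noteq> (c', w) \<Longrightarrow> (c, u) \<noteq> (True, z) \<Longrightarrow> (c', w) \<noteq> (True, z) \<Longrightarrow>
    {Port c u, Port c' w, Port True z} \<in> crowded False"
  unfolding crowded_def if_True if_False by blast+

lemma restI:
  "{PHome} \<in> rest True" "{Port c u} \<in> rest True" "{PHome, CHome} \<in> rest False"
  "{Port False u, CHome} \<in> rest False" "{Port False u, Port True w} \<in> rest False"
  unfolding rest_def if_True if_False by blast+

lemma insert_CHome:
  "{CHome, PHome} \<in> rest False" "{CHome, Port False u} \<in> rest False"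
  "u \<noteq> w \<Longrightarrow> {CHome, Port False u, Port False w} \<in> crowded False"
  using restI(3) restI(4)[of u] crowdedI(2)[of u w] by (simp_all add: insert_commute)

section \<open>Domination of the unoccupied vertices of a cell\<close>

lemma crowded_not_const:
  assumes "R \<in> crowded v" shows "\<exists>c u. Port c u \<in> R \<and> u \<noteq> z"
  using assms by (cases rule: crowded_cases) auto

text \<open>A token on \<open>PHome\<close> is adjacent to every port. A token on a port of another
  colour forces the guards, which are out, to that colour, and these block the colour
  \<open>w\<close>. Of two guards in one layer, at least one has a colour other than
  \<open>w\<close>.\<close>

lemma cell_inv_port_dominated:
  assumes "cell_inv v Y" "spot_indep Y" "\<forall>l. GHome l \<notin> Y" "\<forall>c. Port c w \<notin> Y"
  shows "\<exists>x\<in>Y. spot_adj x (Port c w)"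
  using assms(1,2)
proof (cases rule: cell_inv_normal)
  case (1 x l y R)
  then obtain a where x: "x = Guard l a" using assms(3) by (auto elim: guard_layerE)
  have "PHome \<in> Y \<or> (\<exists>c u. Port c u \<in> Y)"
    using 1(3,4) by (cases rule: rest_cases) auto
  then show ?thesis
  proof
    assume "PHome \<in> Y" then show ?thesis by (rule bexI[rotated]) (simp add: spot_adj_simps)
  next
    assume "\<exists>c u. Port c u \<in> Y"
    then obtain c' u where u: "Port c' u \<in> Y" by blast
    then have "u \<noteq> w" using assms(4) by auto
    moreover have "\<not> spot_adj (Port c' u) x" using u 1 assms(2) unfolding spot_indep_def by blast
    ultimately have "spot_adj x (Port c w)" by (auto simp: spot_adj_simps x)
    then show ?thesis using 1 by blast
  qed
next
  case (2 R l)
  then show ?thesis using assms(3) by auto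
next
  case (3 u w' y l)
  then show ?thesis by (cases "u = w") (auto simp: spot_adj_simps)
qed

lemma cell_inv_no_port_dominated:
  assumes "cell_inv v Y" "spot_indep Y" "\<forall>c u. Port c u \<notin> Y"
  shows "\<exists>x\<in>Y. spot_adj x (Port c w)"
  using assms(1,2)
proof (cases rule: cell_inv_normal)
  case (1 x l y R)
  have "PHome \<in> Y"
    using 1(3,4) assms(3) by (cases rule: rest_cases) auto
  then show ?thesis by (rule bexI[rotated]) (simp add: spot_adj_simps)
next
  case (2 R l)
  then show ?thesis using crowded_not_const assms(3) by blast
next
  case (3 u w' y l)
  then show ?thesis by (cases "u = w") (auto simp: spot_adj_simps)
qed

text \<open>When no guard is at home, each layer still has a guard, and it is adjacent to the home
  of its layer.\<close>

lemma cell_inv_home_dominated: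
  assumes "cell_inv v Y" "spot_indep Y" "\<forall>l. GHome l \<notin> Y"
  shows "\<exists>x\<in>Y. spot_adj x (GHome l)"
  using assms(1,2)
proof (cases rule: cell_inv_normal)
  case (1 x l' y R)
  then obtain a b where "x = Guard l' a" "y = Guard (\<not> l') b" using assms(3) by (auto elim!: guard_layerE)
  then show ?thesis using 1 by (cases "l = l'") (auto simp: spot_adj_simps)
next
  case (2 R l)
  then show ?thesis using assms(3) by auto
next
  case (3 u w' y l')
  then obtain a where "y = Guard (\<not> l') a" using assms(3) by (auto elim!: guard_layerE)
  then show ?thesis using 3 by (cases "l = l'") (auto simp: spot_adj_simps)
qed

text \<open>It serves twice: the token on the second copy of the ports keeps others from entering
  \<open>CHome\<close>, and when nobody is at home it shows the value that the cell has
  chosen.\<close>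

lemma cell_inv_check_dominated:
  assumes "cell_inv False Y" "CHome \<notin> Y"
  shows "\<exists>u. Port True u \<in> Y"
  using assms(1)
proof cases
  case (N x l y R)
  from N(4) show ?thesis using N(1) assms(2) by (cases rule: rest_cases) auto
next
  case (W R l)
  from W(2) show ?thesis using W(1) assms(2) by (cases rule: crowded_cases) auto
next
  case (V u w y l)
  then show ?thesis using assms(2) by auto
qed

section \<open>Checkers leaving and entering a cell\<close>

lemma cell_inv_exit:
  assumes "cell_inv False Y" "CHome \<in> Y"
  shows "cell_inv True (Y - {CHome})"
  using assms(1)
proof cases
  case (N x l y R)
  then have ne: "x \<noteq> CHome" "y \<noteq> CHome" by auto
  then have "CHome \<in> R" using N assms(2) by auto
  with N(4) have "R - {CHome} \<in> rest True"
    by (cases rule: rest_cases) (simp_all add: insert_Diff_if restI)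
  moreover have "Y - {CHome} = {x, y} \<union> (R - {CHome})" using N(1) ne by auto
  ultimately show ?thesis using cell_inv.N[OF N(2,3), of "R - {CHome}" True] by metis
next
  case (W R l)
  then have "CHome \<in> R" using assms(2) by auto
  with W(2) have "R - {CHome} \<in> crowded True"
    by (cases rule: crowded_cases) (simp_all add: insert_Diff_if crowdedI)
  moreover have "Y - {CHome} = insert (GHome l) (R - {CHome})" using W(1) by auto
  ultimately show ?thesis using cell_inv.W[of "R - {CHome}" True l] by metis
next
  case (V u w y l)
  then have "Y - {CHome} = {Guard l u, Guard l w, y}" by auto
  then show ?thesis using cell_inv.V[OF V(2,3), of True] by simp
qed

lemma cell_inv_enter:
  assumes "cell_inv True Y" "\<forall>u. Port True u \<notin> Y"
  shows "cell_inv False (insert CHome Y)"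
  using assms(1)
proof cases
  case (N x l y R)
  then have no: "\<forall>u. Port True u \<notin> R" using assms(2) by blast
  from N(4) have "insert CHome R \<in> rest False"
    by (cases rule: rest_cases) (use no in \<open>simp_all add: insert_CHome\<close>)
  moreover have "insert CHome Y = {x, y} \<union> (insert CHome R)" using N(1) by auto
  ultimately show ?thesis using cell_inv.N[OF N(2,3), of "insert CHome R" False] by metis
next
  case (W R l)
  then have no: "\<forall>u. Port True u \<notin> R" using assms(2) by blast
  from W(2) have "insert CHome R \<in> crowded False"
  proof (cases rule: crowded_cases)
    case (1 c u c' w)
    then have "\<not> c" "\<not> c'" using no by auto
    then show ?thesis using 1 insert_CHome(3) by simp
  qed simp_all
  moreover have "insert CHome Y = insert (GHome l) (insert CHome R)" using W(1) by auto
  ultimately show ?thesis using cell_inv.W[of "insert CHome R" False l] by metis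
next
  case (V u w y l)
  then have "insert CHome Y = {Guard l u, Guard l w, y} \<union> {CHome}" by auto
  then show ?thesis using cell_inv.V[OF V(2,3), of False] by simp
qed

section \<open>Slides inside a cell\<close>

lemma cell_inv_N': "x \<in> guard_layer l \<Longrightarrow> y \<in> guard_layer (\<not> l) \<Longrightarrow> R \<in> rest v \<Longrightarrow> Y = {x, y} \<union> R \<Longrightarrow> cell_inv v Y"
  using cell_inv.N by simp

lemma cell_inv_W': "R \<in> crowded v \<Longrightarrow> Y = insert (GHome l) R \<Longrightarrow> cell_inv v Y"
  using cell_inv.W by simp

lemma cell_inv_V': "u \<noteq> w \<Longrightarrow> y \<in> guard_layer (\<not> l) \<Longrightarrow> Y = {Guard l u, Guard l w, y} \<union> (if v then {} else {CHome})
    \<Longrightarrow> cell_inv v Y"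
  using cell_inv.V by simp

lemma guard_layer_cases_adj:
  assumes "x \<in> guard_layer l" "spot_adj x w"
  obtains "w \<in> guard_layer l" | c a z where "x = Guard l a" "w = Port c z" "z \<noteq> a"
  using assms by (auto elim!: guard_layerE simp: spot_adj_simps)

lemma rest_disjoint: "R \<in> rest v \<Longrightarrow> x \<in> guard_layer l \<Longrightarrow> x \<notin> R"
  by (auto elim!: rest_cases guard_layerE)

text \<open>A guard of colour \<open>a\<close> can leave its layer only for a port of another
  colour. \<open>PHome\<close> is then empty, so some port is occupied, and its colour is
  \<open>a\<close>. The other guard must be at home: outside it would need the colour
  \<open>a\<close> for that port and the colour of the new port as well. The result is state
  \<open>W\<close>.\<close>

lemma cell_inv_step_guard:
  assumes x: "x \<in> guard_layer l" and y: "y \<in> guard_layer (\<not> l)" and R: "R \<in> rest v"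
    and ind: "spot_indep ({x, y} \<union> R)" and w: "w \<notin> {x, y} \<union> R" and adj: "spot_adj x w"
    and noadj: "\<And>z. z \<in> {x, y} \<union> R \<Longrightarrow> z \<noteq> x \<Longrightarrow> \<not> spot_adj z w"
  shows "cell_inv v (insert w ({x, y} \<union> R - {x}))"
proof -
  have xy: "x \<noteq> y" using x y by (auto elim!: guard_layerE)
  have eq: "insert w ({x, y} \<union> R - {x}) = {w, y} \<union> R" using xy rest_disjoint[OF R x] by auto
  from x adj show ?thesis
  proof (cases rule: guard_layer_cases_adj)
    case 1
    then show ?thesis unfolding eq using y R by (rule cell_inv.N)
  next
    case (2 c a z)
    have noR: "\<not> spot_adj r w" if "r \<in> R" for r using noadj[of r] that rest_disjoint[OF R x] by auto
    have same: "b = a" if "Port c' b \<in> R" for c' b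
      using ind that unfolding spot_indep_def 2 by (force simp: spot_adj_simps)
    have yH: "y = GHome (\<not> l)" if "Port c' b \<in> R" for c' b
    proof -
      have "b = a" using same that .
      moreover have "\<not> spot_adj y w" using noadj[of y] xy by auto
      moreover have "\<not> spot_adj (Port c' b) y" using ind that unfolding spot_indep_def by blast
      ultimately show ?thesis using y 2 by (auto elim!: guard_layerE simp: spot_adj_simps)
    qed
    from R show ?thesis
    proof (cases rule: rest_cases)
      case 1
      then show ?thesis using noR[of PHome] 2 by (auto simp: spot_adj_simps)
    next
      case (2 c' u)
      then have "u = a" "y = GHome (\<not> l)" using same yH by auto
      then show ?thesis unfolding eq using 2 \<open>w = Port c z\<close> \<open>z \<noteq> a\<close>
        by (intro cell_inv_W'[of "{Port c z, Port c' u}" _ _ "\<not> l"]) (auto simp: crowdedI)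
    next
      case 3
      then show ?thesis using noR[of PHome] 2 by (auto simp: spot_adj_simps)
    next
      case (4 u)
      then have "u = a" "y = GHome (\<not> l)" using same yH by auto
      moreover have "\<not> c" using noR[of CHome] 4 2 by (auto simp: spot_adj_simps)
      ultimately show ?thesis unfolding eq using 4 2
        by (intro cell_inv_W'[of "{Port False z, Port False u, CHome}" _ _ "\<not> l"]) (auto simp: crowdedI)
    next
      case (5 u t)
      then have "u = a" "t = a" "y = GHome (\<not> l)" using same yH by auto
      then show ?thesis unfolding eq using 5 2
        by (intro cell_inv_W'[of "{Port c z, Port False u, Port True t}" _ _ "\<not> l"]) (auto simp: crowdedI)
    qed
  qed
qed

text \<open>The critical slide takes a token from a port of colour \<open>a\<close> into a guard
  layer. The home of this layer must be empty, so its guard has colour \<open>a\<close>. A further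
  token on a port would need both \<open>a\<close> and the new colour, hence there is none, and the
  result is state \<open>V\<close>. All other slides stay in \<open>N\<close>.\<close>

lemma cell_inv_step_rest:
  assumes x: "x \<in> guard_layer l" and y: "y \<in> guard_layer (\<not> l)" and R: "R \<in> rest v" and u: "u \<in> R"
    and ind: "spot_indep ({x, y} \<union> R)" and w: "w \<notin> {x, y} \<union> R" and adj: "spot_adj u w"
    and noadj: "\<And>z. z \<in> {x, y} \<union> R \<Longrightarrow> z \<noteq> u \<Longrightarrow> \<not> spot_adj z w" and out: "v \<Longrightarrow> w \<noteq> CHome"
  shows "cell_inv v (insert w ({x, y} \<union> R - {u}))"
proof -
  have xu: "x \<noteq> u" "y \<noteq> u" using x y u rest_disjoint[OF R] by auto
  have eq: "insert w ({x, y} \<union> R - {u}) = {x, y} \<union> insert w (R - {u})" using xu by auto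
  have noR: "\<not> spot_adj r w" if "r \<in> R" "r \<noteq> u" for r using noadj[of r] that by auto
  have toguard: ?thesis if p: "u = Port c a" "w = Guard l' z" for c a l' z
  proof -
    obtain x' y' where xy': "x' \<in> guard_layer l'" "y' \<in> guard_layer (\<not> l')" "{x, y} = {x', y'}"
    proof (cases "l = l'")
      case True then show ?thesis using that[of x y] x y by auto
    next
      case False then show ?thesis using that[of y x] x y by auto
    qed
    have x'm: "x' \<in> {x, y}" using xy' by blast
    then have "x' \<noteq> u" using xu by auto
    have "\<not> spot_adj x' w" using noadj[of x'] x'm \<open>x' \<noteq> u\<close> by auto
    then obtain b where b: "x' = Guard l' b" using xy'(1) p by (auto elim!: guard_layerE simp: spot_adj_simps)
    have "\<not> spot_adj u x'" using ind u x'm unfolding spot_indep_def by blast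
    then have ab: "b = a" using p b by (auto simp: spot_adj_simps)
    have za: "z \<noteq> a" using adj p by (auto simp: spot_adj_simps)
    have noport: False if "Port c' b' \<in> R" "Port c' b' \<noteq> u" for c' b'
    proof -
      have "\<not> spot_adj (Port c' b') w" using noR that by auto
      then have "b' = z" using p by (auto simp: spot_adj_simps)
      moreover have "\<not> spot_adj (Port c' b') x'" using ind that(1) x'm unfolding spot_indep_def by blast
      then have "b' = b" using b by (auto simp: spot_adj_simps)
      ultimately show False using ab za by simp
    qed
    have Ru: "R - {u} = (if v then {} else {CHome})"
      using R by (cases rule: rest_cases) (use u p noport in auto)
    have "insert w ({x, y} \<union> R - {u}) = {Guard l' z, Guard l' a, y'} \<union> (if v then {} else {CHome})"
      unfolding eq unfolding xy'(3) Ru b ab p(2) by auto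
    then show ?thesis using za xy'(2) by (intro cell_inv_V'[of z a y' l'])
  qed
  from R show ?thesis
  proof (cases rule: rest_cases)
    case 1
    then have "u = PHome" using u by simp
    then obtain c z where "w = Port c z" using adj by (auto simp: spot_adj_simps)
    then show ?thesis unfolding eq using 1 u x y by (intro cell_inv_N'[of x l y "{Port c z}"]) (auto simp: restI)
  next
    case (2 c a)
    then have up: "u = Port c a" using u by simp
    then consider l' z where "w = Guard l' z" | "w = PHome" using adj out 2 by (auto simp: spot_adj_simps)
    then show ?thesis
    proof cases
      case 1 then show ?thesis using toguard up by blast
    next
      case w: 2 then show ?thesis unfolding eq using 2 u x y by (intro cell_inv_N'[of x l y "{PHome}"]) (auto simp: restI)
    qed
  next
    case 3
    then consider "u = PHome" | "u = CHome" using u by auto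
    then show ?thesis
    proof cases
      case 1
      then obtain c z where wp: "w = Port c z" using adj by (auto simp: spot_adj_simps)
      moreover have "\<not> c" using noR[of CHome] 3 1 wp by (auto simp: spot_adj_simps)
      ultimately show ?thesis unfolding eq using 1 3 x y
        by (intro cell_inv_N'[of x l y "{Port False z, CHome}"]) (auto simp: restI)
    next
      case 2
      then show ?thesis using adj noR[of PHome] 3 by (auto simp: spot_adj_simps)
    qed
  next
    case (4 a)
    then consider "u = Port False a" | "u = CHome" using u by auto
    then show ?thesis
    proof cases
      case 1
      then consider l' z where "w = Guard l' z" | "w = PHome" using adj by (auto simp: spot_adj_simps)
      then show ?thesis
      proof cases
        case 1 then show ?thesis using toguard \<open>u = Port False a\<close> by blast
      next
        case 2 then show ?thesis unfolding eq using 4 1 x y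
            by (intro cell_inv_N'[of x l y "{PHome, CHome}"]) (auto simp: restI)
      qed
    next
      case 2
      then obtain z where "w = Port True z" using adj by (auto simp: spot_adj_simps)
      then show ?thesis unfolding eq using 4 2 x y
        by (intro cell_inv_N'[of x l y "{Port False a, Port True z}"]) (auto simp: restI)
    qed
  next
    case (5 a b)
    then obtain c t where up: "u = Port c t" using u by blast
    then consider l' z where "w = Guard l' z" | "w = PHome" | "c" "w = CHome" using adj by (auto simp: spot_adj_simps)
    then show ?thesis
    proof cases
      case 1 then show ?thesis using toguard up by blast
    next
      case 2
      then have "Port False a = u" "Port True b = u"
        using noR[of "Port False a"] noR[of "Port True b"] 5 by (auto simp: spot_adj_simps)
      then show ?thesis by auto
    next
      case 3
      then have "u = Port True b" using u up 5 by auto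
      then have "R - {u} = {Port False a}" using 5 by auto
      then have "{x, y} \<union> insert w (R - {u}) = {x, y} \<union> {Port False a, CHome}" using 3 by auto
      then show ?thesis unfolding eq using cell_inv_N'[OF x y, of "{Port False a, CHome}" v] 5(1)
        by (simp add: restI)
    qed
  qed
qed

text \<open>The occupied ports have no common colour; three of them cannot, as there are only two
  copies. Hence the guard at home cannot leave, and it closes its own layer to the others. What
  remains is a fall back into the free layer, which leaves only ports of one colour occupied, and
  slides between \<open>CHome\<close> and a port.\<close>

lemma cell_inv_step_crowded:
  assumes R: "R \<in> crowded v" and u: "u \<in> insert (GHome l) R"
    and w: "w \<notin> insert (GHome l) R" and adj: "spot_adj u w"
    and noadj: "\<And>z. z \<in> insert (GHome l) R \<Longrightarrow> z \<noteq> u \<Longrightarrow> \<not> spot_adj z w" and out: "v \<Longrightarrow> w \<noteq> CHome"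
  shows "cell_inv v (insert w (insert (GHome l) R - {u}))"
proof -
  have "u \<noteq> GHome l"
  proof
    assume h: "u = GHome l"
    then obtain z where wz: "w = Guard l z" using adj by (auto simp: spot_adj_simps)
    obtain c a where "Port c a \<in> R" "a \<noteq> z" using crowded_not_const[OF R] by blast
    then show False using noadj[of "Port c a"] h wz by (auto simp: spot_adj_simps)
  qed
  then have uR: "u \<in> R" using u by blast
  have eq: "insert w (insert (GHome l) R - {u}) = insert (GHome l) (insert w (R - {u}))"
    using \<open>u \<noteq> GHome l\<close> by auto
  have noR: "\<not> spot_adj r w" if "r \<in> R" "r \<noteq> u" for r using noadj[of r] that by auto
  have l': "l' = (\<not> l)" if "w = Guard l' z" for l' z
    using noadj[of "GHome l"] that \<open>u \<noteq> GHome l\<close> by (auto simp: spot_adj_simps)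
  have "\<exists>c0 a0. Port c0 a0 \<in> R - {u}"
    using R
  proof (cases rule: crowded_cases)
    case (1 c a c' b)
    then show ?thesis by (cases "u = Port c a") auto
  next
    case (2 a b)
    then show ?thesis by (cases "u = Port False a") auto
  next
    case (3 c a c' b t)
    then show ?thesis by (cases "u = Port c a") auto
  qed
  then obtain c0 a0 where P0: "Port c0 a0 \<in> R - {u}" by blast
  have nPHome: "w \<noteq> PHome" using noR[of "Port c0 a0"] P0 by (auto simp: spot_adj_simps)
  from R show ?thesis
  proof (cases rule: crowded_cases)
    case (1 c a c' b)
    have "R - {Port c a} = {Port c' b}" "R - {Port c' b} = {Port c a}" using 1 by auto
    then obtain d e d' e' where p: "u = Port d e" "R - {u} = {Port d' e'}" using uR 1 by blast
    then obtain z where wz: "w = Guard (\<not> l) z" using adj out l' nPHome 1 by (auto simp: spot_adj_simps)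
    have "insert (GHome l) (insert w (R - {u})) = {GHome l, Guard (\<not> l) z} \<union> {Port d' e'}"
      unfolding p(2) wz by auto
    then show ?thesis unfolding eq using cell_inv_N'[of "GHome l" l "Guard (\<not> l) z" "{Port d' e'}" v] \<open>v\<close>
      by (simp add: restI)
  next
    case (2 a b)
    have "R - {Port False a} = {Port False b, CHome}" "R - {Port False b} = {Port False a, CHome}" using 2 by auto
    then consider "u = CHome" | d d' where "u = Port False d" "R - {u} = {Port False d', CHome}" using uR 2 by blast
    then show ?thesis
    proof cases
      case 1
      then obtain z where "w = Port True z" using adj by (auto simp: spot_adj_simps)
      then show ?thesis unfolding eq using 1 2
        by (intro cell_inv_W'[of "{Port False a, Port False b, Port True z}" _ _ l]) (auto simp: crowdedI)
    next
      case p: 2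
      then obtain z where wz: "w = Guard (\<not> l) z" using adj l' nPHome by (auto simp: spot_adj_simps)
      then have "d' = z" using noR[of "Port False d'"] p by (auto simp: spot_adj_simps)
      then have "insert (GHome l) (insert w (R - {u})) = {GHome l, Guard (\<not> l) z} \<union> {Port False z, CHome}"
        unfolding p(2) wz by auto
      then show ?thesis unfolding eq using cell_inv_N'[of "GHome l" l "Guard (\<not> l) z" "{Port False z, CHome}" v] \<open>\<not> v\<close>
        by (simp add: restI)
    qed
  next
    case (3 c a c' b t)
    then obtain d e where p: "u = Port d e" using uR by blast
    then consider z where "w = Guard (\<not> l) z" | "d" "w = CHome" using adj l' nPHome by (auto simp: spot_adj_simps)
    then show ?thesis
    proof cases
      case (1 z)
      have "e' = z" if "Port d' e' \<in> R - {u}" for d' e'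
        using noR[of "Port d' e'"] 1 that by (auto simp: spot_adj_simps)
      note val = this
      have "R - {u} = {Port False z, Port True z}"
      proof -
        consider "u = Port c a" | "u = Port c' b" | "u = Port True t" using uR 3(2) by blast
        then show ?thesis
        proof cases
          case 1
          have Ru: "R - {u} = {Port c' b, Port True t}" using 1 3(2-) by auto
          then have "b = z" "t = z" using val by blast+
          moreover from this have "\<not> c'" using 3(5) by auto
          ultimately show ?thesis using Ru by simp
        next
          case 2
          have Ru: "R - {u} = {Port c a, Port True t}" using 2 3(2-) by auto
          then have "a = z" "t = z" using val by blast+
          moreover from this have "\<not> c" using 3(4) by auto
          ultimately show ?thesis using Ru by simp
        next
          case u: 3
          have Ru: "R - {u} = {Port c a, Port c' b}" using u 3(2-) by auto
          then have "a = z" "b = z" using val by blast+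
          moreover from this have "c' = (\<not> c)" using 3(3) by auto
          ultimately show ?thesis using Ru by (cases c) (simp_all add: insert_commute)
        qed
      qed
      then have "insert (GHome l) (insert w (R - {u})) = {GHome l, Guard (\<not> l) z} \<union> {Port False z, Port True z}"
        unfolding 1 by auto
      then show ?thesis unfolding eq using cell_inv_N'[of "GHome l" l "Guard (\<not> l) z" "{Port False z, Port True z}" v] \<open>\<not> v\<close>
        by (simp add: restI)
    next
      case 2
      have "\<not> d'" if "Port d' e' \<in> R - {u}" for d' e'
        using noR[of "Port d' e'"] 2 that by (auto simp: spot_adj_simps)
      note val = this
      have ut: "u = Port True t" using val[of True t] 3(2) by blast
      then have "\<not> c" "\<not> c'" using val[of c a] val[of c' b] 3(2,4,5) by auto
      moreover from this have ab: "a \<noteq> b" using 3(3) by auto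
      ultimately have "R - {u} = {Port False a, Port False b}" using 3(2) ut by auto
      then have "insert (GHome l) (insert w (R - {u})) = insert (GHome l) {Port False a, Port False b, CHome}"
        using 2 by auto
      then show ?thesis unfolding eq using cell_inv_W'[OF crowdedI(2)[OF ab]] 3(1) by simp
    qed
  qed
qed

text \<open>The guard that stays blocks the home of the layer and all ports of other colours than
  its own. So the other one can leave only for a port of the colour of the guard that stays, which
  restores state \<open>N\<close>.\<close>

lemma cell_inv_step_doubled:
  assumes ne: "a \<noteq> b" and y: "y \<in> guard_layer (\<not> l)" and Y: "Y = {Guard l a, Guard l b, y} \<union> (if v then {} else {CHome})"
    and ind: "spot_indep Y" and u: "u \<in> Y"
    and w: "w \<notin> Y" and adj: "spot_adj u w"
    and noadj: "\<And>z. z \<in> Y \<Longrightarrow> z \<noteq> u \<Longrightarrow> \<not> spot_adj z w" and out: "v \<Longrightarrow> w \<noteq> CHome"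
  shows "cell_inv v (insert w (Y - {u}))"
proof -
  have yg: "y \<noteq> Guard l a" "y \<noteq> Guard l b" "y \<noteq> CHome" using y by (auto elim!: guard_layerE)
  have toport: ?thesis if ab: "{a, b} = {a', b'}" "a' \<noteq> b'" "u = Guard l a'" for a' b'
  proof -
    have Y': "Y = {Guard l a', Guard l b', y} \<union> (if v then {} else {CHome})"
      using ab(1) Y by (auto simp: doubleton_eq_iff)
    have "\<not> spot_adj (Guard l b') w" using noadj[of "Guard l b'"] Y' ab by auto
    then obtain c where c: "w = Port c b'" using adj ab by (auto simp: spot_adj_simps)
    have "\<not> c" if "\<not> v" using noadj[of CHome] Y' ab c that by (auto simp: spot_adj_simps)
    moreover have "y \<noteq> Guard l a'" using ab(1) yg by (auto simp: doubleton_eq_iff)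
    ultimately show ?thesis using ab c Y' y
      by (intro cell_inv_N'[of "Guard l b'" l y "if v then {Port c b'} else {Port False b', CHome}"]) (auto simp: restI)
  qed
  consider "u = Guard l a" | "u = Guard l b" | "u = y" | "\<not> v" "u = CHome" using u Y by (auto split: if_splits)
  then show ?thesis
  proof cases
    case 1 then show ?thesis using toport[of a b] ne by auto
  next
    case 2 then show ?thesis using toport[of b a] ne by auto
  next
    case 3
    have "w \<in> guard_layer (\<not> l)"
    proof (rule guard_layer_cases_adj)
      show "y \<in> guard_layer (\<not> l)" "spot_adj y w" using y adj 3 by auto
    next
      fix c d z assume "w = Port c z"
      then have "a = z" "b = z" using noadj[of "Guard l a"] noadj[of "Guard l b"] Y 3 yg by (auto simp: spot_adj_simps)
      then show ?thesis using ne by simp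
    qed
    then show ?thesis using 3 Y yg ne by (intro cell_inv_V'[of a b w l]) auto
  next
    case 4
    then obtain z where "w = Port True z" using adj by (auto simp: spot_adj_simps)
    then have "a = z" "b = z" using noadj[of "Guard l a"] noadj[of "Guard l b"] Y 4 by (auto simp: spot_adj_simps)
    then show ?thesis using ne by simp
  qed
qed

lemma cell_inv_step:
  assumes inv: "cell_inv v Y" and ind: "spot_indep Y" and u: "u \<in> Y" and w: "w \<notin> Y" and adj: "spot_adj u w"
    and noadj: "\<And>z. z \<in> Y \<Longrightarrow> z \<noteq> u \<Longrightarrow> \<not> spot_adj z w" and out: "v \<Longrightarrow> w \<noteq> CHome"
  shows "cell_inv v (insert w (Y - {u}))"
  using inv ind
proof (cases rule: cell_inv_normal)
  case (1 x l y R)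
  then consider "u = x" | "u = y" | "u \<in> R" using u by blast
  then show ?thesis
  proof cases
    case u: 1
    then show ?thesis using 1 cell_inv_step_guard[of x l y R v w] ind w adj noadj by simp
  next
    case u: 2
    have "Y = {y, x} \<union> R" using 1 by blast
    then show ?thesis using u 1 cell_inv_step_guard[of y "\<not> l" x R v w] ind w adj noadj by simp
  next
    case u: 3
    then show ?thesis using 1 cell_inv_step_rest[of x l y R v u w] ind w adj noadj out by simp
  qed
next
  case (2 R l)
  then show ?thesis using cell_inv_step_crowded[of R v u l w] u w adj noadj out by simp
next
  case (3 a b y l)
  then show ?thesis using cell_inv_step_doubled[OF 3 ind u w adj noadj out] by simp
qed

section \<open>The gadget graph\<close>

datatype vert = Slot bool nat spot | Pool nat | Lock_Off | Lock_On | Exit | Park | Spare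

locale gadget =
  fixes ok :: "nat \<Rightarrow> nat \<Rightarrow> nat \<Rightarrow> nat \<Rightarrow> bool" and K N :: nat
begin

fun arc :: "vert \<Rightarrow> vert \<Rightarrow> bool" where
  "arc (Slot b i x) (Slot b' j y) = (if b = b' then i = j \<and> spot_arc x y
     else case x of GHome l \<Rightarrow> (\<exists>c u. y = Port c u)
       | Port c u \<Rightarrow> \<not> b \<and> (\<exists>c' v. y = Port c' v \<and> \<not> ok i u j v) | _ \<Rightarrow> False)"
| "arc Lock_On (Slot b i x) = (\<not> b \<and> x = CHome)"
| "arc Lock_Off (Slot b i x) = (b \<and> x = CHome)"
| "arc (Pool j) (Slot b i x) = (b \<and> x = CHome \<and> i = j)"
| "arc Lock_Off Lock_On = True"
| "arc Lock_Off Exit = True"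
| "arc Exit (Pool j) = True"
| "arc Exit Spare = True"
| "arc Park (Pool j) = True"
| "arc Park Spare = True"
| "arc _ _ = False"

definition adj :: "vert \<Rightarrow> vert \<Rightarrow> bool" where
  "adj x y \<longleftrightarrow> arc x y \<or> arc y x"

lemma adj_sym: "adj x y \<longleftrightarrow> adj y x"
  by (auto simp: adj_def)

lemma adj_irrefl: "\<not> adj x x"
  by (cases x) (auto simp: adj_def split: spot.splits elim: spot_arc.elims)

fun valid :: "vert \<Rightarrow> bool" where
  "valid (Slot b i (Port c u)) = (i < K \<and> u < N)"
| "valid (Slot b i (Guard c u)) = (i < K \<and> u < N)"
| "valid (Slot b i x) = (i < K)"
| "valid (Pool i) = (i < K)"
| "valid _ = True"

definition verts :: "vert set" where "verts = {x. valid x}"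

definition edges :: "vert set set" where
  "edges = {{x, y} |x y. valid x \<and> valid y \<and> adj x y}"

lemma edges_iff: "{x, y} \<in> edges \<longleftrightarrow> valid x \<and> valid y \<and> adj x y"
  by (auto simp: edges_def doubleton_eq_iff adj_sym)

lemma indep_iff: "independent verts edges X \<longleftrightarrow> (\<forall>x\<in>X. valid x) \<and> (\<forall>x\<in>X. \<forall>y\<in>X. \<not> adj x y)"
  by (auto simp: independent_def edges_iff verts_def)

definition slice :: "bool \<Rightarrow> nat \<Rightarrow> vert set \<Rightarrow> spot set" where
  "slice b i X = {x. Slot b i x \<in> X}"

definition pools :: "vert set" where
  "pools = {Spare, Exit, Park} \<union> range Pool"

text \<open>The right checkers in their pools are those with \<open>v j\<close>; \<open>e\<close> is the one further token on the pool side. The clause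
for \<open>Lock_Off\<close> can only break when the lock moves back with all checkers inside, that is, at a solution.\<close>
definition inv :: "vert set \<Rightarrow> bool" where
  "inv X \<longleftrightarrow> (Lock_Off \<in> X \<longleftrightarrow> Lock_On \<notin> X) \<and>
    (\<exists>v e. (\<forall>i<K. cell_inv False (slice False i X)) \<and> (\<forall>j<K. cell_inv (v j) (slice True j X)) \<and>
      (Lock_Off \<in> X \<longrightarrow> (\<exists>j<K. v j)) \<and>
      X \<inter> pools = insert e (Pool ` {j. j < K \<and> v j}) \<and> e \<notin> Pool ` {j. j < K \<and> v j})"

definition solvable :: bool where
  "solvable \<longleftrightarrow> (\<exists>u v. (\<forall>i<K. u i < N \<and> v i < N) \<and> (\<forall>i<K. \<forall>j<K. ok i (u i) j (v j)))"

section \<open>The invariant under slides\<close>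

lemma slot_adj: "adj (Slot b i x) (Slot b i y) \<longleftrightarrow> spot_adj x y"
  by (auto simp: adj_def spot_adj_def)

lemma slice_indep: "independent verts edges X \<Longrightarrow> spot_indep (slice b i X)"
  unfolding indep_iff spot_indep_def slice_def using slot_adj by blast

text \<open>The approaching token itself restricts the cell. On a guard home of the other side it
  excludes all occupied ports in the cell; on a port it excludes guards at home and, as copies do
  not matter across the sides, tokens of colour \<open>u\<close>. In both cases a token of the cell
  is adjacent to the port.\<close>

lemma port_dominated:
  assumes inv: "cell_inv v (slice b j X)" and ind: "independent verts edges X" and a: "a \<in> X" "\<And>x. a \<noteq> Slot b j x"
    and w: "adj a (Slot b j (Port c u))"
  shows "\<exists>z\<in>X. z \<noteq> a \<and> adj z (Slot b j (Port c u))"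
proof -
  note si = slice_indep[OF ind, of b j]
  have nadj: "\<not> adj a z" if "z \<in> X" for z using ind a that by (auto simp: indep_iff)
  consider b' i l where "a = Slot b' i (GHome l)" "b' \<noteq> b" | b' i c' u' where "a = Slot b' i (Port c' u')" "b' \<noteq> b"
    using w a(2) by (cases a) (auto simp: adj_def split: if_splits spot.splits)
  then have "\<exists>x\<in>slice b j X. spot_adj x (Port c u)"
  proof cases
    case 1
    have "Port c' u' \<notin> slice b j X" for c' u'
      using nadj[of "Slot b j (Port c' u')"] 1 by (auto simp: slice_def adj_def)
    then show ?thesis using cell_inv_no_port_dominated[OF inv si] by blast
  next
    case 2
    have "GHome l \<notin> slice b j X" for l
      using nadj[of "Slot b j (GHome l)"] 2 by (auto simp: slice_def adj_def)
    moreover have "Port c'' u \<notin> slice b j X" for c''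
      using nadj[of "Slot b j (Port c'' u)"] 2 w by (auto simp: slice_def adj_def)
    ultimately show ?thesis using cell_inv_port_dominated[OF inv si] by blast
  qed
  then obtain t where "Slot b j t \<in> X" "adj (Slot b j t) (Slot b j (Port c u))"
    by (auto simp: slice_def slot_adj)
  then show ?thesis using a(2)[of t] by metis
qed

lemma home_dominated:
  assumes inv: "cell_inv v (slice b j X)" and ind: "independent verts edges X" and a: "a \<in> X" "\<And>x. a \<noteq> Slot b j x"
    and w: "adj a (Slot b j (GHome l))"
  shows "\<exists>z\<in>X. z \<noteq> a \<and> adj z (Slot b j (GHome l))"
proof -
  note si = slice_indep[OF ind, of b j]
  have nadj: "\<not> adj a z" if "z \<in> X" for z using ind a that by (auto simp: indep_iff)
  obtain b' i c' u' where a': "a = Slot b' i (Port c' u')" "b' \<noteq> b"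
    using w a(2) by (cases a) (auto simp: adj_def split: if_splits spot.splits)
  have "GHome l \<notin> slice b j X" for l
    using nadj[of "Slot b j (GHome l)"] a' by (auto simp: slice_def adj_def)
  then have "\<exists>x\<in>slice b j X. spot_adj x (GHome l)" using cell_inv_home_dominated[OF inv si] by blast
  then obtain t where "Slot b j t \<in> X" "adj (Slot b j t) (Slot b j (GHome l))"
    by (auto simp: slice_def slot_adj)
  then show ?thesis using a(2)[of t] by metis
qed

lemma slice_move_other:
  assumes "\<And>x. a \<noteq> Slot b i x" "\<And>x. w \<noteq> Slot b i x"
  shows "slice b i (insert w (X - {a})) = slice b i X"
  using assms[symmetric] by (auto simp: slice_def)

lemma inv_step:
  assumes "inv X" and sl: "slide verts edges X X'"
  shows "inv X' \<or> solvable"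
proof -
  from sl obtain a w where ind: "independent verts edges X" and ind': "independent verts edges X'"
    and a: "a \<in> X" and w: "w \<notin> X" and e: "{a, w} \<in> edges" and X': "X' = insert w (X - {a})"
    by (auto simp: slide_def)
  from assms(1) obtain v x where lock: "Lock_Off \<in> X \<longleftrightarrow> Lock_On \<notin> X"
    and A: "\<And>i. i < K \<Longrightarrow> cell_inv False (slice False i X)"
    and B: "\<And>j. j < K \<Longrightarrow> cell_inv (v j) (slice True j X)"
    and off: "Lock_Off \<in> X \<Longrightarrow> \<exists>j<K. v j"
    and pool: "X \<inter> pools = insert x (Pool ` {j. j < K \<and> v j})" and x: "x \<notin> Pool ` {j. j < K \<and> v j}"
    unfolding inv_def by blast
  have C: "cell_inv (b \<and> v i) (slice b i X)" if "i < K" for b i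
    using A[OF that] B[OF that] by (cases b) auto
  have inPool: "Pool j \<in> X" if "v j" "j < K" for j using pool that by blast
  have aw: "adj a w" "valid a" "valid w" using e by (auto simp: edges_iff)
  have noadj: "\<not> adj z w" "\<not> adj w z" if "z \<in> X" "z \<noteq> a" for z
    using ind' that X' by (auto simp: indep_iff)
  have noadj': "\<not> adj y z" if "y \<in> X" "z \<in> X" for y z using ind that by (auto simp: indep_iff)
  have a_ne: "a \<noteq> w" using a w by auto
  have port_blocked: False if "w = Slot b j (Port c u)" "\<And>x. a \<noteq> Slot b j x" for b j c u
    using port_dominated[OF C ind a that(2)] aw that(1) noadj by auto
  have home_blocked: False if "w = Slot b j (GHome l)" "\<And>x. a \<noteq> Slot b j x" for b j l
    using home_dominated[OF C ind a that(2)] aw that(1) noadj by auto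
  have check_dominated: "\<exists>z\<in>X. adj z (Slot b i CHome) \<and> (\<exists>u. z = Slot b i (Port True u))"
    if "i < K" "\<not> (b \<and> v i)" "Slot b i CHome \<notin> X" for b i
  proof -
    have "\<exists>u. Port True u \<in> slice b i X"
      using cell_inv_check_dominated[of "slice b i X"] C[OF that(1), of b] that by (auto simp: slice_def)
    then obtain u where "Slot b i (Port True u) \<in> X" by (auto simp: slice_def)
    moreover have "adj (Slot b i (Port True u)) (Slot b i CHome)" by (simp add: slot_adj spot_adj_simps)
    ultimately show ?thesis by blast
  qed
  have invI: "inv X'" if "Lock_Off \<in> X' \<longleftrightarrow> Lock_On \<notin> X'" "\<And>b i. i < K \<Longrightarrow> cell_inv (b \<and> v' i) (slice b i X')"
    "Lock_Off \<in> X' \<Longrightarrow> \<exists>j<K. v' j" "X' \<inter> pools = insert x' (Pool ` {j. j < K \<and> v' j})" "x' \<notin> Pool ` {j. j < K \<and> v' j}"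
    for v' x'
    unfolding inv_def using that(1,3,4,5) that(2)[of _ False] that(2)[of _ True]
    by (intro conjI exI[of _ v'] exI[of _ x']) auto
  have pool_move: "inv X'" if ap: "a \<in> pools" and wp: "w \<in> pools"
  proof -
    \<comment> \<open>Within the pool side, the token of a waiting checker could move only to
      \<open>Exit\<close> or \<open>Park\<close>. The further token prevents this: on one of these
      two it is adjacent to every pool, and anywhere else on the pool side it is adjacent to both of
      them.\<close>
    have "a = x"
    proof (rule ccontr)
      assume "a \<noteq> x"
      then obtain j where j: "a = Pool j" "j < K" "v j" using pool a ap by blast
      then have "w \<in> {Exit, Park}" using aw wp by (auto simp: adj_def pools_def)
      have "x \<in> X" "x \<in> pools" using pool by auto
      then consider "x \<in> {Exit, Park}" | "x = Spare \<or> (\<exists>i. x = Pool i)" by (auto simp: pools_def)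
      then show False
      proof cases
        case 1
        then have "adj a x" using j by (auto simp: adj_def)
        then show False using noadj' a \<open>x \<in> X\<close> by blast
      next
        case 2
        then have "adj x w" using \<open>w \<in> {Exit, Park}\<close> by (auto simp: adj_def)
        then show False using noadj \<open>a \<noteq> x\<close> \<open>x \<in> X\<close> by blast
      qed
    qed
    have "X' \<inter> pools = insert w (X \<inter> pools - {x})" unfolding X' using wp \<open>a = x\<close> by auto
    then have "X' \<inter> pools = insert w (Pool ` {j. j < K \<and> v j})" unfolding pool using x by auto
    moreover have "w \<notin> Pool ` {j. j < K \<and> v j}" using pool w by blast
    moreover have "slice b i X' = slice b i X" for b i
      unfolding X' using ap wp by (intro slice_move_other) (auto simp: pools_def)
    moreover have "Lock_Off \<in> X' \<longleftrightarrow> Lock_Off \<in> X" "Lock_On \<in> X' \<longleftrightarrow> Lock_On \<in> X"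
      unfolding X' using ap wp by (auto simp: pools_def)
    ultimately show ?thesis using lock off C by (intro invI[of v w]) auto
  qed
  show ?thesis
  proof (cases a)
    case a': (Slot b i y)
    show ?thesis
    proof (cases w)
      case w': (Slot b' j z)
      show ?thesis
      proof (cases "b = b' \<and> i = j")
        case True
        then have w'': "w = Slot b i z" using w' by simp
        have iK: "i < K" using aw(2) a' by (cases y) auto
        have "z \<noteq> CHome" if "b \<and> v i"
        proof
          assume "z = CHome"
          then have "adj (Pool i) w" using w'' that by (simp add: adj_def)
          then show False using noadj(1)[of "Pool i"] inPool that iK a' by auto
        qed
        moreover have "\<not> spot_adj t z" if "t \<in> slice b i X" "t \<noteq> y" for t
          using noadj(1)[of "Slot b i t"] that a' w'' by (auto simp: slice_def slot_adj)
        moreover have "y \<in> slice b i X" "z \<notin> slice b i X" "spot_adj y z"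
          using a a' w w'' aw by (auto simp: slice_def slot_adj)
        ultimately have "cell_inv (b \<and> v i) (insert z (slice b i X - {y}))"
          using cell_inv_step[OF C[OF iK, of b] slice_indep[OF ind]] by blast
        moreover have "slice b i X' = insert z (slice b i X - {y})"
          unfolding X' a' w'' by (auto simp: slice_def)
        moreover have "slice b'' i' X' = slice b'' i' X" if "(b'', i') \<noteq> (b, i)" for b'' i'
          unfolding X' using that a' w'' by (intro slice_move_other) auto
        ultimately have "cell_inv (b'' \<and> v i') (slice b'' i' X')" if "i' < K" for b'' i'
          using C that by (metis prod.inject)
        moreover have "X' \<inter> pools = X \<inter> pools" "Lock_Off \<in> X' \<longleftrightarrow> Lock_Off \<in> X" "Lock_On \<in> X' \<longleftrightarrow> Lock_On \<in> X"
          unfolding X' a' w'' by (auto simp: pools_def)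
        ultimately have "inv X'" using lock off pool x by (intro invI[of v x]) auto
        then show ?thesis ..
      next
        case False
        then have ne: "\<And>x. a \<noteq> Slot b' j x" using a' by auto
        have "(\<exists>c u. z = Port c u) \<or> (\<exists>l. z = GHome l)"
          using aw(1) False unfolding a' w' by (auto simp: adj_def split: if_splits spot.splits)
        moreover have "j < K" using aw(3) w' by (cases z) auto
        ultimately show ?thesis using port_dominated[OF C ind a ne] home_dominated[OF C ind a ne] aw w' noadj by metis
      qed
    next
      case Lock_Off
      then have "adj Lock_On w" "Lock_On \<in> X" using lock w by (auto simp: adj_def)
      then show ?thesis using noadj(1)[of Lock_On] a' by auto
    next
      case Lock_On
      then have "adj Lock_Off w" "Lock_Off \<in> X" using lock w by (auto simp: adj_def)
      then show ?thesis using noadj(1)[of Lock_Off] a' by auto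
    next
      case w': (Pool j)
      then have a'': "a = Slot True j CHome" "j < K" using aw a' by (auto simp: adj_def)
      then have nv: "\<not> v j" using inPool w w' by auto
      have "slice True j X' = slice True j X - {CHome}" unfolding X' a'' w' by (auto simp: slice_def)
      then have "cell_inv True (slice True j X')"
        using cell_inv_exit[of "slice True j X"] C[OF a''(2), of True] nv a a'' by (auto simp: slice_def)
      moreover have "slice b' i' X' = slice b' i' X" if "(b', i') \<noteq> (True, j)" for b' i'
        unfolding X' using that a'' w' by (intro slice_move_other) auto
      ultimately have "cell_inv (b' \<and> (v(j := True)) i') (slice b' i' X')" if "i' < K" for b' i'
        using C[OF that, of b'] by (cases "(b', i') = (True, j)") (auto split: if_splits)
      moreover have "X' \<inter> pools = insert (Pool j) (X \<inter> pools)" unfolding X' a'' w' by (auto simp: pools_def)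
      then have "X' \<inter> pools = insert x (Pool ` {i. i < K \<and> (v(j := True)) i})"
        unfolding pool using a''(2) by auto
      moreover have "x \<noteq> Pool j" using pool w w' by auto
      then have "x \<notin> Pool ` {i. i < K \<and> (v(j := True)) i}" using x by auto
      moreover have "Lock_Off \<in> X' \<longleftrightarrow> Lock_On \<notin> X'" unfolding X' a'' w' using lock by auto
      ultimately have "inv X'" using a''(2) by (intro invI[of "v(j := True)" x]) auto
      then show ?thesis ..
    qed (use aw a' in \<open>simp_all add: adj_def\<close>)
  next
    case a': (Pool j)
    show ?thesis
    proof (cases w)
      case w': (Slot b i z)
      then have w'': "w = Slot True j CHome" "j < K" using aw a' by (auto simp: adj_def)
      \<comment> \<open>Only the further token can stand on the pool of a checker that is inside. It
        cannot enter, since the cell then dominates \<open>CHome\<close>.\<close>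
      have vj: "v j"
      proof (rule ccontr)
        assume "\<not> v j"
        then show False using check_dominated[of j True] w w'' noadj(1) a' by blast
      qed
      have "Slot True j (Port True u) \<notin> X" for u
        using noadj(1)[of "Slot True j (Port True u)"] a' w'' by (auto simp: slot_adj spot_adj_simps)
      then have "cell_inv False (insert CHome (slice True j X))"
        using cell_inv_enter[of "slice True j X"] C[OF w''(2), of True] vj by (auto simp: slice_def)
      moreover have "slice True j X' = insert CHome (slice True j X)" unfolding X' a' w'' by (auto simp: slice_def)
      moreover have "slice b' i' X' = slice b' i' X" if "(b', i') \<noteq> (True, j)" for b' i'
        unfolding X' using that a' w'' by (intro slice_move_other) auto
      ultimately have "cell_inv (b' \<and> (v(j := False)) i') (slice b' i' X')" if "i' < K" for b' i'
        using C[OF that, of b'] by (cases "(b', i') = (True, j)") (auto split: if_splits)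
      moreover have "X' \<inter> pools = (X \<inter> pools) - {Pool j}" unfolding X' a' w'' by (auto simp: pools_def)
      then have "X' \<inter> pools = insert x (Pool ` {i. i < K \<and> (v(j := False)) i})"
        unfolding pool using x vj w''(2) by auto
      moreover have "x \<notin> Pool ` {i. i < K \<and> (v(j := False)) i}" using x by (auto split: if_splits)
      moreover have "Lock_Off \<notin> X" using noadj(1)[of Lock_Off] a' w'' by (auto simp: adj_def)
      then have "Lock_Off \<in> X' \<longleftrightarrow> Lock_On \<notin> X'" "Lock_Off \<notin> X'" unfolding X' a' w'' using lock by auto
      ultimately have "inv X'" by (intro invI[of "v(j := False)" x]) auto
      then show ?thesis ..
    qed (use aw a' pool_move in \<open>simp_all add: adj_def pools_def\<close>)
  next
    case a': Lock_Off
    then obtain j where j: "j < K" "v j" using off a by blast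
    show ?thesis
    proof (cases w)
      case w': (Slot b i z)
      then have w'': "w = Slot True i CHome" "i < K" using aw a' by (auto simp: adj_def)
      have False
      proof (cases "v i")
        case True
        then show False using noadj(1)[of "Pool i"] inPool w'' a' by (auto simp: adj_def)
      next
        case False
        then show False using check_dominated[of i True] w w'' noadj(1) a' by blast
      qed
      then show ?thesis ..
    next
      case w': Lock_On
      have "slice b i X' = slice b i X" for b i
        unfolding X' using a' w' by (intro slice_move_other) auto
      moreover have "X' \<inter> pools = X \<inter> pools" unfolding X' a' w' by (auto simp: pools_def)
      moreover have "Lock_Off \<notin> X'" "Lock_On \<in> X'" unfolding X' a' w' by auto
      ultimately have "inv X'" using C pool x by (intro invI[of v x]) auto
      then show ?thesis ..
    next
      case Exit
      then show ?thesis using noadj(1)[of "Pool j"] inPool j a' by (auto simp: adj_def)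
    qed (use aw a' in \<open>simp_all add: adj_def\<close>)
  next
    case a': Lock_On
    show ?thesis
    proof (cases w)
      case w': (Slot b i z)
      then have w'': "w = Slot False i CHome" "i < K" using aw a' by (auto simp: adj_def)
      have False using check_dominated[of i False] w w'' noadj(1) a' by blast
      then show ?thesis ..
    next
      case w': Lock_Off
      show ?thesis
      proof (cases "\<exists>j<K. v j")
        case True
        have "slice b i X' = slice b i X" for b i
          unfolding X' using a' w' by (intro slice_move_other) auto
        moreover have "X' \<inter> pools = X \<inter> pools" unfolding X' a' w' by (auto simp: pools_def)
        moreover have "Lock_Off \<in> X'" "Lock_On \<notin> X'" unfolding X' a' w' by auto
        ultimately have "inv X'" using C pool x True by (intro invI[of v x]) auto
        then show ?thesis ..
      next
        case False
        \<comment> \<open>The lock excludes checkers at home on the left before the slide and on the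
          right after it. Thus every cell of both sides exhibits a port, and these ports are
          pairwise non-adjacent.\<close>
        have "Slot b i CHome \<notin> X" if "i < K" for b i
        proof
          assume c: "Slot b i CHome \<in> X"
          show False
          proof (cases b)
            case True
            then have "adj (Slot b i CHome) w" using w' by (simp add: adj_def)
            then show False using noadj c a' by blast
          next
            case False
            then have "adj (Slot b i CHome) a" using a' by (simp add: adj_def)
            then show False using noadj' c a by blast
          qed
        qed
        then have ex: "\<exists>u. Slot b i (Port True u) \<in> X" if "i < K" for b i
          using check_dominated[of i b] False that by blast
        define p where "p b i = (SOME u. Slot b i (Port True u) \<in> X)" for b i
        have p: "Slot b i (Port True (p b i)) \<in> X" if "i < K" for b i
          unfolding p_def using someI_ex[OF ex[OF that]] .
        have pN: "p b i < N" if "i < K" for b i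
        proof -
          have "valid (Slot b i (Port True (p b i)))" using ind p[OF that, of b] unfolding indep_iff by blast
          then show ?thesis by simp
        qed
        have pok: "ok i (p False i) j (p True j)" if "i < K" "j < K" for i j
        proof -
          have "\<not> adj (Slot False i (Port True (p False i))) (Slot True j (Port True (p True j)))"
            using noadj' p that by blast
          then show ?thesis by (auto simp: adj_def)
        qed
        have solvable unfolding solvable_def
          by (rule exI[of _ "p False"], rule exI[of _ "p True"]) (simp add: pN pok)
        then show ?thesis ..
      qed
    qed (use aw a' in \<open>simp_all add: adj_def\<close>)
  next
    case a': Exit
    show ?thesis
    proof (cases w)
      case w': Lock_Off
      then show ?thesis using noadj(1)[of Lock_On] lock w a' by (auto simp: adj_def)
    qed (use aw a' pool_move in \<open>simp_all add: adj_def pools_def\<close>)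
  next
    case a': Park
    show ?thesis
      by (cases w) (use aw a' pool_move in \<open>simp_all add: adj_def pools_def\<close>)
  next
    case a': Spare
    show ?thesis
      by (cases w) (use aw a' pool_move in \<open>simp_all add: adj_def pools_def\<close>)
  qed
qed


end

section \<open>From a solution to a sequence of slides\<close>

context gadget
begin

text \<open>The only adjacent pairs in sight are \<open>p i\<close> and \<open>q i\<close> for the
  same \<open>i\<close>, of which exactly one is occupied at any time. So every mixture of moved and
  unmoved tokens is independent, and the order of the moves is arbitrary.\<close>

lemma slides_simultaneous:
  assumes P: "P = p ` I" and Q: "Q = q ` I" and fin: "finite I" and inj: "inj_on p I" "inj_on q I"
    and disj: "P \<inter> Z = {}" "Q \<inter> Z = {}" "P \<inter> Q = {}"
    and val: "\<forall>x\<in>Z \<union> P \<union> Q. valid x"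
    and adj: "\<forall>i\<in>I. adj (p i) (q i)"
    and only: "\<forall>x\<in>Z \<union> P \<union> Q. \<forall>y\<in>Z \<union> P \<union> Q. arc x y \<longrightarrow>
      (\<exists>i\<in>I. x = p i \<and> y = q i \<or> x = q i \<and> y = p i)"
  shows "(slide verts edges)\<^sup>*\<^sup>* (Z \<union> P) (Z \<union> Q)"
proof -
  note disj = disj[unfolded P Q] and val = val[unfolded P Q] and only = only[unfolded P Q]
  have ind: "independent verts edges (Z \<union> p ` (I - J) \<union> q ` J)" if "J \<subseteq> I" for J
  proof -
    have "\<not> arc x y" if x: "x \<in> Z \<union> p ` (I - J) \<union> q ` J" and y: "y \<in> Z \<union> p ` (I - J) \<union> q ` J" for x y
    proof
      assume "arc x y"
      then obtain i where i: "i \<in> I" "x = p i \<and> y = q i \<or> x = q i \<and> y = p i"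
        using only x y \<open>J \<subseteq> I\<close> by blast
      then have "p i \<in> p ` (I - J)" "q i \<in> q ` J" using x y disj \<open>J \<subseteq> I\<close> by blast+
      then show False using i(1) inj \<open>J \<subseteq> I\<close> by (auto dest: inj_onD)
    qed
    moreover have "valid x" if "x \<in> Z \<union> p ` (I - J) \<union> q ` J" for x using val \<open>J \<subseteq> I\<close> that by blast
    ultimately show ?thesis unfolding indep_iff adj_def by blast
  qed
  have "J \<subseteq> I \<Longrightarrow> (slide verts edges)\<^sup>*\<^sup>* (Z \<union> p ` I) (Z \<union> p ` (I - J) \<union> q ` J)" if "finite J" for J
    using that
  proof (induction J)
    case empty
    then show ?case by simp
  next
    case (insert i J)
    let ?X = "Z \<union> p ` (I - J) \<union> q ` J" and ?X' = "Z \<union> p ` (I - insert i J) \<union> q ` insert i J"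
    have i: "i \<in> I" "i \<notin> J" "J \<subseteq> I" using insert by auto
    have "p ` (I - insert i J) = p ` (I - J) - {p i}" using inj(1) i by (auto simp: inj_on_def)
    moreover have "p i \<notin> Z" "p i \<notin> q ` J" using i disj by blast+
    ultimately have "?X' = insert (q i) (?X - {p i})" by auto
    moreover have "q i \<notin> q ` J" using i inj_on_image_mem_iff[OF inj(2), of i J] by blast
    then have "q i \<notin> ?X" using i disj by blast
    moreover have "p i \<in> ?X" using i by auto
    moreover have "{p i, q i} \<in> edges" using val adj i by (auto simp: edges_iff)
    ultimately have "slide verts edges ?X ?X'"
      unfolding slide_def using ind[of J] ind[of "insert i J"] i insert.prems by blast
    then show ?case using insert i by (auto intro: rtranclp.rtrancl_into_rtrancl)
  qed
  from this[of I] fin show ?thesis by (simp add: P Q)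
qed

lemma arcE:
  assumes "arc x y"
  obtains b i c u l v where "x = Slot b i (Port c u)" "y = Slot b i (Guard l v)" "u \<noteq> v"
  | b i l v where "x = Slot b i (GHome l)" "y = Slot b i (Guard l v)"
  | b i c u where "x = Slot b i PHome" "y = Slot b i (Port c u)"
  | b i u where "x = Slot b i CHome" "y = Slot b i (Port True u)"
  | b i l j c u where "x = Slot b i (GHome l)" "y = Slot (\<not> b) j (Port c u)"
  | i c u j c' v where "x = Slot False i (Port c u)" "y = Slot True j (Port c' v)" "\<not> ok i u j v"
  | i where "x = Lock_On" "y = Slot False i CHome"
  | i where "x = Lock_Off" "y = Slot True i CHome"
  | i where "x = Pool i" "y = Slot True i CHome"
  | "x = Lock_Off" "y = Lock_On"
  | "x = Lock_Off" "y = Exit"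
  | "x = Exit \<or> x = Park" "y = Spare \<or> (\<exists>j. y = Pool j)"
  using assms
  by (cases "(x, y)" rule: arc.cases)
    (auto split: if_splits spot.splits elim!: spot_arc.elims)

definition start :: "vert set" where
  "start = {Lock_Off, Spare} \<union> Pool ` {..<K} \<union> (\<lambda>i. Slot False i CHome) ` {..<K}
     \<union> (\<lambda>(b, i). Slot b i PHome) ` (UNIV \<times> {..<K}) \<union> (\<lambda>(b, l, i). Slot b i (GHome l)) ` (UNIV \<times> UNIV \<times> {..<K})"

text \<open>All traces of the chosen values are erased, so the set is known in advance. Only the
  lock, the further token and the right checkers have changed places.\<close>

definition target :: "vert set" where
  "target = {Exit, Park} \<union> (\<lambda>i. Slot True i CHome) ` {..<K} \<union> (\<lambda>i. Slot False i CHome) ` {..<K}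
     \<union> (\<lambda>(b, i). Slot b i PHome) ` (UNIV \<times> {..<K}) \<union> (\<lambda>(b, l, i). Slot b i (GHome l)) ` (UNIV \<times> UNIV \<times> {..<K})"

lemma solvable_reachable:
  assumes solvable
  shows "(slide verts edges)\<^sup>*\<^sup>* start target"
proof -
  obtain f g where fg: "\<And>i. i < K \<Longrightarrow> f i < N" "\<And>i. i < K \<Longrightarrow> g i < N"
    and ok: "\<And>i j. i < K \<Longrightarrow> j < K \<Longrightarrow> ok i (f i) j (g j)"
    using assms unfolding solvable_def by blast
  define h where "h b i = (if b then g i else f i)" for b i
  have h[simp]: "h b i < N" if "i < K" for b i using fg that by (auto simp: h_def)
  have okh[simp]: "ok i (h False i) j (h True j)" if "i < K" "j < K" for i j using ok that by (auto simp: h_def)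
  define PL CA CB PA PB PH PO GH GU where defs: "PL = Pool ` {..<K}"
    "CA = (\<lambda>i. Slot False i CHome) ` {..<K}" "CB = (\<lambda>i. Slot True i CHome) ` {..<K}"
    "PA = (\<lambda>i. Slot False i (Port True (h False i))) ` {..<K}"
    "PB = (\<lambda>i. Slot True i (Port True (h True i))) ` {..<K}"
    "PH = (\<lambda>(b, i). Slot b i PHome) ` (UNIV \<times> {..<K})"
    "PO = (\<lambda>(b, i). Slot b i (Port False (h b i))) ` (UNIV \<times> {..<K})"
    "GH = (\<lambda>(b, l, i). Slot b i (GHome l)) ` (UNIV \<times> UNIV \<times> {..<K})"
    "GU = (\<lambda>(b, l, i). Slot b i (Guard l (h b i))) ` (UNIV \<times> UNIV \<times> {..<K})"
  let ?R = "(slide verts edges)\<^sup>*\<^sup>*"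
  have mem: "Slot b i s \<in> CA \<longleftrightarrow> \<not> b \<and> i < K \<and> s = CHome" "Slot b i s \<in> CB \<longleftrightarrow> b \<and> i < K \<and> s = CHome"
    "Slot b i s \<in> PA \<longleftrightarrow> \<not> b \<and> i < K \<and> s = Port True (h b i)" "Slot b i s \<in> PB \<longleftrightarrow> b \<and> i < K \<and> s = Port True (h b i)"
    "Slot b i s \<in> PH \<longleftrightarrow> i < K \<and> s = PHome" "Slot b i s \<in> PO \<longleftrightarrow> i < K \<and> s = Port False (h b i)"
    "Slot b i s \<in> GH \<longleftrightarrow> i < K \<and> (\<exists>l. s = GHome l)" "Slot b i s \<in> GU \<longleftrightarrow> i < K \<and> (\<exists>l. s = Guard l (h b i))"
    "Slot b i s \<notin> PL" "Pool i \<in> PL \<longleftrightarrow> i < K" for b i s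
    unfolding defs by (auto simp: image_iff)
  have notmem: "x \<notin> CA" "x \<notin> CB" "x \<notin> PA" "x \<notin> PB" "x \<notin> PH" "x \<notin> PO" "x \<notin> GH" "x \<notin> GU"
    if "\<And>b i s. x \<noteq> Slot b i s" for x using that unfolding defs by auto
  have notPL: "x \<notin> PL" if "\<And>i. x \<noteq> Pool i" for x using that unfolding defs by auto
  have val: "x \<in> CA \<union> CB \<union> PA \<union> PB \<union> PH \<union> PO \<union> GH \<union> GU \<union> PL \<Longrightarrow> valid x" for x
    unfolding defs by auto
  have s1: "?R ({Lock_Off, Spare} \<union> PL \<union> CA \<union> PH \<union> GH) ({Lock_Off, Spare} \<union> PL \<union> CA \<union> PH \<union> GU)"
  proof (rule slides_simultaneous[of _ "\<lambda>(b, l, i). Slot b i (GHome l)" "UNIV \<times> UNIV \<times> {..<K}" _ "\<lambda>(b, l, i). Slot b i (Guard l (h b i))"])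
    show "\<forall>x\<in>{Lock_Off, Spare} \<union> PL \<union> CA \<union> PH \<union> GH \<union> GU. valid x" using val by auto
    show "\<forall>x\<in>{Lock_Off, Spare} \<union> PL \<union> CA \<union> PH \<union> GH \<union> GU. \<forall>y\<in>{Lock_Off, Spare} \<union> PL \<union> CA \<union> PH \<union> GH \<union> GU. arc x y \<longrightarrow>
      (\<exists>i\<in>UNIV \<times> UNIV \<times> {..<K}. x = (\<lambda>(b, l, i). Slot b i (GHome l)) i \<and> y = (\<lambda>(b, l, i). Slot b i (Guard l (h b i))) i \<or> x = (\<lambda>(b, l, i). Slot b i (Guard l (h b i))) i \<and> y = (\<lambda>(b, l, i). Slot b i (GHome l)) i)"
      by (intro ballI impI, erule arcE) (auto simp: mem notmem notPL)
  qed (auto simp: inj_on_def adj_def defs)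
  have s2: "?R ({Lock_Off, Spare} \<union> PL \<union> CA \<union> GU \<union> PH) ({Lock_Off, Spare} \<union> PL \<union> CA \<union> GU \<union> PO)"
  proof (rule slides_simultaneous[of _ "\<lambda>(b, i). Slot b i PHome" "UNIV \<times> {..<K}" _ "\<lambda>(b, i). Slot b i (Port False (h b i))"])
    show "\<forall>x\<in>{Lock_Off, Spare} \<union> PL \<union> CA \<union> GU \<union> PH \<union> PO. valid x" using val by auto
    show "\<forall>x\<in>{Lock_Off, Spare} \<union> PL \<union> CA \<union> GU \<union> PH \<union> PO. \<forall>y\<in>{Lock_Off, Spare} \<union> PL \<union> CA \<union> GU \<union> PH \<union> PO. arc x y \<longrightarrow>
      (\<exists>i\<in>UNIV \<times> {..<K}. x = (\<lambda>(b, i). Slot b i PHome) i \<and> y = (\<lambda>(b, i). Slot b i (Port False (h b i))) i \<or> x = (\<lambda>(b, i). Slot b i (Port False (h b i))) i \<and> y = (\<lambda>(b, i). Slot b i PHome) i)"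
      by (intro ballI impI, erule arcE) (auto simp: mem notmem notPL)
  qed (auto simp: inj_on_def adj_def defs)
  have s3: "?R ({Lock_Off, Spare} \<union> PL \<union> GU \<union> PO \<union> CA) ({Lock_Off, Spare} \<union> PL \<union> GU \<union> PO \<union> PA)"
  proof (rule slides_simultaneous[of _ "\<lambda>i. Slot False i CHome" "{..<K}" _ "\<lambda>i. Slot False i (Port True (h False i))"])
    show "\<forall>x\<in>{Lock_Off, Spare} \<union> PL \<union> GU \<union> PO \<union> CA \<union> PA. valid x" using val by auto
    show "\<forall>x\<in>{Lock_Off, Spare} \<union> PL \<union> GU \<union> PO \<union> CA \<union> PA. \<forall>y\<in>{Lock_Off, Spare} \<union> PL \<union> GU \<union> PO \<union> CA \<union> PA. arc x y \<longrightarrow>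
      (\<exists>i\<in>{..<K}. x = (\<lambda>i. Slot False i CHome) i \<and> y = (\<lambda>i. Slot False i (Port True (h False i))) i \<or> x = (\<lambda>i. Slot False i (Port True (h False i))) i \<and> y = (\<lambda>i. Slot False i CHome) i)"
      by (intro ballI impI, erule arcE) (auto simp: mem notmem notPL)
  qed (auto simp: inj_on_def adj_def defs)
  have s4: "?R ({Spare} \<union> PL \<union> GU \<union> PO \<union> PA \<union> {Lock_Off}) ({Spare} \<union> PL \<union> GU \<union> PO \<union> PA \<union> {Lock_On})"
  proof (rule slides_simultaneous[of _ "\<lambda>_. Lock_Off" "{()}" _ "\<lambda>_. Lock_On"])
    show "\<forall>x\<in>{Spare} \<union> PL \<union> GU \<union> PO \<union> PA \<union> {Lock_Off} \<union> {Lock_On}. valid x" using val by auto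
    show "\<forall>x\<in>{Spare} \<union> PL \<union> GU \<union> PO \<union> PA \<union> {Lock_Off} \<union> {Lock_On}. \<forall>y\<in>{Spare} \<union> PL \<union> GU \<union> PO \<union> PA \<union> {Lock_Off} \<union> {Lock_On}. arc x y \<longrightarrow>
      (\<exists>i\<in>{()}. x = (\<lambda>_. Lock_Off) i \<and> y = (\<lambda>_. Lock_On) i \<or> x = (\<lambda>_. Lock_On) i \<and> y = (\<lambda>_. Lock_Off) i)"
      by (intro ballI impI, erule arcE) (auto simp: mem notmem notPL)
  qed (auto simp: inj_on_def adj_def defs)
  have s5: "?R ({Lock_On, Spare} \<union> GU \<union> PO \<union> PA \<union> PL) ({Lock_On, Spare} \<union> GU \<union> PO \<union> PA \<union> CB)"
  proof (rule slides_simultaneous[of _ "Pool" "{..<K}" _ "\<lambda>i. Slot True i CHome"])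
    show "\<forall>x\<in>{Lock_On, Spare} \<union> GU \<union> PO \<union> PA \<union> PL \<union> CB. valid x" using val by auto
    show "\<forall>x\<in>{Lock_On, Spare} \<union> GU \<union> PO \<union> PA \<union> PL \<union> CB. \<forall>y\<in>{Lock_On, Spare} \<union> GU \<union> PO \<union> PA \<union> PL \<union> CB. arc x y \<longrightarrow>
      (\<exists>i\<in>{..<K}. x = (Pool) i \<and> y = (\<lambda>i. Slot True i CHome) i \<or> x = (\<lambda>i. Slot True i CHome) i \<and> y = (Pool) i)"
      by (intro ballI impI, erule arcE) (auto simp: mem notmem notPL)
  qed (auto simp: inj_on_def adj_def defs)
  have s6: "?R ({Lock_On, Spare} \<union> GU \<union> PO \<union> PA \<union> CB) ({Lock_On, Spare} \<union> GU \<union> PO \<union> PA \<union> PB)"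
  proof (rule slides_simultaneous[of _ "\<lambda>i. Slot True i CHome" "{..<K}" _ "\<lambda>i. Slot True i (Port True (h True i))"])
    show "\<forall>x\<in>{Lock_On, Spare} \<union> GU \<union> PO \<union> PA \<union> CB \<union> PB. valid x" using val by auto
    show "\<forall>x\<in>{Lock_On, Spare} \<union> GU \<union> PO \<union> PA \<union> CB \<union> PB. \<forall>y\<in>{Lock_On, Spare} \<union> GU \<union> PO \<union> PA \<union> CB \<union> PB. arc x y \<longrightarrow>
      (\<exists>i\<in>{..<K}. x = (\<lambda>i. Slot True i CHome) i \<and> y = (\<lambda>i. Slot True i (Port True (h True i))) i \<or> x = (\<lambda>i. Slot True i (Port True (h True i))) i \<and> y = (\<lambda>i. Slot True i CHome) i)"
      by (intro ballI impI, erule arcE) (auto simp: mem notmem notPL)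
  qed (auto simp: inj_on_def adj_def defs)
  \<comment> \<open>\<open>Spare\<close> is adjacent to \<open>Exit\<close>, so its token has to be
    parked before the lock can leave. \<open>Park\<close> is adjacent to the pools, hence available
    only now that they are empty.\<close>
  have s7: "?R ({Lock_On} \<union> GU \<union> PO \<union> PA \<union> PB \<union> {Spare}) ({Lock_On} \<union> GU \<union> PO \<union> PA \<union> PB \<union> {Park})"
  proof (rule slides_simultaneous[of _ "\<lambda>_. Spare" "{()}" _ "\<lambda>_. Park"])
    show "\<forall>x\<in>{Lock_On} \<union> GU \<union> PO \<union> PA \<union> PB \<union> {Spare} \<union> {Park}. valid x" using val by auto
    show "\<forall>x\<in>{Lock_On} \<union> GU \<union> PO \<union> PA \<union> PB \<union> {Spare} \<union> {Park}. \<forall>y\<in>{Lock_On} \<union> GU \<union> PO \<union> PA \<union> PB \<union> {Spare} \<union> {Park}. arc x y \<longrightarrow>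
      (\<exists>i\<in>{()}. x = (\<lambda>_. Spare) i \<and> y = (\<lambda>_. Park) i \<or> x = (\<lambda>_. Park) i \<and> y = (\<lambda>_. Spare) i)"
      by (intro ballI impI, erule arcE) (auto simp: mem notmem notPL)
  qed (auto simp: inj_on_def adj_def defs)
  have s8: "?R ({Park} \<union> GU \<union> PO \<union> PA \<union> PB \<union> {Lock_On}) ({Park} \<union> GU \<union> PO \<union> PA \<union> PB \<union> {Lock_Off})"
  proof (rule slides_simultaneous[of _ "\<lambda>_. Lock_On" "{()}" _ "\<lambda>_. Lock_Off"])
    show "\<forall>x\<in>{Park} \<union> GU \<union> PO \<union> PA \<union> PB \<union> {Lock_On} \<union> {Lock_Off}. valid x" using val by auto
    show "\<forall>x\<in>{Park} \<union> GU \<union> PO \<union> PA \<union> PB \<union> {Lock_On} \<union> {Lock_Off}. \<forall>y\<in>{Park} \<union> GU \<union> PO \<union> PA \<union> PB \<union> {Lock_On} \<union> {Lock_Off}. arc x y \<longrightarrow>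
      (\<exists>i\<in>{()}. x = (\<lambda>_. Lock_On) i \<and> y = (\<lambda>_. Lock_Off) i \<or> x = (\<lambda>_. Lock_Off) i \<and> y = (\<lambda>_. Lock_On) i)"
      by (intro ballI impI, erule arcE) (auto simp: mem notmem notPL)
  qed (auto simp: inj_on_def adj_def defs)
  have s9: "?R ({Park} \<union> GU \<union> PO \<union> PA \<union> PB \<union> {Lock_Off}) ({Park} \<union> GU \<union> PO \<union> PA \<union> PB \<union> {Exit})"
  proof (rule slides_simultaneous[of _ "\<lambda>_. Lock_Off" "{()}" _ "\<lambda>_. Exit"])
    show "\<forall>x\<in>{Park} \<union> GU \<union> PO \<union> PA \<union> PB \<union> {Lock_Off} \<union> {Exit}. valid x" using val by auto
    show "\<forall>x\<in>{Park} \<union> GU \<union> PO \<union> PA \<union> PB \<union> {Lock_Off} \<union> {Exit}. \<forall>y\<in>{Park} \<union> GU \<union> PO \<union> PA \<union> PB \<union> {Lock_Off} \<union> {Exit}. arc x y \<longrightarrow>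
      (\<exists>i\<in>{()}. x = (\<lambda>_. Lock_Off) i \<and> y = (\<lambda>_. Exit) i \<or> x = (\<lambda>_. Exit) i \<and> y = (\<lambda>_. Lock_Off) i)"
      by (intro ballI impI, erule arcE) (auto simp: mem notmem notPL)
  qed (auto simp: inj_on_def adj_def defs)
  \<comment> \<open>With the lock on \<open>Exit\<close>, neither \<open>Lock_Off\<close> nor
    \<open>Lock_On\<close> is occupied, so the checkers of both sides can return home.\<close>
  have s10: "?R ({Park, Exit} \<union> GU \<union> PO \<union> PA \<union> PB) ({Park, Exit} \<union> GU \<union> PO \<union> PA \<union> CB)"
  proof (rule slides_simultaneous[of _ "\<lambda>i. Slot True i (Port True (h True i))" "{..<K}" _ "\<lambda>i. Slot True i CHome"])
    show "\<forall>x\<in>{Park, Exit} \<union> GU \<union> PO \<union> PA \<union> PB \<union> CB. valid x" using val by auto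
    show "\<forall>x\<in>{Park, Exit} \<union> GU \<union> PO \<union> PA \<union> PB \<union> CB. \<forall>y\<in>{Park, Exit} \<union> GU \<union> PO \<union> PA \<union> PB \<union> CB. arc x y \<longrightarrow>
      (\<exists>i\<in>{..<K}. x = (\<lambda>i. Slot True i (Port True (h True i))) i \<and> y = (\<lambda>i. Slot True i CHome) i \<or> x = (\<lambda>i. Slot True i CHome) i \<and> y = (\<lambda>i. Slot True i (Port True (h True i))) i)"
      by (intro ballI impI, erule arcE) (auto simp: mem notmem notPL)
  qed (auto simp: inj_on_def adj_def defs)
  have s11: "?R ({Park, Exit} \<union> GU \<union> PO \<union> CB \<union> PA) ({Park, Exit} \<union> GU \<union> PO \<union> CB \<union> CA)"
  proof (rule slides_simultaneous[of _ "\<lambda>i. Slot False i (Port True (h False i))" "{..<K}" _ "\<lambda>i. Slot False i CHome"])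
    show "\<forall>x\<in>{Park, Exit} \<union> GU \<union> PO \<union> CB \<union> PA \<union> CA. valid x" using val by auto
    show "\<forall>x\<in>{Park, Exit} \<union> GU \<union> PO \<union> CB \<union> PA \<union> CA. \<forall>y\<in>{Park, Exit} \<union> GU \<union> PO \<union> CB \<union> PA \<union> CA. arc x y \<longrightarrow>
      (\<exists>i\<in>{..<K}. x = (\<lambda>i. Slot False i (Port True (h False i))) i \<and> y = (\<lambda>i. Slot False i CHome) i \<or> x = (\<lambda>i. Slot False i CHome) i \<and> y = (\<lambda>i. Slot False i (Port True (h False i))) i)"
      by (intro ballI impI, erule arcE) (auto simp: mem notmem notPL)
  qed (auto simp: inj_on_def adj_def defs)
  have s12: "?R ({Park, Exit} \<union> GU \<union> CB \<union> CA \<union> PO) ({Park, Exit} \<union> GU \<union> CB \<union> CA \<union> PH)"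
  proof (rule slides_simultaneous[of _ "\<lambda>(b, i). Slot b i (Port False (h b i))" "UNIV \<times> {..<K}" _ "\<lambda>(b, i). Slot b i PHome"])
    show "\<forall>x\<in>{Park, Exit} \<union> GU \<union> CB \<union> CA \<union> PO \<union> PH. valid x" using val by auto
    show "\<forall>x\<in>{Park, Exit} \<union> GU \<union> CB \<union> CA \<union> PO \<union> PH. \<forall>y\<in>{Park, Exit} \<union> GU \<union> CB \<union> CA \<union> PO \<union> PH. arc x y \<longrightarrow>
      (\<exists>i\<in>UNIV \<times> {..<K}. x = (\<lambda>(b, i). Slot b i (Port False (h b i))) i \<and> y = (\<lambda>(b, i). Slot b i PHome) i \<or> x = (\<lambda>(b, i). Slot b i PHome) i \<and> y = (\<lambda>(b, i). Slot b i (Port False (h b i))) i)"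
      by (intro ballI impI, erule arcE) (auto simp: mem notmem notPL)
  qed (auto simp: inj_on_def adj_def defs)
  have s13: "?R ({Park, Exit} \<union> CB \<union> CA \<union> PH \<union> GU) ({Park, Exit} \<union> CB \<union> CA \<union> PH \<union> GH)"
  proof (rule slides_simultaneous[of _ "\<lambda>(b, l, i). Slot b i (Guard l (h b i))" "UNIV \<times> UNIV \<times> {..<K}" _ "\<lambda>(b, l, i). Slot b i (GHome l)"])
    show "\<forall>x\<in>{Park, Exit} \<union> CB \<union> CA \<union> PH \<union> GU \<union> GH. valid x" using val by auto
    show "\<forall>x\<in>{Park, Exit} \<union> CB \<union> CA \<union> PH \<union> GU \<union> GH. \<forall>y\<in>{Park, Exit} \<union> CB \<union> CA \<union> PH \<union> GU \<union> GH. arc x y \<longrightarrow>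
      (\<exists>i\<in>UNIV \<times> UNIV \<times> {..<K}. x = (\<lambda>(b, l, i). Slot b i (Guard l (h b i))) i \<and> y = (\<lambda>(b, l, i). Slot b i (GHome l)) i \<or> x = (\<lambda>(b, l, i). Slot b i (GHome l)) i \<and> y = (\<lambda>(b, l, i). Slot b i (Guard l (h b i))) i)"
      by (intro ballI impI, erule arcE) (auto simp: mem notmem notPL)
  qed (auto simp: inj_on_def adj_def defs)
  have chain: "?R X Y \<Longrightarrow> ?R Y' Z \<Longrightarrow> Y = Y' \<Longrightarrow> ?R X Z" for X Y Y' Z by (simp add: rtranclp_trans)
  have start: "start = ({Lock_Off, Spare} \<union> PL \<union> CA \<union> PH) \<union> GH"
    unfolding start_def defs by auto
  have target: "target = ({Park, Exit} \<union> CB \<union> CA \<union> PH) \<union> GH"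
    unfolding target_def defs by auto
  show ?thesis
    unfolding start target
    apply (rule chain[OF s1])
    apply (rule chain[OF s2])
    apply (rule chain[OF s3])
    apply (rule chain[OF s4])
    apply (rule chain[OF s5])
    apply (rule chain[OF s6])
    apply (rule chain[OF s7])
    apply (rule chain[OF s8])
    apply (rule chain[OF s9])
    apply (rule chain[OF s10])
    apply (rule chain[OF s11])
    apply (rule chain[OF s12])
    apply (rule s13)
    by blast+
qed

section \<open>Equivalence with the constraint problem\<close>

lemma inv_start:
  assumes "K \<ge> 1"
  shows "inv start"
proof -
  have sA: "slice False i start = {GHome False, GHome True} \<union> {PHome, CHome}" if "i < K" for i
    using that by (auto simp: slice_def start_def image_iff)
  have sB: "slice True i start = {GHome False, GHome True} \<union> {PHome}" if "i < K" for i
    using that by (auto simp: slice_def start_def image_iff)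
  have "start \<inter> pools = insert Spare (Pool ` {j. j < K})"
    by (auto simp: start_def pools_def)
  moreover have "cell_inv False (slice False i start)" "cell_inv True (slice True i start)" if "i < K" for i
    unfolding sA[OF that] sB[OF that] by (rule cell_inv.N[of _ False]; simp add: restI)+
  moreover have "Lock_Off \<in> start" "Lock_On \<notin> start" by (auto simp: start_def)
  \<comment> \<open>The clause of the invariant for \<open>Lock_Off\<close> needs a waiting checker,
    hence at least one cell.\<close>
  moreover have "\<exists>j<K. True" using assms by (intro exI[of _ 0]) simp
  ultimately show ?thesis unfolding inv_def
    by (intro conjI exI[of _ "\<lambda>_. True"] exI[of _ Spare]) auto
qed

lemma inv_reachable:
  assumes "(slide verts edges)\<^sup>*\<^sup>* X Y" "inv X"
  shows "inv Y \<or> solvable"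
  using assms by (induction rule: rtranclp_induct) (use inv_step in blast)+

lemma card_start: "card start = 8 * K + 2"
proof -
  have *: "card (f ` A) = card A" if "inj f" for f :: "'x \<Rightarrow> vert" and A using that by (simp add: card_image inj_on_def)
  have "start = {Lock_Off, Spare} \<union> (Pool ` {..<K} \<union> ((\<lambda>i. Slot False i CHome) ` {..<K}
     \<union> ((\<lambda>(b, i). Slot b i PHome) ` (UNIV \<times> {..<K}) \<union> (\<lambda>(b, l, i). Slot b i (GHome l)) ` (UNIV \<times> UNIV \<times> {..<K}))))"
    unfolding start_def by (simp only: Un_assoc)
  also have "card \<dots> = 2 + (K + (K + (2 * K + 4 * K)))"
    by (subst card_Un_disjoint, simp, simp, force)+
      (subst *, force simp: inj_on_def, simp add: card_cartesian_product)+
  finally show ?thesis by simp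
qed

lemma finite_start: "finite start"
  by (simp add: start_def)

lemma slides_card:
  assumes "(slide verts edges)\<^sup>*\<^sup>* X Y" "finite X"
  shows "finite Y \<and> card Y = card X"
  using assms
proof (induction rule: rtranclp_induct)
  case (step Y Z)
  then obtain u w where "u \<in> Y" "w \<notin> Y" "Z = insert w (Y - {u})" by (auto simp: slide_def)
  moreover from this have "card (insert w (Y - {u})) = card Y"
    using step by (metis Diff_iff card.remove card_insert_disjoint finite_Diff)
  ultimately show ?case using step by simp
qed simp

theorem token_sliding_iff_solvable:
  assumes "K \<ge> 1"
  shows "token_sliding_yes verts edges start target (8 * K + 2) \<longleftrightarrow> solvable"
proof
  \<comment> \<open>The invariant demands exactly one of \<open>Lock_Off\<close> and
    \<open>Lock_On\<close>, and the target contains neither.\<close>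
  have "\<not> inv target" by (auto simp: inv_def target_def)
  moreover assume "token_sliding_yes verts edges start target (8 * K + 2)"
  ultimately show solvable
    using inv_reachable[OF _ inv_start[OF assms]] by (auto simp: token_sliding_yes_def)
next
  assume solvable
  then have r: "(slide verts edges)\<^sup>*\<^sup>* start target" by (rule solvable_reachable)
  have "Lock_Off \<in> start" "Lock_Off \<notin> target" by (auto simp: start_def target_def)
  then have ne: "start \<noteq> target" by metis
  \<comment> \<open>Independence of both ends is read off the first and the last slide, which exist
    because the ends differ.\<close>
  have "independent verts edges start" using r ne by (cases rule: converse_rtranclpE) (auto simp: slide_def)
  moreover have "independent verts edges target" using r ne by (cases rule: rtranclp.cases) (auto simp: slide_def)
  ultimately show "token_sliding_yes verts edges start target (8 * K + 2)"
    using r slides_card[OF r finite_start] card_start by (simp add: token_sliding_yes_def)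
qed

lemma bipartite_edges: "bipartite verts edges"
proof -
  \<comment> \<open>Inside a cell, ports and guard homes are opposed to the other spots. The two
    classes are exchanged between left and right cells, since across the sides ports meet ports and
    guard homes.\<close>
  define L where "L x \<longleftrightarrow> (case x of Slot b i s \<Rightarrow> (case s of Port c u \<Rightarrow> \<not> b | GHome l \<Rightarrow> \<not> b | _ \<Rightarrow> b)
    | Lock_On \<Rightarrow> True | Exit \<Rightarrow> True | Park \<Rightarrow> True | _ \<Rightarrow> False)" for x
  have L: "L x \<longleftrightarrow> \<not> L y" if "arc x y" for x y
    using that by (rule arcE) (auto simp: L_def)
  have "\<exists>a\<in>{x \<in> verts. L x}. \<exists>b\<in>{x \<in> verts. \<not> L x}. e = {a, b}" if e: "e \<in> edges" for e
  proof -
    obtain x y where "e = {x, y}" "valid x" "valid y" "adj x y" using e unfolding edges_def by blast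
    moreover from this have "L x \<longleftrightarrow> \<not> L y" using L by (auto simp: adj_def)
    ultimately show ?thesis by (cases "L x") (auto simp: verts_def insert_commute)
  qed
  then show ?thesis unfolding bipartite_def
    by (intro exI[of _ "{x \<in> verts. L x}"] exI[of _ "{x \<in> verts. \<not> L x}"]) auto
qed

end

section \<open>Views as variables\<close>

definition digit :: "nat \<Rightarrow> nat \<Rightarrow> nat \<Rightarrow> nat" where
  "digit M r t = t div M ^ r mod M"

lemma digits_exist:
  assumes "\<And>r. r < Q \<Longrightarrow> f r < M"
  shows "\<exists>t<M ^ Q. \<forall>r<Q. digit M r t = f r"
  using assms
proof (induction Q arbitrary: f)
  case (Suc Q)
  from Suc.IH[of "\<lambda>r. f (Suc r)"] Suc.prems obtain t where t: "t < M ^ Q" "\<And>r. r < Q \<Longrightarrow> digit M r t = f (Suc r)" by auto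
  have f0: "f 0 < M" using Suc.prems by simp
  have "f 0 + M * t < M * Suc t" using f0 by simp
  also have "\<dots> \<le> M * M ^ Q" using t(1) by (intro mult_le_mono2) simp
  finally have "f 0 + M * t < M ^ Suc Q" by simp
  moreover have "digit M r (f 0 + M * t) = f r" if "r < Suc Q" for r
  proof (cases r)
    case 0
    then show ?thesis using f0 by (simp add: digit_def)
  next
    case (Suc r')
    have "(f 0 + M * t) div M = t" using f0 by simp
    then have "(f 0 + M * t) div M ^ Suc r' = t div M ^ r'" by (simp add: div_mult2_eq)
    then show ?thesis using t(2)[of r'] that Suc by (simp add: digit_def)
  qed
  ultimately show ?case by blast
qed simp

definition vis_code :: "nat \<Rightarrow> nat \<Rightarrow> nat \<Rightarrow> nat \<Rightarrow> nat \<Rightarrow> nat \<Rightarrow> nat \<Rightarrow> bool" where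
  "vis_code Q M D t w a v \<longleftrightarrow> (\<exists>r<Q. digit M r t = a \<and> digit D r w = v)"

text \<open>A variable \<open>t\<close> is a list of \<open>Q\<close> indices below \<open>M\<close>, coded by its digits, and its value \<open>w\<close> lists the entries there.\<close>
definition agree :: "nat \<Rightarrow> nat \<Rightarrow> nat \<Rightarrow> nat \<Rightarrow> nat \<Rightarrow> nat \<Rightarrow> nat \<Rightarrow> bool" where
  "agree Q M D t w t' w' \<longleftrightarrow> (\<forall>r<Q. \<forall>r'<Q. digit M r t = digit M r' t' \<longrightarrow> digit D r w = digit D r' w')"

text \<open>An index \<open>a\<close> below \<open>M\<close> is itself a variable, with digit 0
  equal to \<open>a\<close>. Its value on the right fixes entry \<open>a\<close> of the sequence,
  and agreement with it determines all values on the left, so it suffices to impose \<open>P\<close>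
  there.\<close>

lemma solvable_iff_local:
  assumes Q: "0 < Q" and M: "0 < M" and D: "0 < D"
  shows "gadget.solvable (\<lambda>t w t' w'. agree Q M D t w t' w' \<and> P (vis_code Q M D t w)) (M ^ Q) (D ^ Q) \<longleftrightarrow>
    (\<exists>s. (\<forall>a<M. s a < D) \<and> (\<forall>V. V \<subseteq> {..<M} \<and> V \<noteq> {} \<and> card V \<le> Q \<longrightarrow> P (vis_of s V)))"
proof
  assume "gadget.solvable (\<lambda>t w t' w'. agree Q M D t w t' w' \<and> P (vis_code Q M D t w)) (M ^ Q) (D ^ Q)"
  then obtain f g where ok: "\<And>i j. i < M ^ Q \<Longrightarrow> j < M ^ Q \<Longrightarrow> agree Q M D i (f i) j (g j)"
    and P: "\<And>i. i < M ^ Q \<Longrightarrow> P (vis_code Q M D i (f i))"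
    unfolding gadget.solvable_def by blast
  define s where "s a = digit D 0 (g a)" for a
  have "M ^ 1 \<le> M ^ Q" using Q M by (intro power_increasing) auto
  then have f_digit: "digit D r (f i) = s (digit M r i)" if "i < M ^ Q" "r < Q" for i r
  proof -
    let ?a = "digit M r i"
    have a: "?a < M" using M by (simp add: digit_def)
    then have "agree Q M D i (f i) ?a (g ?a)" using ok[OF that(1), of ?a] \<open>M ^ 1 \<le> M ^ Q\<close> by simp
    moreover have "digit M 0 ?a = ?a" using a by (simp add: digit_def)
    ultimately show ?thesis using that(2) Q unfolding agree_def s_def by metis
  qed
  have "P (vis_of s V)" if V: "V \<subseteq> {..<M}" "V \<noteq> {}" "card V \<le> Q" for V
  proof -
    have "finite V" using V(1) finite_subset by blast
    then obtain h where h: "bij_betw h {0..<card V} V" using ex_bij_betw_nat_finite by blast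
    obtain b where b: "b \<in> V" using V(2) by blast
    \<comment> \<open>A variable lists exactly \<open>Q\<close> indices. A smaller set is padded by
      repeating one of its elements, which is why \<open>V\<close> must not be empty.\<close>
    define e where "e r = (if r < card V then h r else b)" for r
    have hV: "h ` {0..<card V} = V" using h by (simp add: bij_betw_def)
    have eV: "e ` {..<Q} = V"
    proof
      show "e ` {..<Q} \<subseteq> V" using hV b by (auto simp: e_def)
      have "h r \<in> e ` {..<Q}" if "r < card V" for r using that V(3) by (intro image_eqI[of _ _ r]) (auto simp: e_def)
      then have "h ` {0..<card V} \<subseteq> e ` {..<Q}" by auto
      then show "V \<subseteq> e ` {..<Q}" unfolding hV .
    qed
    then have "e r < M" if "r < Q" for r using V(1) that by blast
    then obtain i where i: "i < M ^ Q" "\<And>r. r < Q \<Longrightarrow> digit M r i = e r" using digits_exist[of Q e M] by blast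
    have "vis_code Q M D i (f i) = vis_of s V"
    proof (intro ext)
      fix a v
      have "vis_code Q M D i (f i) a v \<longleftrightarrow> (\<exists>r<Q. e r = a \<and> s a = v)"
        unfolding vis_code_def using i f_digit by auto
      also have "\<dots> \<longleftrightarrow> a \<in> V \<and> v = s a" unfolding eV[symmetric] by auto
      finally show "vis_code Q M D i (f i) a v = vis_of s V a v" unfolding vis_of_def .
    qed
    then show ?thesis using P[OF i(1)] by simp
  qed
  moreover have "s a < D" for a using D by (simp add: s_def digit_def)
  ultimately show "\<exists>s. (\<forall>a<M. s a < D) \<and> (\<forall>V. V \<subseteq> {..<M} \<and> V \<noteq> {} \<and> card V \<le> Q \<longrightarrow> P (vis_of s V))"
    by blast
next
  assume "\<exists>s. (\<forall>a<M. s a < D) \<and> (\<forall>V. V \<subseteq> {..<M} \<and> V \<noteq> {} \<and> card V \<le> Q \<longrightarrow> P (vis_of s V))"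
  then obtain s where s: "\<And>a. a < M \<Longrightarrow> s a < D"
    and P: "\<And>V. V \<subseteq> {..<M} \<and> V \<noteq> {} \<and> card V \<le> Q \<longrightarrow> P (vis_of s V)" by blast
  have dM: "digit M r i < M" for r i using M by (simp add: digit_def)
  have "\<exists>w. w < D ^ Q \<and> (\<forall>r<Q. digit D r w = s (digit M r i))" for i
    using digits_exist[of Q "\<lambda>r. s (digit M r i)" D] s[OF dM] by simp
  then obtain f where f: "\<And>i. f i < D ^ Q" "\<And>i r. r < Q \<Longrightarrow> digit D r (f i) = s (digit M r i)" by metis
  have "P (vis_code Q M D i (f i))" for i
  proof -
    let ?V = "(\<lambda>r. digit M r i) ` {..<Q}"
    have "?V \<subseteq> {..<M}" "?V \<noteq> {}" using dM Q by auto
    moreover have "card ?V \<le> Q" using card_image_le[of "{..<Q}" "\<lambda>r. digit M r i"] by simp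
    ultimately have "P (vis_of s ?V)" using P by blast
    moreover have "vis_code Q M D i (f i) = vis_of s ?V"
      unfolding vis_code_def vis_of_def fun_eq_iff using f(2) by auto
    ultimately show ?thesis by simp
  qed
  moreover have "agree Q M D i (f i) j (f j)" for i j unfolding agree_def using f(2) by simp
  ultimately show "gadget.solvable (\<lambda>t w t' w'. agree Q M D t w t' w' \<and> P (vis_code Q M D t w)) (M ^ Q) (D ^ Q)"
    unfolding gadget.solvable_def using f(1) by blast
qed

section \<open>Transfer of token sliding along injections\<close>

lemma independent_image:
  assumes "inj_on f V" "f ` V \<subseteq> V'" "\<And>e. e \<in> E \<Longrightarrow> e \<subseteq> V" "X \<subseteq> V"
  shows "independent V' ((`) f ` E) (f ` X) \<longleftrightarrow> independent V E X"
proof -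
  have "{f x, f y} \<in> (`) f ` E \<longleftrightarrow> {x, y} \<in> E" if "x \<in> X" "y \<in> X" for x y
  proof
    assume "{f x, f y} \<in> (`) f ` E"
    then obtain e where e: "e \<in> E" "f ` {x, y} = f ` e" by auto
    then have "{x, y} = e" using inj_on_image_eq_iff[OF assms(1), of "{x, y}" e] assms(3,4) that by blast
    then show "{x, y} \<in> E" using e by simp
  next
    assume "{x, y} \<in> E"
    then show "{f x, f y} \<in> (`) f ` E" by (intro image_eqI[of _ _ "{x, y}"]) auto
  qed
  moreover have "f ` X \<subseteq> V'" using assms by blast
  ultimately show ?thesis using assms(4) by (auto simp: independent_def)
qed

text \<open>Vertices outside the image of \<open>f\<close> are isolated, since every edge is the
  image of an edge. So a slide of an image set uses only image vertices and can be lifted.\<close>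

lemma slide_image:
  assumes f: "inj_on f V" "f ` V \<subseteq> V'" "\<And>e. e \<in> E \<Longrightarrow> e \<subseteq> V"
  shows "slide V E X X' \<Longrightarrow> slide V' ((`) f ` E) (f ` X) (f ` X')"
    and "slide V' ((`) f ` E) (f ` X) Y \<Longrightarrow> X \<subseteq> V \<Longrightarrow> \<exists>X'. Y = f ` X' \<and> slide V E X X'"
proof -
  assume "slide V E X X'"
  then obtain u w where uw: "independent V E X" "independent V E X'" "u \<in> X" "w \<notin> X" "{u, w} \<in> E" "X' = insert w (X - {u})"
    by (auto simp: slide_def)
  then have sub: "X \<subseteq> V" "X' \<subseteq> V" by (auto simp: independent_def)
  have "f w \<notin> f ` X" using uw sub inj_on_image_mem_iff[OF f(1), of w X] by auto
  moreover have "f ` X' = insert (f w) (f ` X - {f u})"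
    using uw(3,6) sub inj_on_image_set_diff[OF f(1), of X "{u}"] by auto
  moreover have "{f u, f w} \<in> (`) f ` E" using uw(5) by (intro image_eqI[of _ _ "{u, w}"]) auto
  ultimately show "slide V' ((`) f ` E) (f ` X) (f ` X')"
    unfolding slide_def using independent_image[OF f sub(1)] independent_image[OF f sub(2)] uw by blast
next
  assume "slide V' ((`) f ` E) (f ` X) Y" and sub: "X \<subseteq> V"
  then obtain u' w' where uw: "independent V' ((`) f ` E) (f ` X)" "independent V' ((`) f ` E) Y" "u' \<in> f ` X" "w' \<notin> f ` X"
    "{u', w'} \<in> (`) f ` E" "Y = insert w' (f ` X - {u'})"
    by (auto simp: slide_def)
  then obtain u e where u: "u \<in> X" "u' = f u" and e: "e \<in> E" "f ` e = {u', w'}" by auto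
  then obtain w where w: "w \<in> e" "w' = f w" by (metis imageE insertCI)
  have eV: "e \<subseteq> V" using e f(3) by blast
  have "f ` e = f ` {u, w}" using e u w by auto
  then have "e = {u, w}" using inj_on_image_eq_iff[OF f(1), of e "{u, w}"] eV sub u w by auto
  let ?X' = "insert w (X - {u})"
  have Y: "Y = f ` ?X'" using uw(6) u w sub inj_on_image_set_diff[OF f(1), of X "{u}"] by auto
  moreover have sub': "?X' \<subseteq> V" using sub eV w by auto
  have "independent V E ?X'" using independent_image[OF f sub'] uw(2) Y by simp
  moreover have "w \<notin> X" using uw(4) w by auto
  moreover have "independent V E X" using independent_image[OF f sub] uw(1) by simp
  ultimately have "slide V E X ?X'" unfolding slide_def using u e \<open>e = {u, w}\<close> by blast
  then show "\<exists>X'. Y = f ` X' \<and> slide V E X X'" using Y by blast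
qed

lemma token_sliding_yes_image:
  assumes f: "inj_on f V" "f ` V \<subseteq> V'" "\<And>e. e \<in> E \<Longrightarrow> e \<subseteq> V" and ST: "S \<subseteq> V" "T \<subseteq> V"
  shows "token_sliding_yes V' ((`) f ` E) (f ` S) (f ` T) k \<longleftrightarrow> token_sliding_yes V E S T k"
proof -
  let ?R = "(slide V E)\<^sup>*\<^sup>*" and ?R' = "(slide V' ((`) f ` E))\<^sup>*\<^sup>*"
  have "?R S X \<Longrightarrow> ?R' (f ` S) (f ` X)" for X
  proof (induction rule: rtranclp_induct)
    case (step Y Z)
    then show ?case using slide_image(1)[OF f step(2)] by (meson rtranclp.rtrancl_into_rtrancl)
  qed simp
  moreover have "?R' (f ` S) Y \<Longrightarrow> \<exists>X\<subseteq>V. Y = f ` X \<and> ?R S X" for Y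
  proof (induction rule: rtranclp_induct)
    case base
    then show ?case using ST by blast
  next
    case (step Y Z)
    then obtain X where X: "X \<subseteq> V" "Y = f ` X" "?R S X" by blast
    then obtain X' where "Z = f ` X'" "slide V E X X'"
      using slide_image(2)[OF f step(2)[unfolded X(2)] X(1)] by blast
    moreover from this have "X' \<subseteq> V" by (auto simp: slide_def independent_def)
    moreover from calculation X have "?R S X'" by (auto intro: rtranclp.rtrancl_into_rtrancl)
    ultimately show ?case by blast
  qed
  then have "?R' (f ` S) (f ` T) \<Longrightarrow> ?R S T" using inj_on_image_eq_iff[OF f(1)] ST(2) by metis
  ultimately have "?R' (f ` S) (f ` T) \<longleftrightarrow> ?R S T" by blast
  moreover have "card (f ` S) = card S" "card (f ` T) = card T"
    using f(1) ST by (auto intro: card_image inj_on_subset)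
  ultimately show ?thesis unfolding token_sliding_yes_def
    using independent_image[OF f ST(1)] independent_image[OF f ST(2)] by simp
qed

section \<open>Decoding circuits and coding vertices\<close>

lemma enc_rel_eq: "enc_rel n R = map (\<lambda>i. R (i div n) (i mod n)) [0..<n * n]"
proof -
  have "concat (map (\<lambda>i. map (R i) [0..<n]) [0..<m]) = map (\<lambda>i. R (i div n) (i mod n)) [0..<m * n]" for m
  proof (induction m)
    case (Suc m)
    have "map (R m) [0..<n] = map (\<lambda>i. R (i div n) (i mod n)) [m * n..<m * n + n]"
      by (rule nth_equalityI) auto
    then show ?case using Suc upt_add_eq_append[of 0 "m * n" n] by (simp add: add.commute)
  qed simp
  then show ?thesis unfolding enc_rel_def .
qed

lemma length_enc_circuit: "length (enc_circuit C) = gates C + 1 + gates C * gates C + gates C"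
  by (simp add: enc_circuit_def enc_nat_def enc_rel_eq enc_set_def)

lemma nth_enc:
  fixes b c d :: "bool list"
  assumes "length b = n * n" "length c = n"
  defines "w \<equiv> enc_nat n @ b @ c @ d"
  shows "i < n \<Longrightarrow> w ! i" "\<not> w ! n" "i < n * n \<Longrightarrow> w ! (n + 1 + i) = b ! i" "i < n \<Longrightarrow> w ! (n + 1 + n * n + i) = c ! i"
    "i < length d \<Longrightarrow> w ! (n + 1 + n * n + n + i) = d ! i"
  unfolding w_def enc_nat_def using assms(1,2) by (simp_all add: nth_append)

text \<open>Total, because the reduction must answer on every word. Words that encode no circuit are
  recognized by \<open>well_formed\<close>.\<close>

definition decode :: "bool list \<Rightarrow> circuit" where
  "decode x = (let n = length (takeWhile id x) in
     \<lparr>gates = n, wires = {(j, i). j < n \<and> i < n \<and> n + 1 + (j * n + i) < length x \<and> x ! (n + 1 + (j * n + i))},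
      and_gates = {i. i < n \<and> n + 1 + n * n + i < length x \<and> x ! (n + 1 + n * n + i)}\<rparr>)"

definition well_formed :: "bool list \<Rightarrow> bool" where
  "well_formed x \<longleftrightarrow> length x = gates (decode x) + 1 + gates (decode x) * gates (decode x) + gates (decode x) \<and>
     1 \<le> gates (decode x) \<and> (\<forall>j<gates (decode x). \<forall>i<gates (decode x). wire (decode x) j i \<longrightarrow> j < i)"

lemma gates_decode: "gates (decode x) = length (takeWhile id x)"
  by (simp add: decode_def Let_def)

lemma wires_decode: "wire (decode x) j i \<longleftrightarrow> j < gates (decode x) \<and> i < gates (decode x) \<and>
    gates (decode x) + 1 + (j * gates (decode x) + i) < length x \<and> x ! (gates (decode x) + 1 + (j * gates (decode x) + i))"
  by (simp add: decode_def Let_def)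

lemma and_gates_decode: "i \<in> and_gates (decode x) \<longleftrightarrow> i < gates (decode x) \<and>
    gates (decode x) + 1 + gates (decode x) * gates (decode x) + i < length x \<and>
    x ! (gates (decode x) + 1 + gates (decode x) * gates (decode x) + i)"
  by (simp add: decode_def Let_def)

lemma pair_less_square: "j < n \<Longrightarrow> i < n \<Longrightarrow> j * n + i < n * (n::nat)"
proof -
  assume "j < n" "i < n"
  then have "j * n + i < Suc j * n" by simp
  also have "\<dots> \<le> n * n" using \<open>j < n\<close> by (intro mult_le_mono1) simp
  finally show ?thesis .
qed

lemma decode_enc_circuit:
  assumes wf: "wf_circuit C"
  defines "x \<equiv> enc_circuit C"
  shows "gates (decode x) = gates C" "wires (decode x) = wires C"
    "and_gates (decode x) = and_gates C \<inter> {..<gates C}" "well_formed x"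
proof -
  let ?n = "gates C"
  have len: "length x = ?n + 1 + ?n * ?n + ?n" unfolding x_def by (rule length_enc_circuit)
  have x: "x = enc_nat ?n @ enc_rel ?n (\<lambda>j i. wire C j i) @ enc_set ?n (and_gates C) @ []"
    unfolding x_def enc_circuit_def by simp
  note nth = nth_enc[where b = "enc_rel ?n (\<lambda>j i. wire C j i)" and n = ?n and c = "enc_set ?n (and_gates C)" and d = "[]", folded x]
  show g: "gates (decode x) = ?n"
    unfolding gates_decode x enc_nat_def by (simp add: takeWhile_append)
  show w: "wires (decode x) = wires C"
  proof (intro set_eqI, clarify)
    fix j i
    show "wire (decode x) j i \<longleftrightarrow> wire C j i"
    proof (cases "j < ?n \<and> i < ?n")
      case True
      then have l: "j * ?n + i < ?n * ?n" by (auto intro: pair_less_square)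
      then have "x ! (?n + 1 + (j * ?n + i)) \<longleftrightarrow> wire C j i"
        using True by (subst nth(3)) (simp_all add: enc_rel_eq enc_set_def)
      then show ?thesis unfolding wires_decode g len using True l by simp
    next
      case False
      then show ?thesis unfolding wires_decode g using wire_less[OF wf, of j i] by auto
    qed
  qed
  show "and_gates (decode x) = and_gates C \<inter> {..<?n}"
  proof (intro set_eqI)
    fix i
    have "x ! (?n + 1 + ?n * ?n + i) \<longleftrightarrow> i \<in> and_gates C" if "i < ?n"
      using that by (subst nth(4)) (simp_all add: enc_rel_eq enc_set_def)
    then show "i \<in> and_gates (decode x) \<longleftrightarrow> i \<in> and_gates C \<inter> {..<?n}"
      unfolding and_gates_decode g len by auto
  qed
  show "well_formed x" unfolding well_formed_def g w len using wire_less[OF wf] wf by (auto simp: wf_circuit_def)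
qed

lemma wf_decode: "well_formed x \<Longrightarrow> wf_circuit (decode x)"
  unfolding wf_circuit_def well_formed_def by (auto simp: wires_decode)

lemma enc_decode:
  assumes "well_formed x"
  shows "enc_circuit (decode x) = x"
proof -
  let ?n = "gates (decode x)"
  have len: "length x = ?n + 1 + ?n * ?n + ?n" using assms by (simp add: well_formed_def)
  let ?y = "enc_circuit (decode x)"
  have y: "?y = enc_nat ?n @ enc_rel ?n (\<lambda>j i. wire (decode x) j i) @ enc_set ?n (and_gates (decode x)) @ []"
    unfolding enc_circuit_def by simp
  note nth = nth_enc[where b = "enc_rel ?n (\<lambda>j i. wire (decode x) j i)" and n = ?n
      and c = "enc_set ?n (and_gates (decode x))" and d = "[]", folded y]
  have lead: "x ! i" if "i < ?n" for i
    using that set_takeWhileD[of "takeWhile id x ! i" id x] nth_mem[of i "takeWhile id x"] takeWhile_nth[of i id x]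
    unfolding gates_decode by simp
  have stop: "\<not> x ! ?n" using len nth_length_takeWhile[of id x] unfolding gates_decode by simp
  show ?thesis
  proof (rule nth_equalityI)
    show "length ?y = length x" unfolding len by (rule length_enc_circuit)
  next
    fix i assume "i < length ?y"
    then have i: "i < ?n + 1 + ?n * ?n + ?n" by (simp only: length_enc_circuit)
    consider "i < ?n" | "i = ?n" | k where "i = ?n + 1 + k" "k < ?n * ?n" | k where "i = ?n + 1 + ?n * ?n + k" "k < ?n"
    proof -
      have "i < ?n \<or> i = ?n \<or> (i = ?n + 1 + (i - (?n + 1)) \<and> i - (?n + 1) < ?n * ?n) \<or>
          (i = ?n + 1 + ?n * ?n + (i - (?n + 1 + ?n * ?n)) \<and> i - (?n + 1 + ?n * ?n) < ?n)"
        using i by linarith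
      then show ?thesis using that by blast
    qed
    then show "?y ! i = x ! i"
    proof cases
      case 1
      then show ?thesis using lead nth(1)[of i] by (simp add: enc_rel_eq enc_set_def)
    next
      case 2
      then show ?thesis using stop nth(2) by (simp add: enc_rel_eq enc_set_def)
    next
      case (3 k)
      have n0: "0 < ?n" using 3(2) by (cases ?n) auto
      have "k div ?n < ?n" "k mod ?n < ?n" using 3(2) n0 by (auto simp: less_mult_imp_div_less)
      moreover have "k div ?n * ?n + k mod ?n = k" by simp
      ultimately have "wire (decode x) (k div ?n) (k mod ?n) \<longleftrightarrow> x ! (?n + 1 + k)"
        unfolding wires_decode using 3(2) len by simp
      then show ?thesis unfolding 3(1) using 3(2) by (subst nth(3)) (simp_all add: enc_rel_eq enc_set_def)
    next
      case (4 k)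
      have "k \<in> and_gates (decode x) \<longleftrightarrow> x ! (?n + 1 + ?n * ?n + k)"
        unfolding and_gates_decode using 4(2) len by simp
      then show ?thesis unfolding 4(1) using 4(2) by (subst nth(4)) (simp_all add: enc_rel_eq enc_set_def)
    qed
  qed
qed

text \<open>The encoding forgets members of \<open>and_gates\<close> that are not below
  \<open>gates C\<close>, so decoding returns the circuit only up to such members.\<close>

lemma gate_value_cong:
  assumes "wf_circuit C" "wires C' = wires C" "\<And>i. i < gates C \<Longrightarrow> i \<in> and_gates C' \<longleftrightarrow> i \<in> and_gates C"
  shows "i < gates C \<Longrightarrow> gate_value C' X i \<longleftrightarrow> gate_value C X i"
proof (induction i rule: less_induct)
  case (less i)
  have "gate_value C' X j \<longleftrightarrow> gate_value C X j" if "j < i" for j using less that by auto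
  moreover have "indegree C' i = indegree C i" using assms(2) by (simp add: indegree_def)
  ultimately show ?case
    using assms(2) assms(3)[OF less.prems] by (subst (1 2) gate_value.simps) auto
qed

lemma weighted_circuit_sat_iff:
  "(x, k) \<in> weighted_circuit_sat 1 d \<longleftrightarrow> well_formed x \<and>
     depth_le (decode x) d (gates (decode x) - 1) \<and> weft_le_1 (decode x) d (gates (decode x) - 1) \<and>
     (\<exists>X\<subseteq>input_gates (decode x). card X = k \<and> gate_value (decode x) X (output_gate (decode x)))"
proof
  assume "(x, k) \<in> weighted_circuit_sat 1 d"
  then obtain C X where C: "x = enc_circuit C" "wf_circuit C" "weft_at_most C 1" "depth_at_most C d"
    "X \<subseteq> input_gates C" "card X = k" "gate_value C X (output_gate C)"
    by (auto simp: weighted_circuit_sat_def)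
  note dec = decode_enc_circuit[OF C(2), folded C(1)]
  let ?C = "decode x"
  have wf: "wf_circuit ?C" using wf_decode dec(4) .
  have ind: "indegree ?C = indegree C" by (intro ext) (simp add: indegree_def dec(2))
  have inp: "input_gates ?C = input_gates C" by (simp add: input_gates_def ind dec(1))
  have paths: "input_output_paths ?C = input_output_paths C"
    by (simp add: input_output_paths_def inp output_gate_def dec(1,2))
  have "weft_at_most ?C 1 \<and> depth_at_most ?C d"
    using C(3,4) by (simp add: weft_at_most_def depth_at_most_def paths ind)
  then have "depth_le ?C d (gates ?C - 1)" "weft_le_1 ?C d (gates ?C - 1)"
    using weft_depth_iff[OF wf] by blast+
  moreover have "output_gate C < gates C" using C(2) by (auto simp: output_gate_def wf_circuit_def)
  then have "gate_value ?C X (output_gate C) \<longleftrightarrow> gate_value C X (output_gate C)"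
    using gate_value_cong[OF C(2) dec(2)] dec(3) by auto
  then have "gate_value ?C X (output_gate ?C)" using C(7) by (simp add: output_gate_def dec(1))
  ultimately show "well_formed x \<and> depth_le ?C d (gates ?C - 1) \<and> weft_le_1 ?C d (gates ?C - 1) \<and>
     (\<exists>X\<subseteq>input_gates ?C. card X = k \<and> gate_value ?C X (output_gate ?C))"
    using dec(4) C(5,6) inp by blast
next
  let ?C = "decode x"
  assume a: "well_formed x \<and> depth_le ?C d (gates ?C - 1) \<and> weft_le_1 ?C d (gates ?C - 1) \<and>
     (\<exists>X\<subseteq>input_gates ?C. card X = k \<and> gate_value ?C X (output_gate ?C))"
  then have "weft_at_most ?C 1 \<and> depth_at_most ?C d" using weft_depth_iff[OF wf_decode] by blast
  then have "(enc_circuit ?C, k) \<in> weighted_circuit_sat 1 d"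
    unfolding weighted_circuit_sat_def using a wf_decode[of x] by blast
  then show "(x, k) \<in> weighted_circuit_sat 1 d" using a enc_decode[of x] by simp
qed

section \<open>Vertices as numbers\<close>

fun tag :: "vert \<Rightarrow> nat" where
  "tag (Slot b i (Port c u)) = 2 * of_bool b + of_bool c"
| "tag (Slot b i (Guard l u)) = 4 + 2 * of_bool b + of_bool l"
| "tag (Slot b i (GHome l)) = 8 + 2 * of_bool b + of_bool l"
| "tag (Slot b i PHome) = 12 + of_bool b"
| "tag (Slot b i CHome) = 14 + of_bool b"
| "tag (Pool i) = 16"
| "tag Lock_Off = 17"
| "tag Lock_On = 18"
| "tag Exit = 19"
| "tag Park = 20"
| "tag Spare = 21"

fun index :: "vert \<Rightarrow> nat" where
  "index (Slot b i y) = i"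
| "index (Pool i) = i"
| "index _ = 0"

fun colour :: "vert \<Rightarrow> nat" where
  "colour (Slot b i (Port c u)) = u"
| "colour (Slot b i (Guard l u)) = u"
| "colour _ = 0"

text \<open>A mixed-radix number with the digits tag, index and colour, for the radices 22,
  \<open>K\<close> and \<open>N\<close>. Missing indices and colours are 0; numbers that code no
  vertex become isolated vertices.\<close>

definition code :: "nat \<Rightarrow> nat \<Rightarrow> vert \<Rightarrow> nat" where
  "code K N y = (tag y * K + index y) * N + colour y"

lemma tag_less: "tag y < 22"
  by (cases y rule: tag.cases) auto

lemma vert_eqI: "tag y = tag z \<Longrightarrow> index y = index z \<Longrightarrow> colour y = colour z \<Longrightarrow> y = z"
  by (cases y rule: tag.cases; cases z rule: tag.cases) (auto split: if_splits simp: of_bool_def)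

lemma code_less_inj:
  assumes "0 < K" "0 < N" "gadget.valid K N y"
  shows "code K N y < 22 * K * N" "gadget.valid K N z \<Longrightarrow> code K N y = code K N z \<Longrightarrow> y = z"
proof -
  have bounds: "index y < K \<and> colour y < N" if "gadget.valid K N y" for y
    using that assms(1,2) by (cases y rule: tag.cases) (auto simp: gadget.valid.simps)
  have "code K N y < Suc (tag y * K + index y) * N" using bounds[OF assms(3)] by (simp add: code_def)
  also have "\<dots> \<le> (Suc (tag y) * K) * N" using bounds[OF assms(3)] by (intro mult_le_mono1) simp
  also have "\<dots> \<le> (22 * K) * N" using tag_less[of y] by (intro mult_le_mono1) simp
  finally show "code K N y < 22 * K * N" .
  have parts: "colour y = code K N y mod N" "index y = code K N y div N mod K" "tag y = code K N y div N div K"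
    if "gadget.valid K N y" for y
    using bounds[OF that] unfolding code_def by simp_all
  show "y = z" if "gadget.valid K N z" "code K N y = code K N z"
    using parts[OF assms(3)] parts[OF that(1)] that(2) by (intro vert_eqI) simp_all
qed

text \<open>Describing the bit at position \<open>i\<close> by bounded quantifiers gives the form
  that a predicate computable by bounded sums needs.\<close>

lemma enc_ts_eq:
  "enc_ts n E S T = map (\<lambda>i. i < n \<or> (\<exists>u<n. \<exists>v<n. i = n + 1 + (u * n + v) \<and> {u, v} \<in> E) \<or>
     (\<exists>u<n. i = n + 1 + n * n + u \<and> u \<in> S) \<or> (\<exists>u<n. i = n + 1 + n * n + n + u \<and> u \<in> T)) [0..<n + 1 + n * n + n + n]"
  (is "_ = map ?f [0..<?m]")
proof (rule nth_equalityI)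
  show len: "length (enc_ts n E S T) = length (map ?f [0..<?m])"
    by (simp add: enc_ts_def enc_nat_def enc_rel_eq enc_set_def)
  fix i assume "i < length (enc_ts n E S T)"
  then have i: "i < ?m" using len by simp
  note nth = nth_enc[where b = "enc_rel n (\<lambda>u v. {u, v} \<in> E)" and n = n and c = "enc_set n S" and d = "enc_set n T", folded enc_ts_def]
  have sq: "u * n + v < n * n" if "u < n" "v < n" for u v using pair_less_square[OF that] .
  consider "i < n" | "i = n" | k where "i = n + 1 + k" "k < n * n" | k where "i = n + 1 + n * n + k" "k < n"
    | k where "i = n + 1 + n * n + n + k" "k < n"
  proof -
    have "i < n \<or> i = n \<or> (i = n + 1 + (i - (n + 1)) \<and> i - (n + 1) < n * n) \<or>
        (i = n + 1 + n * n + (i - (n + 1 + n * n)) \<and> i - (n + 1 + n * n) < n) \<or>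
        (i = n + 1 + n * n + n + (i - (n + 1 + n * n + n)) \<and> i - (n + 1 + n * n + n) < n)"
      using i by linarith
    then show ?thesis using that by blast
  qed
  then have "enc_ts n E S T ! i \<longleftrightarrow> ?f i"
  proof cases
    case 1
    then show ?thesis using nth(1)[of i] by (simp add: enc_rel_eq enc_set_def)
  next
    case 2
    then show ?thesis using nth(2) by (simp add: enc_rel_eq enc_set_def)
  next
    case (3 k)
    have n0: "0 < n" using 3(2) by (cases n) auto
    have dm: "k div n < n" "k mod n < n" "k div n * n + k mod n = k" using 3(2) n0 by (auto simp: less_mult_imp_div_less)
    have "(u = k div n \<and> v = k mod n)" if "v < n" "k = u * n + v" for u v using that by simp
    then have "(\<exists>u<n. \<exists>v<n. k = u * n + v \<and> {u, v} \<in> E) \<longleftrightarrow> {k div n, k mod n} \<in> E" using dm by metis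
    moreover have "enc_ts n E S T ! i \<longleftrightarrow> {k div n, k mod n} \<in> E"
      unfolding 3(1) using 3(2) by (subst nth(3)) (simp_all add: enc_rel_eq enc_set_def)
    ultimately show ?thesis using 3 by simp
  next
    case (4 k)
    have "enc_ts n E S T ! i \<longleftrightarrow> k \<in> S"
      unfolding 4(1) using 4(2) by (subst nth(4)) (simp_all add: enc_rel_eq enc_set_def)
    then show ?thesis unfolding 4(1) using 4(2) sq by force
  next
    case (5 k)
    have "enc_ts n E S T ! i \<longleftrightarrow> k \<in> T"
      unfolding 5(1) using 5(2) by (subst nth(5)) (simp_all add: enc_rel_eq enc_set_def)
    then show ?thesis unfolding 5(1) using 5(2) sq by force
  qed
  moreover have "map ?f [0..<?m] ! i = ?f i" using i by (subst nth_map_upt) simp_all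
  ultimately show "enc_ts n E S T ! i = map ?f [0..<?m] ! i" by blast
qed

section \<open>Circuit predicates as bounded sums\<close>

lemma poly_pred_ex_bool:
  assumes "\<And>b. poly_pred (P b)"
  shows "poly_pred (\<lambda>x s. \<exists>b::bool. P b x s)"
  unfolding ex_bool_eq by ((rule poly_pred_disj assms)+)

lemma sum_of_bool_less: "(\<Sum>i<m. of_bool (i < q)) = min m (q::nat)"
  by (induction m) auto

lemma poly_gates: "poly_term (\<lambda>x s. gates (decode x))"
proof -
  \<comment> \<open>The length of the unary prefix is the number of positions up to which all bits
    are true.\<close>
  have "poly_term (\<lambda>x s. \<Sum>i<length x. of_bool (\<forall>j<i + 1. j < length x \<and> x ! j))"
    by (rule poly_term_sum[OF poly_term.len], fold poly_pred_def)
      ((rule poly_pred_ball poly_pred_bit poly_term.add poly_term.peek poly_term.const)+)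
  moreover have "(\<Sum>i<length x. of_bool (\<forall>j<i + 1. j < length x \<and> x ! j)) = gates (decode x)" for x
  proof -
    let ?n = "length (takeWhile id x)"
    have "(\<forall>j<i + 1. j < length x \<and> x ! j) \<longleftrightarrow> i < ?n" if "i < length x" for i
    proof
      assume all: "\<forall>j<i + 1. j < length x \<and> x ! j"
      show "i < ?n"
      proof (rule ccontr)
        assume "\<not> i < ?n"
        then have "?n < i + 1" "?n < length x" using that by auto
        then show False using all nth_length_takeWhile[of id x] by auto
      qed
    next
      assume i: "i < ?n"
      have "x ! j" if "j < i + 1" for j
        using that i set_takeWhileD[of "takeWhile id x ! j" id x] nth_mem[of j "takeWhile id x"] takeWhile_nth[of j id x] by simp
      then show "\<forall>j<i + 1. j < length x \<and> x ! j" using that by simp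
    qed
    then have "(\<Sum>i<length x. of_bool (\<forall>j<i + 1. j < length x \<and> x ! j)) = (\<Sum>i<length x. of_bool (i < ?n))"
      by (intro sum.cong) auto
    also have "\<dots> = min (length x) ?n" by (rule sum_of_bool_less)
    also have "\<dots> = ?n" using length_takeWhile_le[of id x] by simp
    finally show ?thesis by (simp add: gates_decode)
  qed
  ultimately show ?thesis by simp
qed

lemma poly_wire:
  assumes "poly_term A" "poly_term B"
  shows "poly_pred (\<lambda>x s. wire (decode x) (A x s) (B x s))"
  unfolding wires_decode
  by ((rule poly_pred_conj[OF poly_pred_less poly_pred_conj[OF poly_pred_less poly_pred_bit]]
      poly_term.add poly_term_mult poly_gates assms poly_term.const)+)

lemma poly_and_gates:
  assumes "poly_term A"
  shows "poly_pred (\<lambda>x s. A x s \<in> and_gates (decode x))"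
  unfolding and_gates_decode
  by ((rule poly_pred_conj[OF poly_pred_less poly_pred_bit] poly_term.add poly_term_mult poly_gates assms poly_term.const)+)

lemma poly_indegree:
  assumes "poly_term A"
  shows "poly_term (\<lambda>x s. indegree (decode x) (A x s))"
proof -
  have "poly_term (\<lambda>x s. \<Sum>j<gates (decode x). of_bool (wire (decode x) j (A x s)))"
    by (rule poly_term_sum[OF poly_gates], fold poly_pred_def)
      ((rule poly_wire poly_term.peek assms poly_term.pop)+)
  moreover have "(\<Sum>j<gates (decode x). of_bool (wire (decode x) j i)) = indegree (decode x) i" for x i
  proof -
    have "{..<gates (decode x)} \<inter> {j. wire (decode x) j i} = {j. wire (decode x) j i}"
      by (auto simp: wires_decode)
    then show ?thesis by (simp add: indegree_def)
  qed
  ultimately show ?thesis by simp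
qed

lemmas poly_rules = poly_term.const poly_term.peek poly_term.len poly_gates poly_indegree poly_term.add poly_term.sub
  poly_term_mult poly_term_power poly_term_div poly_term_mod
  poly_wire poly_and_gates poly_pred_less poly_pred_not poly_pred_conj poly_pred_disj poly_pred_imp
  poly_pred_iff poly_pred_le poly_pred_eq poly_pred_const
  poly_pred_if poly_pred_bex poly_pred_ball poly_pred_ex_bool

text \<open>For fixed \<open>m\<close> the recursion unfolds into \<open>m\<close> nested
  quantifiers over gates. Each of them pushes an index, so the induction ranges over all terms
  \<open>A\<close> for the gate.\<close>

lemma poly_depth_le: "poly_term A \<Longrightarrow> poly_pred (\<lambda>x s. depth_le (decode x) m (A x s))"
proof (induction m arbitrary: A)
  case 0
  show ?case unfolding depth_le.simps by ((rule poly_rules 0)+)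
next
  case (Suc m)
  show ?case unfolding depth_le.simps by ((rule poly_rules Suc.IH Suc.prems poly_term.pop)+)
qed

lemma poly_thin: "poly_term A \<Longrightarrow> poly_pred (\<lambda>x s. thin (decode x) m (A x s))"
proof (induction m arbitrary: A)
  case 0
  show ?case unfolding thin.simps by ((rule poly_rules)+)
next
  case (Suc m)
  show ?case unfolding thin.simps by ((rule poly_rules Suc.IH Suc.prems poly_term.pop)+)
qed

lemma poly_weft_le_1: "poly_term A \<Longrightarrow> poly_pred (\<lambda>x s. weft_le_1 (decode x) m (A x s))"
proof (induction m arbitrary: A)
  case 0
  show ?case unfolding weft_le_1.simps by ((rule poly_rules)+)
next
  case (Suc m)
  show ?case unfolding weft_le_1.simps by ((rule poly_rules Suc.IH poly_thin Suc.prems poly_term.pop)+)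
qed

lemma poly_vis_code:
  assumes "poly_term M" "poly_term D" "poly_term T" "poly_term Y" "poly_term A" "poly_term B"
  shows "poly_pred (\<lambda>x s. vis_code Q (M x s) (D x s) (T x s) (Y x s) (A x s) (B x s))"
  unfolding vis_code_def digit_def
  by ((rule poly_pred_bex_const poly_pred_conj poly_pred_eq poly_term_mod poly_term_div poly_term_power assms)+)

lemma poly_agree:
  assumes "poly_term M" "poly_term D" "poly_term T" "poly_term Y" "poly_term A" "poly_term B"
  shows "poly_pred (\<lambda>x s. agree Q (M x s) (D x s) (T x s) (Y x s) (A x s) (B x s))"
  unfolding agree_def digit_def
  by ((rule poly_pred_ball_const poly_pred_imp poly_pred_eq poly_term_mod poly_term_div poly_term_power assms)+)

lemma poly_sees:
  assumes "poly_term K" "poly_term M" "poly_term D" "poly_term T" "poly_term Y" "poly_term A"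
  shows "poly_pred (\<lambda>x s. sees (decode x) (K x s) (vis_code Q (M x s) (D x s) (T x s) (Y x s)) b (A x s))"
  unfolding sees_def
  by (cases b; simp only: if_True if_False)
    ((rule poly_pred_bex poly_pred_conj poly_vis_code poly_pred_less poly_term.add poly_gates poly_term.peek poly_term.const assms poly_term.pop)+)

lemma poly_determined:
  assumes "poly_term K" "poly_term M" "poly_term D" "poly_term T" "poly_term Y" "poly_term A"
  shows "poly_pred (\<lambda>x s. determined (decode x) (K x s) (vis_code Q (M x s) (D x s) (T x s) (Y x s)) m b (A x s))"
  using assms
proof (induction m arbitrary: b K M D T Y A)
  case 0
  show ?case unfolding determined.simps by ((rule poly_rules poly_sees 0)+)
next
  case (Suc m)
  show ?case unfolding determined.simps
    by ((rule poly_rules poly_sees Suc.IH Suc.prems poly_term.pop)+)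
qed

lemma poly_cert_bound: "poly_term (\<lambda>x s. cert_bound (gates (decode x)) m)"
proof (induction m)
  case 0
  show ?case unfolding cert_bound.simps by (rule poly_term.const)
next
  case (Suc m)
  show ?case unfolding cert_bound.simps by ((rule poly_term_mult poly_term.add poly_gates Suc.IH)+)
qed

lemma poly_refuted:
  assumes "poly_term K" "poly_term M" "poly_term D" "poly_term T" "poly_term Y" "poly_term A" "poly_term B"
  shows "poly_pred (\<lambda>x s. refuted (decode x) (K x s) (vis_code Q (M x s) (D x s) (T x s) (Y x s)) m b (A x s) (B x s))"
  using assms
proof (induction m arbitrary: b K M D T Y A B)
  case 0
  show ?case unfolding refuted.simps by ((rule poly_rules poly_sees 0)+)
next
  case (Suc m)
  show ?case unfolding refuted.simps
    by ((rule poly_rules poly_sees poly_determined poly_cert_bound Suc.IH Suc.prems poly_term.pop)+)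
qed

lemma poly_well_formed: "poly_pred (\<lambda>x s. well_formed x)"
  unfolding well_formed_def by ((rule poly_rules poly_term.pop)+)

lemma poly_good:
  assumes "poly_term K" "poly_term M" "poly_term D" "poly_term T" "poly_term Y" "poly_term E"
  shows "poly_pred (\<lambda>x s. good (decode x) (K x s) d (E x s) (vis_code Q (M x s) (D x s) (T x s) (Y x s)))"
  unfolding good_def
  by ((rule poly_rules poly_vis_code poly_refuted assms poly_term.pop)+)

section \<open>Numbering the vertices of the gadget graph\<close>

text \<open>The cases of \<open>arcE\<close> on numbers, with all indices and colours bounded; in
  this form adjacency in the gadget graph is computable by bounded sums.\<close>

definition edge_code :: "(nat \<Rightarrow> nat \<Rightarrow> nat \<Rightarrow> nat \<Rightarrow> bool) \<Rightarrow> nat \<Rightarrow> nat \<Rightarrow> nat \<Rightarrow> nat \<Rightarrow> bool" where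
  "edge_code ok K N p q \<longleftrightarrow>
    (\<exists>b c l. \<exists>i<K. \<exists>u<N. \<exists>v<N. p = code K N (Slot b i (Port c u)) \<and> q = code K N (Slot b i (Guard l v)) \<and> u \<noteq> v) \<or>
    (\<exists>b l. \<exists>i<K. \<exists>v<N. p = code K N (Slot b i (GHome l)) \<and> q = code K N (Slot b i (Guard l v))) \<or>
    (\<exists>b c. \<exists>i<K. \<exists>u<N. p = code K N (Slot b i PHome) \<and> q = code K N (Slot b i (Port c u))) \<or>
    (\<exists>b. \<exists>i<K. \<exists>u<N. p = code K N (Slot b i CHome) \<and> q = code K N (Slot b i (Port True u))) \<or>
    (\<exists>b l c. \<exists>i<K. \<exists>j<K. \<exists>u<N. p = code K N (Slot b i (GHome l)) \<and> q = code K N (Slot (\<not> b) j (Port c u))) \<or>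
    (\<exists>c c'. \<exists>i<K. \<exists>u<N. \<exists>j<K. \<exists>v<N. p = code K N (Slot False i (Port c u)) \<and> q = code K N (Slot True j (Port c' v))
       \<and> \<not> ok i u j v) \<or>
    (\<exists>i<K. p = code K N Lock_On \<and> q = code K N (Slot False i CHome)) \<or>
    (\<exists>i<K. p = code K N Lock_Off \<and> q = code K N (Slot True i CHome)) \<or>
    (\<exists>i<K. p = code K N (Pool i) \<and> q = code K N (Slot True i CHome)) \<or>
    p = code K N Lock_Off \<and> q = code K N Lock_On \<or>
    p = code K N Lock_Off \<and> q = code K N Exit \<or>
    (p = code K N Exit \<or> p = code K N Park) \<and> (q = code K N Spare \<or> (\<exists>j<K. q = code K N (Pool j)))"

definition start_code :: "nat \<Rightarrow> nat \<Rightarrow> nat \<Rightarrow> bool" where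
  "start_code K N p \<longleftrightarrow> p = code K N Lock_Off \<or> p = code K N Spare \<or> (\<exists>i<K. p = code K N (Pool i)) \<or>
    (\<exists>i<K. p = code K N (Slot False i CHome)) \<or> (\<exists>b. \<exists>i<K. p = code K N (Slot b i PHome)) \<or>
    (\<exists>b l. \<exists>i<K. p = code K N (Slot b i (GHome l)))"

definition target_code :: "nat \<Rightarrow> nat \<Rightarrow> nat \<Rightarrow> bool" where
  "target_code K N p \<longleftrightarrow> p = code K N Exit \<or> p = code K N Park \<or>
    (\<exists>i<K. p = code K N (Slot True i CHome)) \<or> (\<exists>i<K. p = code K N (Slot False i CHome)) \<or>
    (\<exists>b. \<exists>i<K. p = code K N (Slot b i PHome)) \<or> (\<exists>b l. \<exists>i<K. p = code K N (Slot b i (GHome l)))"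

context gadget
begin

lemma edge_code_iff:
  "edge_code ok K N p q \<longleftrightarrow> (\<exists>y z. valid y \<and> valid z \<and> arc y z \<and> p = code K N y \<and> q = code K N z)"
proof
  assume "edge_code ok K N p q"
  then show "\<exists>y z. valid y \<and> valid z \<and> arc y z \<and> p = code K N y \<and> q = code K N z"
    unfolding edge_code_def
    by (elim disjE exE conjE) (rule exI, rule exI, rule conjI[rotated], rule conjI[rotated], rule conjI[rotated], rule conjI, assumption, assumption, force, force, force)+
next
  assume "\<exists>y z. valid y \<and> valid z \<and> arc y z \<and> p = code K N y \<and> q = code K N z"
  then obtain y z where yz: "valid y" "valid z" "arc y z" "p = code K N y" "q = code K N z" by blast
  from yz(3) show "edge_code ok K N p q"
  proof (cases rule: arcE)
    case 1
    show ?thesis unfolding edge_code_def by (rule disjI1, use yz 1 in force)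
  next
    case 2
    show ?thesis unfolding edge_code_def by (rule disjI2, rule disjI1, use yz 2 in force)
  next
    case 3
    show ?thesis unfolding edge_code_def by (rule disjI2, rule disjI2, rule disjI1, use yz 3 in force)
  next
    case 4
    show ?thesis unfolding edge_code_def by (rule disjI2, rule disjI2, rule disjI2, rule disjI1, use yz 4 in force)
  next
    case 5
    show ?thesis unfolding edge_code_def by (rule disjI2, rule disjI2, rule disjI2, rule disjI2, rule disjI1, use yz 5 in force)
  next
    case 6
    show ?thesis unfolding edge_code_def by (rule disjI2, rule disjI2, rule disjI2, rule disjI2, rule disjI2, rule disjI1, use yz 6 in force)
  next
    case 7
    show ?thesis unfolding edge_code_def by (rule disjI2, rule disjI2, rule disjI2, rule disjI2, rule disjI2, rule disjI2, rule disjI1, use yz 7 in force)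
  next
    case 8
    show ?thesis unfolding edge_code_def by (rule disjI2, rule disjI2, rule disjI2, rule disjI2, rule disjI2, rule disjI2, rule disjI2, rule disjI1, use yz 8 in force)
  next
    case 9
    show ?thesis unfolding edge_code_def by (rule disjI2, rule disjI2, rule disjI2, rule disjI2, rule disjI2, rule disjI2, rule disjI2, rule disjI2, rule disjI1, use yz 9 in force)
  next
    case 10
    show ?thesis unfolding edge_code_def by (rule disjI2, rule disjI2, rule disjI2, rule disjI2, rule disjI2, rule disjI2, rule disjI2, rule disjI2, rule disjI2, rule disjI1, use yz 10 in force)
  next
    case 11
    show ?thesis unfolding edge_code_def by (rule disjI2, rule disjI2, rule disjI2, rule disjI2, rule disjI2, rule disjI2, rule disjI2, rule disjI2, rule disjI2, rule disjI2, rule disjI1, use yz 11 in force)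
  next
    case 12
    show ?thesis unfolding edge_code_def by (rule disjI2, rule disjI2, rule disjI2, rule disjI2, rule disjI2, rule disjI2, rule disjI2, rule disjI2, rule disjI2, rule disjI2, rule disjI2, use yz 12 in force)
  qed
qed

lemma mem_coded_edges:
  "{p, q} \<in> (`) (code K N) ` edges \<longleftrightarrow> edge_code ok K N p q \<or> edge_code ok K N q p"
proof
  assume "{p, q} \<in> (`) (code K N) ` edges"
  then obtain y z where yz: "valid y" "valid z" "adj y z" "{p, q} = {code K N y, code K N z}"
    unfolding edges_def by auto
  then have "p = code K N y \<and> q = code K N z \<or> p = code K N z \<and> q = code K N y"
    by (simp add: doubleton_eq_iff)
  then show "edge_code ok K N p q \<or> edge_code ok K N q p"
    using yz(1-3) unfolding edge_code_iff adj_def by blast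
next
  have "{p, q} \<in> (`) (code K N) ` edges" if "edge_code ok K N p q" for p q
  proof -
    obtain y z where yz: "valid y" "valid z" "arc y z" "p = code K N y" "q = code K N z"
      using \<open>edge_code ok K N p q\<close> unfolding edge_code_iff by blast
    then have "{y, z} \<in> edges" by (simp add: edges_iff adj_def)
    then show ?thesis unfolding yz(4,5) by (intro image_eqI[of _ _ "{y, z}"]) auto
  qed
  then show "edge_code ok K N p q \<or> edge_code ok K N q p \<Longrightarrow> {p, q} \<in> (`) (code K N) ` edges"
    by (metis insert_commute)
qed

lemma mem_start: "y \<in> start \<longleftrightarrow> y = Lock_Off \<or> y = Spare \<or> (\<exists>i<K. y = Pool i) \<or> (\<exists>i<K. y = Slot False i CHome) \<or>
    (\<exists>b. \<exists>i<K. y = Slot b i PHome) \<or> (\<exists>b l. \<exists>i<K. y = Slot b i (GHome l))"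
  unfolding start_def by (auto simp: image_iff)

lemma mem_target: "y \<in> target \<longleftrightarrow> y = Exit \<or> y = Park \<or> (\<exists>i<K. y = Slot True i CHome) \<or>
    (\<exists>i<K. y = Slot False i CHome) \<or> (\<exists>b. \<exists>i<K. y = Slot b i PHome) \<or> (\<exists>b l. \<exists>i<K. y = Slot b i (GHome l))"
  unfolding target_def by (auto simp: image_iff)

lemma mem_coded_start: "p \<in> code K N ` start \<longleftrightarrow> start_code K N p"
  unfolding image_iff Bex_def mem_start start_code_def
  by (simp only: conj_disj_distribR ex_disj_distrib) (intro arg_cong2[where f = "(\<or>)"]; blast)

lemma mem_coded_target: "p \<in> code K N ` target \<longleftrightarrow> target_code K N p"
  unfolding image_iff Bex_def mem_target target_code_def
  by (simp only: conj_disj_distribR ex_disj_distrib) (intro arg_cong2[where f = "(\<or>)"]; blast)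

lemma start_target_verts: "start \<subseteq> verts" "target \<subseteq> verts"
  by (auto simp: start_def target_def verts_def)

lemma coded_instance:
  assumes K: "0 < K" and N: "0 < N"
  defines "n \<equiv> 22 * K * N"
  shows "simple_graph {..<n} ((`) (code K N) ` edges)" "bipartite {..<n} ((`) (code K N) ` edges)"
    "token_sliding_yes {..<n} ((`) (code K N) ` edges) (code K N ` start) (code K N ` target) (8 * K + 2) \<longleftrightarrow> solvable"
proof -
  have inj: "inj_on (code K N) verts"
    using code_less_inj(2)[OF K N] by (auto simp: inj_on_def verts_def)
  have sub: "code K N ` verts \<subseteq> {..<n}" unfolding n_def using code_less_inj(1)[OF K N] by (auto simp: verts_def)
  have edge: "e \<subseteq> verts" if "e \<in> edges" for e using that by (auto simp: edges_def verts_def)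
  show "simple_graph {..<n} ((`) (code K N) ` edges)"
    unfolding simple_graph_def
  proof (intro conjI ballI)
    fix e' assume "e' \<in> (`) (code K N) ` edges"
    then obtain y z where yz: "valid y" "valid z" "adj y z" "e' = {code K N y, code K N z}"
      unfolding edges_def by auto
    then have "y \<noteq> z" using adj_irrefl by blast
    then have "code K N y \<noteq> code K N z" using code_less_inj(2)[OF K N] yz(1,2) by blast
    then show "\<exists>u\<in>{..<n}. \<exists>v\<in>{..<n}. u \<noteq> v \<and> e' = {u, v}"
      using yz code_less_inj(1)[OF K N] unfolding n_def by blast
  qed simp
  obtain A B where AB: "A \<union> B = verts" "A \<inter> B = {}" "\<forall>e\<in>edges. \<exists>a\<in>A. \<exists>b\<in>B. e = {a, b}"
    using bipartite_edges unfolding bipartite_def by blast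
  show "bipartite {..<n} ((`) (code K N) ` edges)"
    unfolding bipartite_def
  \<comment> \<open>Numbers that code no vertex lie on no edge and may join either side; they are
    put next to the codes of \<open>A\<close>.\<close>
  proof (rule exI[of _ "{..<n} - code K N ` B"], rule exI[of _ "code K N ` B"], intro conjI ballI)
    show "{..<n} - code K N ` B \<union> code K N ` B = {..<n}" using sub AB(1) by auto
    fix e' assume "e' \<in> (`) (code K N) ` edges"
    then obtain e where e: "e \<in> edges" "e' = code K N ` e" by blast
    then obtain a b where ab: "a \<in> A" "b \<in> B" "e = {a, b}" using AB(3) by blast
    have "code K N a \<notin> code K N ` B"
      using inj_on_image_mem_iff[OF inj, of a B] ab(1) AB(1,2) by blast
    moreover have "code K N a < n" using sub ab(1) AB(1) by auto
    ultimately show "\<exists>a\<in>{..<n} - code K N ` B. \<exists>b\<in>code K N ` B. e' = {a, b}"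
      using e(2) ab(2,3) by auto
  qed auto
  show "token_sliding_yes {..<n} ((`) (code K N) ` edges) (code K N ` start) (code K N ` target) (8 * K + 2) \<longleftrightarrow> solvable"
    using token_sliding_yes_image[OF inj sub edge start_target_verts] token_sliding_iff_solvable K by simp
qed

end

text \<open>Membership in the problem only asks for some instance with the given word. Injectivity
  makes it the intended one; edges are recovered since those of a simple graph are pairs of
  vertices.\<close>

lemma enc_ts_inject:
  assumes eq: "enc_ts n E S T = enc_ts n' E' S' T'" and simple: "simple_graph {..<n} E" "simple_graph {..<n'} E'"
    and sub: "S \<subseteq> {..<n}" "T \<subseteq> {..<n}" "S' \<subseteq> {..<n'}" "T' \<subseteq> {..<n'}"
  shows "n = n' \<and> E = E' \<and> S = S' \<and> T = T'"
proof -
  have lead: "length (takeWhile id (enc_ts n E S T)) = n" for n E S T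
    unfolding enc_ts_def enc_nat_def by (simp add: takeWhile_append)
  have n: "n' = n" using lead[of n E S T] lead[of n' E' S' T'] eq by simp
  have "{u, v} \<in> E \<longleftrightarrow> enc_ts n E S T ! (n + 1 + (u * n + v))" if "u < n" "v < n" for u v E S T
    using that pair_less_square[OF that] unfolding enc_ts_def
    by (subst nth_enc(3)) (simp_all add: enc_rel_eq enc_set_def)
  then have uv: "{u, v} \<in> E \<longleftrightarrow> {u, v} \<in> E'" if "u < n" "v < n" for u v using that eq n by metis
  have sg: "\<exists>u<n. \<exists>v<n. e = {u, v}" if "simple_graph {..<n} E" "e \<in> E" for E e
    using that unfolding simple_graph_def by blast
  have "e \<in> E \<longleftrightarrow> e \<in> E'" for e using uv sg[OF simple(1)] sg[OF simple(2)[unfolded n]] by metis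
  moreover have "i \<in> S \<longleftrightarrow> enc_ts n E S T ! (n + 1 + n * n + i)" if "i < n" for i E S T
    using that unfolding enc_ts_def by (subst nth_enc(4)) (simp_all add: enc_rel_eq enc_set_def)
  then have "i \<in> S \<longleftrightarrow> i \<in> S'" for i using sub(1) sub(3)[unfolded n] eq n by (cases "i < n") (metis, auto)
  moreover have "i \<in> T \<longleftrightarrow> enc_ts n E S T ! (n + 1 + n * n + n + i)" if "i < n" for i E S T
    using that unfolding enc_ts_def by (subst nth_enc(5)) (simp_all add: enc_rel_eq enc_set_def)
  then have "i \<in> T \<longleftrightarrow> i \<in> T'" for i using sub(2) sub(4)[unfolded n] eq n by (cases "i < n") (metis, auto)
  ultimately show ?thesis using n by blast
qed

lemma enc_ts_mem:
  assumes "simple_graph {..<n} E" "bipartite {..<n} E" "S \<subseteq> {..<n}" "T \<subseteq> {..<n}"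
  shows "(enc_ts n E S T, k) \<in> token_sliding_bipartite \<longleftrightarrow> token_sliding_yes {..<n} E S T k"
proof
  assume "(enc_ts n E S T, k) \<in> token_sliding_bipartite"
  then obtain n' E' S' T' where *: "enc_ts n E S T = enc_ts n' E' S' T'" "simple_graph {..<n'} E'"
    "token_sliding_yes {..<n'} E' S' T' k"
    unfolding token_sliding_bipartite_def by blast
  then have "S' \<subseteq> {..<n'}" "T' \<subseteq> {..<n'}" by (auto simp: token_sliding_yes_def independent_def)
  then have "n = n' \<and> E = E' \<and> S = S' \<and> T = T'" using enc_ts_inject[OF *(1) assms(1) *(2) assms(3,4)] by blast
  then show "token_sliding_yes {..<n} E S T k" using *(3) by simp
next
  assume "token_sliding_yes {..<n} E S T k"
  then show "(enc_ts n E S T, k) \<in> token_sliding_bipartite"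
    unfolding token_sliding_bipartite_def using assms by blast
qed

section \<open>The gadget graph as bounded sums\<close>

lemma poly_code_coloured:
  assumes "poly_term K" "poly_term N" "poly_term I" "poly_term U"
  shows "poly_term (\<lambda>x s. code (K x s) (N x s) (Slot b (I x s) (Port c (U x s))))"
    "poly_term (\<lambda>x s. code (K x s) (N x s) (Slot b (I x s) (Guard c (U x s))))"
  unfolding code_def tag.simps index.simps colour.simps
  by ((rule poly_term.add poly_term_mult poly_term.const assms)+)

lemma poly_code_indexed:
  assumes "poly_term K" "poly_term N" "poly_term I"
  shows "poly_term (\<lambda>x s. code (K x s) (N x s) (Slot b (I x s) (GHome c)))"
    "poly_term (\<lambda>x s. code (K x s) (N x s) (Slot b (I x s) PHome))"
    "poly_term (\<lambda>x s. code (K x s) (N x s) (Slot b (I x s) CHome))"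
    "poly_term (\<lambda>x s. code (K x s) (N x s) (Pool (I x s)))"
  unfolding code_def tag.simps index.simps colour.simps
  by ((rule poly_term.add poly_term_mult poly_term.const assms)+)

lemma poly_code_single:
  assumes "poly_term K" "poly_term N"
  shows "poly_term (\<lambda>x s. code (K x s) (N x s) Lock_On)"
    "poly_term (\<lambda>x s. code (K x s) (N x s) Lock_Off)"
    "poly_term (\<lambda>x s. code (K x s) (N x s) Exit)"
    "poly_term (\<lambda>x s. code (K x s) (N x s) Park)"
    "poly_term (\<lambda>x s. code (K x s) (N x s) Spare)"
  unfolding code_def tag.simps index.simps colour.simps
  by ((rule poly_term.add poly_term_mult poly_term.const assms)+)

lemmas poly_code = poly_code_coloured poly_code_indexed poly_code_single

text \<open>The hypothesis on \<open>ok\<close> refers to the environment below the quantifiers over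
  \<open>i\<close>, \<open>u\<close>, \<open>j\<close> and \<open>v\<close> in
  \<open>edge_code\<close>, pushed in this order, so that \<open>v\<close> is on top.\<close>

lemma poly_edge_code:
  assumes "poly_term K" "poly_term N" "poly_term A" "poly_term B"
    and ok: "poly_pred (\<lambda>x s. ok x (tl (tl (tl (tl s)))) (peek (tl (tl (tl s)))) (peek (tl (tl s))) (peek (tl s)) (peek s))"
  shows "poly_pred (\<lambda>x s. edge_code (ok x s) (K x s) (N x s) (A x s) (B x s))"
  unfolding edge_code_def
  by ((rule poly_pred_disj poly_pred_conj poly_pred_ex_bool poly_pred_bex poly_pred_eq poly_pred_not poly_code ok poly_term.peek
      assms(1-4) poly_term.pop)+)

lemma poly_start_code:
  assumes "poly_term K" "poly_term N" "poly_term A"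
  shows "poly_pred (\<lambda>x s. start_code (K x s) (N x s) (A x s))"
  unfolding start_code_def
  by ((rule poly_pred_disj poly_pred_conj poly_pred_ex_bool poly_pred_bex poly_pred_eq poly_code poly_term.peek assms poly_term.pop)+)

lemma poly_target_code:
  assumes "poly_term K" "poly_term N" "poly_term A"
  shows "poly_pred (\<lambda>x s. target_code (K x s) (N x s) (A x s))"
  unfolding target_code_def
  by ((rule poly_pred_disj poly_pred_conj poly_pred_ex_bool poly_pred_bex poly_pred_eq poly_code poly_term.peek assms poly_term.pop)+)

section \<open>The reduction\<close>

abbreviation views :: "nat \<Rightarrow> nat" where
  "views d \<equiv> 2 * 2 ^ d + 1"

definition range_size :: "nat \<Rightarrow> bool list \<Rightarrow> nat" where
  "range_size d x = gates (decode x) + 2 + cert_bound (gates (decode x)) d"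

text \<open>The tests of the word are conjoined to every constraint. A word that encodes no circuit
  of weft 1 and depth \<open>d\<close> thus yields an unsolvable instance, without a special case in
  the program.\<close>

definition compatible :: "nat \<Rightarrow> bool list \<Rightarrow> nat \<Rightarrow> nat \<Rightarrow> nat \<Rightarrow> nat \<Rightarrow> nat \<Rightarrow> bool" where
  "compatible d x k t w t' w' \<longleftrightarrow> agree (views d) (k + 3) (range_size d x) t w t' w' \<and>
    (well_formed x \<and> depth_le (decode x) d (gates (decode x) - 1) \<and> weft_le_1 (decode x) d (gates (decode x) - 1) \<and>
     good (decode x) k d (range_size d x) (vis_code (views d) (k + 3) (range_size d x) t w))"

text \<open>This number enters the parameter, so it may depend on \<open>k\<close> and
  \<open>d\<close> only, whereas the number of colours may grow polynomially with the word.\<close>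

abbreviation classes :: "nat \<Rightarrow> nat \<Rightarrow> nat" where
  "classes d k \<equiv> (k + 3) ^ views d"

abbreviation colours :: "nat \<Rightarrow> bool list \<Rightarrow> nat" where
  "colours d x \<equiv> range_size d x ^ views d"

lemma solvable_compatible:
  "gadget.solvable (compatible d x k) (classes d k) (colours d x) \<longleftrightarrow> (x, k) \<in> weighted_circuit_sat 1 d"
proof -
  let ?Q = "views d" and ?M = "k + 3" and ?D = "range_size d x"
  let ?B = "well_formed x \<and> depth_le (decode x) d (gates (decode x) - 1) \<and> weft_le_1 (decode x) d (gates (decode x) - 1)"
  let ?P = "\<lambda>vis. ?B \<and> good (decode x) k d ?D vis"
  let ?S = "\<lambda>P. \<exists>s. (\<forall>a<?M. s a < ?D) \<and> (\<forall>V. V \<subseteq> {..<?M} \<and> V \<noteq> {} \<and> card V \<le> ?Q \<longrightarrow> P (vis_of s V))"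
  have "compatible d x k = (\<lambda>t w t' w'. agree ?Q ?M ?D t w t' w' \<and> ?P (vis_code ?Q ?M ?D t w))"
    by (intro ext) (simp add: compatible_def)
  moreover have "0 < ?D" by (simp add: range_size_def)
  ultimately have "gadget.solvable (compatible d x k) (classes d k) (colours d x) \<longleftrightarrow> ?S ?P"
    using solvable_iff_local[of ?Q ?M ?D ?P] by simp
  also have "\<dots> \<longleftrightarrow> ?B \<and> ?S (good (decode x) k d ?D)"
  proof
    assume "?S ?P"
    then obtain s where s: "\<forall>a<?M. s a < ?D" "\<forall>V. V \<subseteq> {..<?M} \<and> V \<noteq> {} \<and> card V \<le> ?Q \<longrightarrow> ?P (vis_of s V)"
      by (elim exE conjE)
    \<comment> \<open>Any nonempty view carries the tests of the word, which themselves do not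
      depend on the view.\<close>
    have "?P (vis_of s {0})" using spec[OF s(2), of "{0}"] by simp
    then have ?B by (elim conjE) (intro conjI)
    moreover have "\<forall>V. V \<subseteq> {..<?M} \<and> V \<noteq> {} \<and> card V \<le> ?Q \<longrightarrow> good (decode x) k d ?D (vis_of s V)"
      using s(2) by simp
    ultimately show "?B \<and> ?S (good (decode x) k d ?D)" using s(1) by blast
  next
    assume a: "?B \<and> ?S (good (decode x) k d ?D)"
    then obtain s where s: "\<forall>a<?M. s a < ?D" "\<forall>V. V \<subseteq> {..<?M} \<and> V \<noteq> {} \<and> card V \<le> ?Q \<longrightarrow> good (decode x) k d ?D (vis_of s V)"
      by (elim exE conjE)
    then have "\<forall>V. V \<subseteq> {..<?M} \<and> V \<noteq> {} \<and> card V \<le> ?Q \<longrightarrow> ?P (vis_of s V)" using a by simp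
    then show "?S ?P" using s(1) by (intro exI[of _ s] conjI)
  qed
  also have "\<dots> \<longleftrightarrow> (x, k) \<in> weighted_circuit_sat 1 d"
  proof (cases ?B)
    case True
    then show ?thesis
      using satisfiable_iff_good[OF wf_decode[of x], of d "range_size d x" k] unfolding weighted_circuit_sat_iff range_size_def
      by blast
  next
    case False
    then show ?thesis unfolding weighted_circuit_sat_iff by blast
  qed
  finally show ?thesis .
qed

lemma poly_range_size: "poly_term (\<lambda>x s. range_size d x)"
  unfolding range_size_def by ((rule poly_term.add poly_gates poly_cert_bound poly_term.const)+)

lemma poly_compatible:
  assumes "poly_term A" "poly_term T" "poly_term Y" "poly_term T'" "poly_term Y'"
  shows "poly_pred (\<lambda>x s. compatible d x (A x s) (T x s) (Y x s) (T' x s) (Y' x s))"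
  unfolding compatible_def
  by ((rule poly_pred_conj poly_agree poly_well_formed poly_depth_le poly_weft_le_1 poly_good poly_range_size
      poly_term.sub poly_gates poly_term.add poly_term.const assms)+)

lemma poly_edge_compatible:
  assumes "poly_term A" "poly_term P" "poly_term Q"
  shows "poly_pred (\<lambda>x s. edge_code (compatible d x (A x s)) (classes d (A x s)) (colours d x) (P x s) (Q x s))"
  by (rule poly_edge_code[where ok = "\<lambda>x s. compatible d x (A x s)"])
    ((rule poly_compatible poly_term_power poly_range_size poly_term.add poly_term.const poly_term.peek assms poly_term.pop)+)

definition vertices :: "nat \<Rightarrow> bool list \<Rightarrow> nat \<Rightarrow> nat" where
  "vertices d x k = 22 * classes d k * colours d x"

definition word_length :: "nat \<Rightarrow> bool list \<Rightarrow> nat \<Rightarrow> nat" where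
  "word_length d x k = (let n = vertices d x k in n + 1 + n * n + n + n)"

definition word_bit :: "nat \<Rightarrow> bool list \<Rightarrow> nat \<Rightarrow> nat \<Rightarrow> bool" where
  "word_bit d x i k \<longleftrightarrow> i < vertices d x k \<or>
    (\<exists>u<vertices d x k. \<exists>v<vertices d x k. i = vertices d x k + 1 + (u * vertices d x k + v) \<and>
       (edge_code (compatible d x k) (classes d k) (colours d x) u v \<or>
        edge_code (compatible d x k) (classes d k) (colours d x) v u)) \<or>
    (\<exists>u<vertices d x k. i = vertices d x k + 1 + vertices d x k * vertices d x k + u \<and>
       start_code (classes d k) (colours d x) u) \<or>
    (\<exists>u<vertices d x k. i = vertices d x k + 1 + vertices d x k * vertices d x k + vertices d x k + u \<and>
       target_code (classes d k) (colours d x) u)"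

lemma poly_vertices: "poly_term A \<Longrightarrow> poly_term (\<lambda>x s. vertices d x (A x s))"
  unfolding vertices_def
  by (assumption | rule poly_term_mult poly_term_power poly_term.add poly_range_size poly_term.const)+

lemma poly_word_length: "poly_term (\<lambda>x s. word_length d x (peek s))"
  unfolding word_length_def Let_def
  by ((rule poly_term_mult poly_term.add poly_vertices poly_term.peek poly_term.const)+)

lemma poly_word_bit: "poly_pred (\<lambda>x s. word_bit d x (peek s) (peek (tl s)))"
  unfolding word_bit_def
  by ((rule poly_pred_disj poly_pred_conj poly_pred_bex poly_pred_less poly_pred_eq poly_edge_compatible poly_start_code
      poly_target_code poly_vertices poly_range_size poly_term_power poly_term_mult poly_term.add poly_term.const poly_term.peek
      poly_term.pop)+)

lemma mem_word:
  "(map (\<lambda>i. word_bit d x i k) [0..<word_length d x k], 8 * classes d k + 2) \<in> token_sliding_bipartite \<longleftrightarrow>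
    (x, k) \<in> weighted_circuit_sat 1 d"
proof -
  let ?K = "classes d k" and ?N = "colours d x"
  interpret gadget "compatible d x k" ?K ?N .
  have pos: "0 < ?K" "0 < ?N" by (simp_all add: range_size_def)
  let ?n = "vertices d x k" and ?E = "(`) (code ?K ?N) ` edges" and ?S = "code ?K ?N ` start" and ?T = "code ?K ?N ` target"
  note inst = coded_instance[OF pos, folded vertices_def]
  have sub: "?S \<subseteq> {..<?n}" "?T \<subseteq> {..<?n}"
    using start_target_verts code_less_inj(1)[OF pos] unfolding vertices_def verts_def by blast+
  have "map (\<lambda>i. word_bit d x i k) [0..<word_length d x k] = enc_ts ?n ?E ?S ?T"
    unfolding enc_ts_eq mem_coded_edges mem_coded_start mem_coded_target word_bit_def word_length_def Let_def ..
  then show ?thesis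
    using enc_ts_mem[OF inst(1,2) sub] inst(3) solvable_compatible by simp
qed

theorem theorem29: "W_hard 1 token_sliding_bipartite"
  unfolding W_hard_def
proof
  fix L assume "L \<in> Defs.W 1"
  then obtain d where red: "fpt_reducible L (weighted_circuit_sat 1 d)" unfolding W_def by blast
  show "fpt_reducible L token_sliding_bipartite"
  proof (rule fpt_reducible_poly[OF red poly_word_length[of d] poly_word_bit[of d, unfolded poly_pred_def]])
    show "poly_term (\<lambda>x s. 8 * classes d (peek s) + 2)"
      by ((rule poly_term_mult poly_term_power poly_term.add poly_term.peek poly_term.const)+)
    show "mono (\<lambda>k. 8 * classes d k + 2)"
      by (intro monoI add_right_mono mult_le_mono2 power_mono) auto
  next
    fix x :: "bool list" and k :: nat
    show "8 * classes d (peek [k]) + 2 = 8 * classes d k + 2" by simp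
    show "(x, k) \<in> weighted_circuit_sat 1 d \<longleftrightarrow>
      (map (\<lambda>i. of_bool (word_bit d x (peek [i, k]) (peek (tl [i, k]))) \<noteq> (0::nat)) [0..<word_length d x (peek [k])],
       8 * classes d k + 2) \<in> token_sliding_bipartite"
      using mem_word[of d x k] by simp
  qed
qed

end
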